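(* Let $k\geq0$ be an integer and $(u_0,v_0)\in L^{2,k}_{\mathcal{E}}\times L^{2,k}_{\mathcal{E}}$. Then there exists a unique solution $(u,v)\in\mathcal{C}^\infty\big(\mathbb{R},L^{2,k}_{\mathcal{E}}\times L^{2,k}_{\mathcal{E}}\big)$ to the system $$i\partial_t u=\Pi(|v|^2u),\qquad i\partial_t v=-\Pi(|u|^2v),\qquad u(0,\cdot)=u_0,\quad v(0,\cdot)=v_0,$$ and it satisfies, for all $t\in\mathbb{R}$, $$\|\langle z\rangle^ku(t)\|_{L^2(\mathbb{C})}\leq\|\langle z\rangle^ku_0\|_{L^2(\mathbb{C})}\big(1+C\|v_0\|^2_{L^2(\mathbb{C})}|t|\big)^k,$$ $$\|\langle z\rangle^kv(t)\|_{L^2(\mathbb{C})}\leq\|\langle z\rangle^kv_0\|_{L^2(\mathbb{C})}\big(1+C\|u_0\|^2_{L^2(\mathbb{C})}|t|\big)^k,$$ where $C>0$ is a constant depending only on $k$ (not on $t$, $u_0$, $v_0$). Moreover, for all $t\in\mathbb{R}$, $$\Big|\,\|\langle z\rangle^ku(t)\|^2_{L^2(\mathbb{C})}-\|\langle z\rangle^kv(t)\|^2_{L^2(\mathbb{C})}\Big|\lesssim(1+|t|)^{2k-1}\quad\text{if } k\geq2,$$ $$\Big|\,\|\langle z\rangle^ku(t)\|^2_{L^2(\mathbb{C})}-\|\langle z\rangle^kv(t)\|^2_{L^2(\mathbb{C})}\Big|\lesssim1\quad\text{if } k=0,1.$$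
   Context: $L$ is Lebesgue measure on $\mathbb{C}$ and $\langle z\rangle=(1+|z|^2)^{1/2}$. The Bargmann-Fock space is $\mathcal{E}=\{u(z)=e^{-|z|^2/2}f(z):\ f \text{ entire holomorphic}\}\cap L^2(\mathbb{C})$. For $s\ge0$, $L^{2,s}_{\mathcal{E}}=\{u\in\mathcal{E}:\ \langle z\rangle^su\in L^2(\mathbb{C})\}$, with norm $\|\langle z\rangle^su\|_{L^2(\mathbb{C})}$. $\Pi$ is the orthogonal projection onto $\mathcal{E}$, given by $[\Pi u](z)=\frac1\pi e^{-|z|^2/2}\int_{\mathbb{C}}e^{\overline{w}z-|w|^2/2}u(w)\,dL(w)$. The notation $A(t)\lesssim B(t)$ means $A(t)\le C'B(t)$ for all $t\in\mathbb{R}$, with $C'$ a constant that may depend on $k$ and on the initial data $(u_0,v_0)$ but not on $t$. *)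

theory Defs
  imports "HOL-Analysis.Analysis"
begin

definition japanese_bracket :: "complex \<Rightarrow> real" where
  "japanese_bracket z = sqrt (1 + (cmod z)\<^sup>2)"

definition square_integrable :: "(complex \<Rightarrow> complex) \<Rightarrow> bool" where
  "square_integrable f \<longleftrightarrow>
     f \<in> borel_measurable lborel \<and> integrable lborel (\<lambda>z. (cmod (f z))\<^sup>2)"

(* Meaningful only for square integrable functions: otherwise the integral is 0 by convention. *)
definition L2_norm :: "(complex \<Rightarrow> complex) \<Rightarrow> real" where
  "L2_norm f = sqrt (\<integral>z. (cmod (f z))\<^sup>2 \<partial>lborel)"

(* Elements are functions, not classes modulo null sets: each class in the Bargmann-Fock space
   has exactly one representative of this form, so equality of functions is equality there. *)
definition bargmann_fock :: "(complex \<Rightarrow> complex) set" where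
  "bargmann_fock =
     {u. (\<exists>f. f holomorphic_on UNIV \<and>
              (\<forall>z. u z = complex_of_real (exp (- (cmod z)\<^sup>2 / 2)) * f z)) \<and>
         square_integrable u}"

definition weighted :: "real \<Rightarrow> (complex \<Rightarrow> complex) \<Rightarrow> complex \<Rightarrow> complex" where
  "weighted s u z = complex_of_real (japanese_bracket z powr s) * u z"

definition weighted_fock :: "real \<Rightarrow> (complex \<Rightarrow> complex) set" where
  "weighted_fock s = {u \<in> bargmann_fock. square_integrable (weighted s u)}"

definition weighted_norm :: "real \<Rightarrow> (complex \<Rightarrow> complex) \<Rightarrow> real" where
  "weighted_norm s u = L2_norm (weighted s u)"

(* Integral formula, via the reproducing kernel, for the orthogonal projection of L^2
   onto bargmann_fock. *)
definition fock_projection :: "(complex \<Rightarrow> complex) \<Rightarrow> complex \<Rightarrow> complex" where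
  "fock_projection u z =
     complex_of_real (1 / pi * exp (- (cmod z)\<^sup>2 / 2)) *
     (\<integral>w. exp (cnj w * z - complex_of_real ((cmod w)\<^sup>2 / 2)) * u w \<partial>lborel)"

(* Differentiability at time t of a curve with values in the normed space weighted_fock s.
   The membership conditions ensure that weighted_norm is only applied to elements of that space. *)
definition has_fock_derivative ::
    "real \<Rightarrow> (real \<Rightarrow> complex \<Rightarrow> complex) \<Rightarrow> (complex \<Rightarrow> complex) \<Rightarrow> real \<Rightarrow> bool" where
  "has_fock_derivative s u u' t \<longleftrightarrow>
     (\<forall>\<tau>. u \<tau> \<in> weighted_fock s) \<and> u' \<in> weighted_fock s \<and>
     ((\<lambda>h. weighted_norm s (\<lambda>z. (u (t + h) z - u t z) / complex_of_real h - u' z))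
        \<longlongrightarrow> 0) (at 0)"

(* D n is the n-th time derivative of u. *)
definition smooth_fock_curve :: "real \<Rightarrow> (real \<Rightarrow> complex \<Rightarrow> complex) \<Rightarrow> bool" where
  "smooth_fock_curve s u \<longleftrightarrow>
     (\<exists>D :: nat \<Rightarrow> real \<Rightarrow> complex \<Rightarrow> complex.
        D 0 = u \<and> (\<forall>n t. has_fock_derivative s (D n) (D (Suc n) t) t))"

(* Smoothness and time derivatives of a curve in a product of two normed spaces
   are taken componentwise. *)
definition is_smooth_solution ::
    "real \<Rightarrow> (complex \<Rightarrow> complex) \<Rightarrow> (complex \<Rightarrow> complex) \<Rightarrow>
     (real \<Rightarrow> complex \<Rightarrow> complex) \<Rightarrow> (real \<Rightarrow> complex \<Rightarrow> complex) \<Rightarrow> bool" where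
  "is_smooth_solution s u0 v0 u v \<longleftrightarrow>
     smooth_fock_curve s u \<and> smooth_fock_curve s v \<and>
     (\<forall>t. \<exists>u' v'. has_fock_derivative s u u' t \<and> has_fock_derivative s v v' t \<and>
        (\<forall>z. \<i> * u' z =
               fock_projection (\<lambda>w. complex_of_real ((cmod (v t w))\<^sup>2) * u t w) z) \<and>
        (\<forall>z. \<i> * v' z =
               - fock_projection (\<lambda>w. complex_of_real ((cmod (u t w))\<^sup>2) * v t w) z)) \<and>
     u 0 = u0 \<and> v 0 = v0"

end

theory Submission
  imports Defs "HOL-Complex_Analysis.Complex_Analysis" "HOL-Real_Asymp.Real_Asymp"
begin

text \<open>
  With \<open>T(a, b, c) = -i \<Pi>(a conj(b) c)\<close> the system reads \<open>u' = T(v, v, u)\<close>, \<open>v' = - T(u, u, v)\<close>.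
  Two properties of the Fock space carry the argument. The kernel of \<open>\<Pi>\<close> has modulus
  \<open>exp(-|z - w|^2 / 2) / \<pi>\<close>, so that \<open>\<Pi>\<close> is bounded for every polynomial weight
  (\<open>fock_projection_weigh\<close>); and \<open>\<Pi>\<close> reproduces the elements of the space
  (\<open>fock_reproducing\<close>), which are therefore bounded pointwise by their norm. Consequently every
  weighted norm of \<open>T(a, b, c)\<close> is controlled by \<open>||a|| ||b||\<close> times the same weighted norm of \<open>c\<close>.

  Existence and uniqueness are settled in the unweighted space. Since \<open>\<Pi>\<close> is symmetric and
  \<open>|v|^2\<close> is real, \<open>||u(t)||\<close> and \<open>||v(t)||\<close> are constant. The vector field may thus be clipped at the
  size of the data, which makes it bounded and globally Lipschitz without changing the solution
  (\<open>fock_solution_exists\<close>, \<open>fock_solution_unique\<close>). All weighted statements are then proved along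
  this one solution. They are first proved for the bounded weight \<open>min <z> R\<close>, for which the
  weighted inner product is continuous on the unweighted space and can be differentiated along the
  solution; the estimates are uniform in \<open>R\<close>, and Fatou's lemma removes \<open>R\<close>.
  Smoothness in the weighted norm follows in the same way from Taylor's formula: a curve whose second
  derivative is locally bounded in the weighted norm has difference quotients that converge in it
  (\<open>weighted_derivative_lift\<close>).

  For the growth bound, half the derivative of \<open>||\<omega>^k u||^2\<close> is
  \<open>Im \<integral> \<omega>^(2k) conj(u) \<Pi>(|v|^2 u)\<close>. Subtracting the real number \<open>\<integral> \<omega>^(2k) |u|^2 |v|^2\<close> replaces the weight
  by \<open>\<omega>(z)^(2k) - \<omega>(w)^(2k)\<close> in a double integral against the kernel. This gains one power of
  \<open>\<omega>\<close> for a factor \<open>|z - w|\<close>, which the Gaussian absorbs (\<open>weighted_current_bound\<close>). So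
  \<open>||\<omega>^k u||\<close> grows at a rate of at most \<open>C ||v||^2 ||\<omega>^(k-1) u||\<close>, and the bound follows by
  induction on \<open>k\<close> (\<open>growth_forward\<close>).

  In the difference of the two squared norms one more order cancels. Write \<open>u\<close> and \<open>v\<close> as the Gaussian
  \<open>exp(-|z|^2 / 2)\<close> times entire functions \<open>f\<close> and \<open>h\<close>. The linear term in the Taylor expansion of
  \<open><z>^(2k)\<close> contributes to the derivative of the difference the integral of a radial function times
  the angular derivative of \<open>|f h|^2\<close>, and this vanishes
  (\<open>radial_angular_derivative_real\<close>, \<open>current_cancellation\<close>). The remainder is bounded by the squares of
  the weighted norms of order \<open>k - 1\<close>, that is by \<open>(1 + |t|)^(2k - 2)\<close>. For \<open>k \<le> 1\<close> the weight is an
  affine function of \<open>|z|^2\<close>; there is no remainder, and the difference is constant.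
\<close>

section \<open>Lebesgue measure on the complex plane\<close>

lemma nn_integral_lborel_translate:
  fixes f :: "complex \<Rightarrow> ennreal"
  assumes [measurable]: "f \<in> borel_measurable borel"
  shows "(\<integral>\<^sup>+x. f (x + a) \<partial>lborel) = (\<integral>\<^sup>+x. f x \<partial>lborel)"
proof -
  have "(\<integral>\<^sup>+x. f x \<partial>lborel) = (\<integral>\<^sup>+x. f x \<partial>distr lborel borel ((+) a))"
    by (simp add: lborel_distr_plus)
  also have "\<dots> = (\<integral>\<^sup>+x. f (a + x) \<partial>lborel)"
    by (subst nn_integral_distr) auto
  finally show ?thesis by (simp add: add.commute)
qed

text \<open>
  The argument for the uniqueness of Haar measure. For \<open>g\<close> the indicator of the unit disc, the
  double integral of \<open>f(c x + y) g(y)\<close> is computed in both orders by translations only; since the disc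
  is invariant under rotations and reflection, this gives the product of the integrals of \<open>f\<close> and \<open>g\<close>
  on one side and of \<open>f(c x)\<close> and \<open>g\<close> on the other.
\<close>

lemma nn_integral_lborel_unit_mult:
  fixes f :: "complex \<Rightarrow> ennreal"
  assumes [measurable]: "f \<in> borel_measurable borel" and c: "cmod c = 1"
  shows "(\<integral>\<^sup>+x. f (c * x) \<partial>lborel) = (\<integral>\<^sup>+x. f x \<partial>lborel)"
proof -
  have c0: "c \<noteq> 0" using c by auto
  define g :: "complex \<Rightarrow> ennreal" where "g = indicator (cball 0 1)"
  have [measurable]: "g \<in> borel_measurable borel" unfolding g_def by (intro borel_measurable_indicator) simp
  have g_inv: "g (- (c * x)) = g x" for x
    using c by (auto simp: g_def indicator_def norm_mult)
  have g_int: "(\<integral>\<^sup>+x. g x \<partial>lborel) = ennreal pi"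
    unfolding g_def by (simp add: emeasure_cball unit_ball_vol_2)
  have "(\<integral>\<^sup>+x. f (c * x) \<partial>lborel) * (\<integral>\<^sup>+y. g y \<partial>lborel)
      = (\<integral>\<^sup>+y. (\<integral>\<^sup>+x. f (c * x) * g y \<partial>lborel) \<partial>lborel)"
    by (simp add: nn_integral_cmult nn_integral_multc)
  also have "\<dots> = (\<integral>\<^sup>+y. (\<integral>\<^sup>+x. f (c * x + y) * g y \<partial>lborel) \<partial>lborel)"
  proof (rule nn_integral_cong)
    fix y
    have "(\<integral>\<^sup>+x. f (c * x) * g y \<partial>lborel) = (\<integral>\<^sup>+x. f (c * (x + y / c)) * g y \<partial>lborel)"
      by (rule nn_integral_lborel_translate[symmetric]) simp
    then show "(\<integral>\<^sup>+x. f (c * x) * g y \<partial>lborel) = (\<integral>\<^sup>+x. f (c * x + y) * g y \<partial>lborel)"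
      using c0 by (simp add: distrib_left)
  qed
  also have "\<dots> = (\<integral>\<^sup>+x. (\<integral>\<^sup>+y. f (c * x + y) * g y \<partial>lborel) \<partial>lborel)"
    by (rule lborel_pair.Fubini'[symmetric]) measurable
  also have "\<dots> = (\<integral>\<^sup>+x. (\<integral>\<^sup>+y. f y * g (y - c * x) \<partial>lborel) \<partial>lborel)"
  proof (rule nn_integral_cong)
    fix x
    show "(\<integral>\<^sup>+y. f (c * x + y) * g y \<partial>lborel) = (\<integral>\<^sup>+y. f y * g (y - c * x) \<partial>lborel)"
      using nn_integral_lborel_translate[of "\<lambda>y. f y * g (y - c * x)" "c * x"]
      by (simp add: add.commute)
  qed
  also have "\<dots> = (\<integral>\<^sup>+y. (\<integral>\<^sup>+x. f y * g (y - c * x) \<partial>lborel) \<partial>lborel)"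
    by (rule lborel_pair.Fubini') measurable
  also have "\<dots> = (\<integral>\<^sup>+y. (\<integral>\<^sup>+x. f y * g x \<partial>lborel) \<partial>lborel)"
  proof (rule nn_integral_cong)
    fix y
    have "(\<integral>\<^sup>+x. f y * g (y - c * x) \<partial>lborel) = (\<integral>\<^sup>+x. f y * g (y - c * (x + y / c)) \<partial>lborel)"
      by (rule nn_integral_lborel_translate[symmetric]) simp
    then show "(\<integral>\<^sup>+x. f y * g (y - c * x) \<partial>lborel) = (\<integral>\<^sup>+x. f y * g x \<partial>lborel)"
      using c0 by (simp add: distrib_left g_inv)
  qed
  also have "\<dots> = (\<integral>\<^sup>+x. f x \<partial>lborel) * (\<integral>\<^sup>+y. g y \<partial>lborel)"
    by (simp add: nn_integral_cmult nn_integral_multc)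
  finally have "(\<integral>\<^sup>+x. f (c * x) \<partial>lborel) * ennreal pi = (\<integral>\<^sup>+x. f x \<partial>lborel) * ennreal pi"
    unfolding g_int .
  then show ?thesis
    using pi_gt_zero by (auto simp: mult.commute[of _ "ennreal pi"] ennreal_mult_cancel_left ennreal_eq_0_iff simp del: pi_gt_zero)
qed

lemma lborel_distr_unit_mult:
  assumes "cmod c = 1"
  shows "distr lborel borel (\<lambda>x. c * x) = (lborel :: complex measure)"
proof (rule measure_eqI)
  fix A :: "complex set" assume "A \<in> sets (distr lborel borel ((*) c))"
  then have A[measurable]: "A \<in> sets borel" by simp
  show "emeasure (distr lborel borel ((*) c)) A = emeasure lborel A"
    using nn_integral_lborel_unit_mult[OF _ assms, of "indicator A"] A
    by (simp add: nn_integral_distr flip: nn_integral_indicator)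
qed simp

lemma nn_integral_lborel_reflect:
  fixes f :: "complex \<Rightarrow> ennreal"
  assumes [measurable]: "f \<in> borel_measurable borel"
  shows "(\<integral>\<^sup>+w. f (z - w) \<partial>lborel) = (\<integral>\<^sup>+w. f w \<partial>lborel)"
  using nn_integral_lborel_unit_mult[of "\<lambda>w. f (z + w)" "-1"]
    nn_integral_lborel_translate[of f z] by (simp add: add.commute)

lemma integral_lborel_translate:
  fixes f :: "complex \<Rightarrow> complex"
  assumes [measurable]: "f \<in> borel_measurable borel"
  shows "(\<integral>x. f (x + a) \<partial>lborel) = (\<integral>x. f x \<partial>lborel)"
proof -
  have "(\<integral>x. f x \<partial>lborel) = (\<integral>x. f x \<partial>distr lborel borel ((+) a))"
    by (simp add: lborel_distr_plus)
  also have "\<dots> = (\<integral>x. f (a + x) \<partial>lborel)"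
    by (subst integral_distr) auto
  finally show ?thesis by (simp add: add.commute)
qed

lemma integrable_lborel_translate:
  fixes f :: "complex \<Rightarrow> complex"
  assumes f: "integrable lborel f"
  shows "integrable lborel (\<lambda>x. f (x + a))"
proof -
  have [measurable]: "f \<in> borel_measurable borel" using f by auto
  have "integrable (distr lborel borel ((+) a)) f" using f by (simp add: lborel_distr_plus)
  then show ?thesis by (subst (asm) integrable_distr_eq) (auto simp: add.commute)
qed

lemma integral_lborel_unit_mult:
  fixes f :: "complex \<Rightarrow> complex"
  assumes [measurable]: "f \<in> borel_measurable borel" and c: "cmod c = 1"
  shows "(\<integral>x. f (c * x) \<partial>lborel) = (\<integral>x. f x \<partial>lborel)"
proof -
  have "(\<integral>x. f x \<partial>lborel) = (\<integral>x. f x \<partial>distr lborel borel ((*) c))"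
    using lborel_distr_unit_mult[OF c] by simp
  also have "\<dots> = (\<integral>x. f (c * x) \<partial>lborel)"
    by (subst integral_distr) auto
  finally show ?thesis by simp
qed

text \<open>
  Only the area of discs is needed: \<open>exp(-c |w|^2)\<close> is the integral of \<open>c exp(-c r)\<close> over
  \<open>r \<ge> |w|^2\<close>, and for fixed \<open>r\<close> the points with \<open>|w|^2 \<le> r\<close> have area \<open>\<pi> r\<close>.
\<close>

lemma nn_integral_gaussian:
  assumes c: "c > 0"
  shows "(\<integral>\<^sup>+w. ennreal (exp (- c * (cmod w)\<^sup>2)) \<partial>lborel) = ennreal (pi / c)"
proof -
  have tail: "(\<integral>\<^sup>+r. ennreal (c * exp (- c * r)) * indicator {a..} r \<partial>lborel) = ennreal (exp (- c * a))" for a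
  proof -
    have "((\<lambda>r. - exp (- c * r)) \<longlongrightarrow> 0) at_top" using c by real_asymp
    then have "(\<integral>\<^sup>+r. ennreal (c * exp (- c * r)) * indicator {a..} r \<partial>lborel) = ennreal (0 - - exp (- c * a))"
      using c by (intro nn_integral_FTC_atLeast[where F = "\<lambda>r. - exp (- c * r)"])
        (auto intro!: derivative_eq_intros)
    then show ?thesis by simp
  qed
  have "(\<integral>\<^sup>+w. ennreal (exp (- c * (cmod w)\<^sup>2)) \<partial>lborel)
     = (\<integral>\<^sup>+w. (\<integral>\<^sup>+r. ennreal (c * exp (- c * r)) * indicator {(cmod w)\<^sup>2..} r \<partial>lborel) \<partial>lborel)"
    by (simp only: tail)
  also have "\<dots> = (\<integral>\<^sup>+w. (\<integral>\<^sup>+r. ennreal (c * exp (- c * r)) * (if (cmod w)\<^sup>2 \<le> r then 1 else 0) \<partial>lborel) \<partial>lborel)"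
    by (intro nn_integral_cong) (auto simp: indicator_def)
  also have "\<dots> = (\<integral>\<^sup>+r. (\<integral>\<^sup>+w. ennreal (c * exp (- c * r)) * (if (cmod w)\<^sup>2 \<le> r then 1 else 0) \<partial>lborel) \<partial>lborel)"
    by (rule lborel_pair.Fubini') measurable
  also have "\<dots> = (\<integral>\<^sup>+r. ennreal (pi * c * r * exp (- c * r)) * indicator {0..} r \<partial>lborel)"
  proof (rule nn_integral_cong)
    fix r :: real
    show "(\<integral>\<^sup>+w. ennreal (c * exp (- c * r)) * (if (cmod w)\<^sup>2 \<le> r then 1 else 0) \<partial>lborel)
        = ennreal (pi * c * r * exp (- c * r)) * indicator {0..} r"
    proof (cases "r \<ge> 0")
      case True
      have "(\<integral>\<^sup>+w. ennreal (c * exp (- c * r)) * (if (cmod w)\<^sup>2 \<le> r then 1 else 0) \<partial>lborel)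
          = (\<integral>\<^sup>+w. ennreal (c * exp (- c * r)) * indicator (cball (0::complex) (sqrt r)) w \<partial>lborel)"
        using True by (intro nn_integral_cong)
          (auto simp: indicator_def real_le_rsqrt intro: power2_le_iff_abs_le[THEN iffD1] dest: power_mono[where n = 2])
      also have "\<dots> = ennreal (c * exp (- c * r)) * ennreal (pi * r)"
        using True by (subst nn_integral_cmult_indicator) (simp_all add: emeasure_cball unit_ball_vol_2)
      also have "\<dots> = ennreal (pi * c * r * exp (- c * r)) * indicator {0..} r"
        using True c by (simp add: ennreal_mult[symmetric] mult_ac)
      finally show ?thesis .
    next
      case False
      then have "\<not> (cmod w)\<^sup>2 \<le> r" for w
        using zero_le_power2[of "cmod w"] by linarith
      then show ?thesis using False by simp
    qed
  qed
  also have "\<dots> = ennreal (0 - (- pi * (0 + 1 / c) * exp (- c * 0)))"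
  proof (rule nn_integral_FTC_atLeast)
    show "((\<lambda>r. - pi * (r + 1 / c) * exp (- c * r)) \<longlongrightarrow> 0) at_top" using c by real_asymp
    show "((\<lambda>r. - pi * (r + 1 / c) * exp (- c * r)) has_real_derivative pi * c * r * exp (- c * r)) (at r)" for r
      using c by (auto intro!: derivative_eq_intros simp: field_simps)
  qed (use c in auto)
  finally show ?thesis by simp
qed

text \<open>
  The polynomial is at most \<open>n! exp(1 + |w|)\<close>, and half of the Gaussian absorbs that exponential.
\<close>

lemma integrable_poly_gaussian:
  assumes c: "c > 0"
  shows "integrable lborel (\<lambda>w::complex. (1 + cmod w) ^ n * exp (- c * (cmod w)\<^sup>2))"
proof -
  define d where "d = c / 2"
  have d: "d > 0" using c by (simp add: d_def)
  define C where "C = fact n * exp (1 + 1 / (4 * d))"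
  have bound: "(1 + r) ^ n * exp (- c * r\<^sup>2) \<le> C * exp (- d * r\<^sup>2)" if "r \<ge> 0" for r
  proof -
    have "(1 + r) ^ n / fact n \<le> exp (1 + r)"
    proof -
      have "(1 + r) ^ n / fact n = (\<Sum>i\<in>{n}. (1 + r) ^ i /\<^sub>R fact i)" by (simp add: divide_inverse mult.commute)
      also have "\<dots> \<le> (\<Sum>i. (1 + r) ^ i /\<^sub>R fact i)"
        using that by (intro sum_le_suminf summable_exp_generic) auto
      finally show ?thesis by (simp add: exp_def)
    qed
    moreover have "1 + r \<le> (1 + 1 / (4 * d)) + d * r\<^sup>2"
    proof -
      have "0 \<le> (2 * d * r - 1)\<^sup>2 / (4 * d)" using d by simp
      also have "\<dots> = 1 / (4 * d) + d * r\<^sup>2 - r" using d by (simp add: power2_eq_square field_simps)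
      finally show ?thesis by simp
    qed
    ultimately have "(1 + r) ^ n / fact n \<le> exp ((1 + 1 / (4 * d)) + d * r\<^sup>2)"
      by (meson exp_le_cancel_iff order_trans)
    then have "(1 + r) ^ n \<le> C * exp (d * r\<^sup>2)"
      by (simp add: C_def exp_add field_simps)
    then have "(1 + r) ^ n * exp (- c * r\<^sup>2) \<le> C * exp (d * r\<^sup>2) * exp (- c * r\<^sup>2)"
      by (intro mult_right_mono) auto
    also have "\<dots> = C * exp (- d * r\<^sup>2)"
      by (simp add: d_def mult.assoc field_simps flip: exp_add)
    finally show ?thesis .
  qed
  have gi: "integrable lborel (\<lambda>w::complex. exp (- d * (cmod w)\<^sup>2))"
    using nn_integral_gaussian[OF d] by (intro integrableI_nonneg) auto
  then have "integrable lborel (\<lambda>w::complex. C * exp (- d * (cmod w)\<^sup>2))" by simp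
  then show ?thesis
    by (rule Bochner_Integration.integrable_bound) (use bound in \<open>auto simp: abs_mult C_def\<close>)
qed

lemma integral_gaussian: "(\<integral>w. complex_of_real (exp (- (cmod w)\<^sup>2)) \<partial>lborel) = complex_of_real pi"
proof -
  have "(\<integral>w. exp (- (cmod w)\<^sup>2) \<partial>lborel) = pi"
    using nn_integral_gaussian[of 1] by (simp add: integral_eq_nn_integral)
  then show ?thesis by simp
qed

text \<open>
  Cauchy-Schwarz for the measure \<open>G(z - w) dw\<close>, followed by Tonelli.
\<close>

lemma young_inequality:
  fixes G :: "complex \<Rightarrow> real" and b :: "complex \<Rightarrow> ennreal"
  assumes [measurable]: "G \<in> borel_measurable borel" "b \<in> borel_measurable borel"
    and G0: "\<And>z. G z \<ge> 0"
  shows "(\<integral>\<^sup>+z. (\<integral>\<^sup>+w. ennreal (G (z - w)) * b w \<partial>lborel)\<^sup>2 \<partial>lborel)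
    \<le> (\<integral>\<^sup>+z. ennreal (G z) \<partial>lborel)\<^sup>2 * (\<integral>\<^sup>+z. (b z)\<^sup>2 \<partial>lborel)"
proof -
  let ?I = "\<integral>\<^sup>+z. ennreal (G z) \<partial>lborel"
  have sq: "ennreal (sqrt (G x)) * ennreal (sqrt (G x)) = ennreal (G x)" for x
    using G0 by (simp flip: ennreal_mult)
  have "(\<integral>\<^sup>+w. ennreal (G (z - w)) * b w \<partial>lborel)\<^sup>2
      \<le> ?I * (\<integral>\<^sup>+w. ennreal (G (z - w)) * (b w)\<^sup>2 \<partial>lborel)" for z
  proof -
    have "(\<integral>\<^sup>+w. ennreal (G (z - w)) * b w \<partial>lborel)\<^sup>2
       = (\<integral>\<^sup>+w. ennreal (sqrt (G (z - w))) * (ennreal (sqrt (G (z - w))) * b w) \<partial>lborel)\<^sup>2"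
      by (simp add: sq flip: mult.assoc)
    also have "\<dots> \<le> (\<integral>\<^sup>+w. (ennreal (sqrt (G (z - w))))\<^sup>2 \<partial>lborel)
        * (\<integral>\<^sup>+w. (ennreal (sqrt (G (z - w))) * b w)\<^sup>2 \<partial>lborel)"
      by (rule Cauchy_Schwarz_nn_integral) measurable
    also have "\<dots> = (\<integral>\<^sup>+w. ennreal (G (z - w)) \<partial>lborel) * (\<integral>\<^sup>+w. ennreal (G (z - w)) * (b w)\<^sup>2 \<partial>lborel)"
      by (simp only: power_mult_distrib power2_eq_square[of "ennreal (sqrt _)"] sq)
    also have "(\<integral>\<^sup>+w. ennreal (G (z - w)) \<partial>lborel) = ?I"
      by (rule nn_integral_lborel_reflect[of "\<lambda>w. ennreal (G w)"]) simp
    finally show ?thesis .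
  qed
  then have "(\<integral>\<^sup>+z. (\<integral>\<^sup>+w. ennreal (G (z - w)) * b w \<partial>lborel)\<^sup>2 \<partial>lborel)
     \<le> (\<integral>\<^sup>+z. ?I * (\<integral>\<^sup>+w. ennreal (G (z - w)) * (b w)\<^sup>2 \<partial>lborel) \<partial>lborel)"
    by (rule nn_integral_mono)
  also have "\<dots> = ?I * (\<integral>\<^sup>+z. (\<integral>\<^sup>+w. ennreal (G (z - w)) * (b w)\<^sup>2 \<partial>lborel) \<partial>lborel)"
    by (rule nn_integral_cmult) measurable
  also have "(\<integral>\<^sup>+z. (\<integral>\<^sup>+w. ennreal (G (z - w)) * (b w)\<^sup>2 \<partial>lborel) \<partial>lborel)
     = (\<integral>\<^sup>+w. (\<integral>\<^sup>+z. ennreal (G (z - w)) * (b w)\<^sup>2 \<partial>lborel) \<partial>lborel)"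
    by (rule lborel_pair.Fubini') measurable
  also have "\<dots> = (\<integral>\<^sup>+w. ?I * (b w)\<^sup>2 \<partial>lborel)"
  proof (rule nn_integral_cong)
    fix w
    have "(\<integral>\<^sup>+z. ennreal (G (z - w)) \<partial>lborel) = ?I"
      using nn_integral_lborel_translate[of "\<lambda>z. ennreal (G z)" "- w"] by simp
    then show "(\<integral>\<^sup>+z. ennreal (G (z - w)) * (b w)\<^sup>2 \<partial>lborel) = ?I * (b w)\<^sup>2"
      by (simp add: nn_integral_multc)
  qed
  also have "\<dots> = ?I * (\<integral>\<^sup>+w. (b w)\<^sup>2 \<partial>lborel)"
    by (rule nn_integral_cmult) measurable
  finally show ?thesis by (simp add: power2_eq_square mult.assoc)
qed

section \<open>Square integrable functions\<close>

lemma square_integrable_measurable [measurable_dest]: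
  "square_integrable f \<Longrightarrow> f \<in> borel_measurable borel"
  by (simp add: square_integrable_def)

lemma L2_norm_nonneg [simp]: "L2_norm f \<ge> 0"
  by (simp add: L2_norm_def)

lemma L2_norm_sq: "(L2_norm f)\<^sup>2 = (\<integral>z. (cmod (f z))\<^sup>2 \<partial>lborel)"
  by (simp add: L2_norm_def)

lemma square_integrable_iff:
  "square_integrable f \<longleftrightarrow> f \<in> borel_measurable borel \<and> (\<integral>\<^sup>+z. ennreal (cmod (f z))^2 \<partial>lborel) < \<infinity>"
  by (auto simp: square_integrable_def integrable_iff_bounded ennreal_power)

lemma nn_integral_sq_eq:
  assumes "square_integrable f"
  shows "(\<integral>\<^sup>+z. ennreal (cmod (f z))^2 \<partial>lborel) = ennreal ((L2_norm f)\<^sup>2)"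
  using assms by (simp add: square_integrable_def L2_norm_sq ennreal_power nn_integral_eq_integral)

lemma square_integrableI_bound:
  assumes [measurable]: "f \<in> borel_measurable borel"
    and b: "(\<integral>\<^sup>+z. ennreal (cmod (f z))^2 \<partial>lborel) \<le> ennreal (B\<^sup>2)" and B: "B \<ge> 0"
  shows "square_integrable f" "L2_norm f \<le> B"
proof -
  show f: "square_integrable f" using b by (auto simp: square_integrable_iff intro: le_less_trans)
  show "L2_norm f \<le> B"
    using b nn_integral_sq_eq[OF f] B by (auto intro: power2_le_imp_le)
qed

lemma L2_cross_integrable:
  assumes f: "square_integrable f" and g: "square_integrable g"
  shows "integrable lborel (\<lambda>z. f z * g z)"
proof (rule Bochner_Integration.integrable_bound)
  have [measurable]: "f \<in> borel_measurable borel" "g \<in> borel_measurable borel"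
    using f g by auto
  show "integrable lborel (\<lambda>z. (cmod (f z))\<^sup>2 + (cmod (g z))\<^sup>2)"
    using f g by (auto simp: square_integrable_def)
  show "(\<lambda>z. f z * g z) \<in> borel_measurable lborel" by measurable
  have "a * b \<le> a\<^sup>2 + b\<^sup>2" if "a \<ge> 0" "b \<ge> 0" for a b :: real
    using sum_squares_bound[of a b] that by (auto intro: order_trans[of _ "2 * a * b"])
  then show "AE z in lborel. norm (f z * g z) \<le> norm ((cmod (f z))\<^sup>2 + (cmod (g z))\<^sup>2)"
    by (auto simp: norm_mult)
qed

lemma L2_cauchy_schwarz:
  assumes f: "square_integrable f" and g: "square_integrable g"
  shows "(\<integral>z. cmod (f z) * cmod (g z) \<partial>lborel) \<le> L2_norm f * L2_norm g"
proof -
  have [measurable]: "f \<in> borel_measurable borel" "g \<in> borel_measurable borel"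
    using f g by auto
  have int: "integrable lborel (\<lambda>z. cmod (f z) * cmod (g z))"
    using integrable_norm[OF L2_cross_integrable[OF f g]] by (simp add: norm_mult)
  have "ennreal ((\<integral>z. cmod (f z) * cmod (g z) \<partial>lborel)\<^sup>2) = (\<integral>\<^sup>+z. ennreal (cmod (f z)) * ennreal (cmod (g z)) \<partial>lborel)\<^sup>2"
    using int by (simp add: nn_integral_eq_integral ennreal_power flip: ennreal_mult)
  also have "\<dots> \<le> (\<integral>\<^sup>+z. (ennreal (cmod (f z)))\<^sup>2 \<partial>lborel) * (\<integral>\<^sup>+z. (ennreal (cmod (g z)))\<^sup>2 \<partial>lborel)"
    by (rule Cauchy_Schwarz_nn_integral) measurable
  also have "\<dots> = ennreal ((L2_norm f * L2_norm g)\<^sup>2)"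
    by (simp add: nn_integral_sq_eq f g power_mult_distrib flip: ennreal_mult)
  finally have "(\<integral>z. cmod (f z) * cmod (g z) \<partial>lborel)\<^sup>2 \<le> (L2_norm f * L2_norm g)\<^sup>2"
    by (simp add: ennreal_le_iff)
  then show ?thesis by (rule power2_le_imp_le) simp
qed

lemma L2_cauchy_schwarz':
  assumes f: "square_integrable f" and g: "square_integrable g"
  shows "cmod (\<integral>z. f z * g z \<partial>lborel) \<le> L2_norm f * L2_norm g"
  using integral_norm_bound[of lborel "\<lambda>z. f z * g z"] L2_cauchy_schwarz[OF f g]
  by (simp add: norm_mult)

lemma square_integrable_add:
  assumes f: "square_integrable f" and g: "square_integrable g"
  shows "square_integrable (\<lambda>z. f z + g z)"
    and "L2_norm (\<lambda>z. f z + g z) \<le> L2_norm f + L2_norm g"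
proof -
  have [measurable]: "f \<in> borel_measurable borel" "g \<in> borel_measurable borel"
    using f g by auto
  have int: "integrable lborel (\<lambda>z. cmod (f z) * cmod (g z))"
    using integrable_norm[OF L2_cross_integrable[OF f g]] by (simp add: norm_mult)
  have fi: "integrable lborel (\<lambda>z. (cmod (f z))\<^sup>2)" and gi: "integrable lborel (\<lambda>z. (cmod (g z))\<^sup>2)"
    using f g by (auto simp: square_integrable_def)
  let ?S = "\<lambda>z. (cmod (f z))\<^sup>2 + 2 * (cmod (f z) * cmod (g z)) + (cmod (g z))\<^sup>2"
  have Si: "integrable lborel ?S" using int fi gi by auto
  have le: "(cmod (f z + g z))\<^sup>2 \<le> ?S z" for z
  proof -
    have "(cmod (f z + g z))\<^sup>2 \<le> (cmod (f z) + cmod (g z))\<^sup>2"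
      by (intro power_mono norm_triangle_ineq) simp
    then show ?thesis by (simp add: power2_sum)
  qed
  have I: "integrable lborel (\<lambda>z. (cmod (f z + g z))\<^sup>2)"
    by (rule Bochner_Integration.integrable_bound[OF Si]) (use le in \<open>auto intro: order_trans[OF _ abs_ge_self]\<close>)
  then show "square_integrable (\<lambda>z. f z + g z)"
    by (simp add: square_integrable_def)
  have "(L2_norm (\<lambda>z. f z + g z))\<^sup>2 \<le> (\<integral>z. ?S z \<partial>lborel)"
    unfolding L2_norm_sq by (rule integral_mono[OF I Si]) (use le in auto)
  also have "\<dots> = (L2_norm f)\<^sup>2 + 2 * (\<integral>z. cmod (f z) * cmod (g z) \<partial>lborel) + (L2_norm g)\<^sup>2"
    using int fi gi by (simp add: L2_norm_sq)
  also have "\<dots> \<le> (L2_norm f + L2_norm g)\<^sup>2"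
    using L2_cauchy_schwarz[OF f g] by (simp add: power2_sum)
  finally show "L2_norm (\<lambda>z. f z + g z) \<le> L2_norm f + L2_norm g"
    by (rule power2_le_imp_le) simp
qed

lemma square_integrable_cmult:
  assumes f: "square_integrable f"
  shows "square_integrable (\<lambda>z. c * f z)" "L2_norm (\<lambda>z. c * f z) = cmod c * L2_norm f"
  using f by (auto simp: square_integrable_def L2_norm_def norm_mult power_mult_distrib real_sqrt_mult)

lemma square_integrable_diff:
  assumes f: "square_integrable f" and g: "square_integrable g"
  shows "square_integrable (\<lambda>z. f z - g z)"
    and "L2_norm (\<lambda>z. f z - g z) \<le> L2_norm f + L2_norm g"
  using square_integrable_add[OF f square_integrable_cmult(1)[OF g, of "-1"]]
    square_integrable_cmult(2)[OF g, of "-1"] by auto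

lemma square_integrable_zero [simp]: "square_integrable (\<lambda>z. 0)"
  by (simp add: square_integrable_def)

lemma square_integrable_mono:
  assumes g: "square_integrable g" and [measurable]: "f \<in> borel_measurable borel"
    and le: "\<And>z. cmod (f z) \<le> C * cmod (g z)" and C: "C \<ge> 0"
  shows "square_integrable f" "L2_norm f \<le> C * L2_norm g"
proof -
  have "(\<integral>\<^sup>+z. ennreal (cmod (f z))^2 \<partial>lborel) \<le> (\<integral>\<^sup>+z. ennreal (cmod (complex_of_real C * g z))^2 \<partial>lborel)"
    using le C by (intro nn_integral_mono power_mono ennreal_leI) (auto simp: norm_mult)
  also have "\<dots> = ennreal ((C * L2_norm g)\<^sup>2)"
    using nn_integral_sq_eq[OF square_integrable_cmult(1)[OF g]] square_integrable_cmult(2)[OF g] C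
    by simp
  finally have *: "(\<integral>\<^sup>+z. ennreal (cmod (f z))^2 \<partial>lborel) \<le> ennreal ((C * L2_norm g)\<^sup>2)" .
  show "square_integrable f" "L2_norm f \<le> C * L2_norm g"
    using square_integrableI_bound[OF _ *] C by auto
qed

text \<open>
  This gives both the completeness of the Fock space and the passage from truncated to full weights.
\<close>

lemma L2_Fatou:
  assumes f: "\<And>n::nat. square_integrable (f n)" and B: "\<And>n. L2_norm (f n) \<le> B"
    and lim: "\<And>z. (\<lambda>n. f n z) \<longlonglongrightarrow> g z"
  shows "square_integrable g" "L2_norm g \<le> B"
proof -
  have [measurable]: "f n \<in> borel_measurable borel" for n using f by auto
  have [measurable]: "g \<in> borel_measurable borel"
    by (rule borel_measurable_LIMSEQ_metric[OF _ lim]) simp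
  have B0: "B \<ge> 0" using B[of 0] L2_norm_nonneg[of "f 0"] by linarith
  have "(\<integral>\<^sup>+z. ennreal (cmod (g z))^2 \<partial>lborel) = (\<integral>\<^sup>+z. liminf (\<lambda>n. ennreal (cmod (f n z))^2) \<partial>lborel)"
  proof (rule nn_integral_cong)
    fix z
    have "(\<lambda>n. ennreal ((cmod (f n z))^2)) \<longlonglongrightarrow> ennreal ((cmod (g z))^2)"
      by (intro tendsto_ennrealI tendsto_intros lim)
    then have "(\<lambda>n. ennreal (cmod (f n z))^2) \<longlonglongrightarrow> ennreal (cmod (g z))^2"
      by (simp add: ennreal_power)
    then show "ennreal (cmod (g z))^2 = liminf (\<lambda>n. ennreal (cmod (f n z))^2)"
      by (simp add: lim_imp_Liminf)
  qed
  also have "\<dots> \<le> liminf (\<lambda>n. \<integral>\<^sup>+z. ennreal (cmod (f n z))^2 \<partial>lborel)"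
    by (rule nn_integral_liminf) measurable
  also have "\<dots> \<le> ennreal (B\<^sup>2)"
  proof (rule Liminf_le)
    show "\<forall>\<^sub>F n in sequentially. (\<integral>\<^sup>+z. ennreal (cmod (f n z))^2 \<partial>lborel) \<le> ennreal (B\<^sup>2)"
      using B by (auto simp: nn_integral_sq_eq[OF f] intro!: always_eventually ennreal_leI power_mono)
  qed simp
  finally have *: "(\<integral>\<^sup>+z. ennreal (cmod (g z))^2 \<partial>lborel) \<le> ennreal (B\<^sup>2)" .
  show "square_integrable g" "L2_norm g \<le> B"
    using square_integrableI_bound[OF _ * B0] by auto
qed

lemma cnj_borel_measurable [measurable (raw)]:
  assumes "f \<in> borel_measurable M"
  shows "(\<lambda>x. cnj (f x)) \<in> borel_measurable M"
  using measurable_compose[OF assms, of cnj borel]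
  by (simp add: borel_measurable_continuous_onI continuous_on_cnj)

section \<open>Radial weights and entire functions\<close>

text \<open>
  Rotating by an angle \<open>t\<close> with \<open>(n - m) t = \<pi>\<close> changes the sign of the integral.
\<close>

lemma radial_monomials_orthogonal:
  fixes g :: "real \<Rightarrow> real"
  assumes [measurable]: "g \<in> borel_measurable borel" and "n \<noteq> m"
  shows "(\<integral>w. complex_of_real (g (cmod w)) * (w ^ n * cnj (w ^ m)) \<partial>lborel) = 0" (is "?I = 0")
proof -
  define t where "t = pi / (real n - real m)"
  have t: "(real n - real m) * t = pi" using \<open>n \<noteq> m\<close> by (simp add: t_def)
  define c where "c = cis t"
  have c1: "cmod c = 1" by (simp add: c_def)
  have "c ^ n * cnj (c ^ m) = cis (real n * t - real m * t)"
    by (simp add: c_def Complex.DeMoivre cis_mult cis_cnj)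
  also have "real n * t - real m * t = pi"
    using t by (simp add: left_diff_distrib)
  finally have c: "c ^ n * cnj c ^ m = - 1" by simp
  have "?I = (\<integral>w. complex_of_real (g (cmod (c * w))) * ((c * w) ^ n * cnj ((c * w) ^ m)) \<partial>lborel)"
    by (rule integral_lborel_unit_mult[OF _ c1, symmetric]) measurable
  also have "\<dots> = (\<integral>w. - (complex_of_real (g (cmod w)) * (w ^ n * cnj (w ^ m))) \<partial>lborel)"
  proof (rule Bochner_Integration.integral_cong[OF refl])
    fix w
    have "(c * w) ^ n * cnj ((c * w) ^ m) = (c ^ n * cnj c ^ m) * (w ^ n * cnj (w ^ m))"
      by (simp add: power_mult_distrib)
    then show "complex_of_real (g (cmod (c * w))) * ((c * w) ^ n * cnj ((c * w) ^ m))
        = - (complex_of_real (g (cmod w)) * (w ^ n * cnj (w ^ m)))"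
      by (simp only: c norm_mult c1) simp
  qed
  also have "\<dots> = - ?I" by simp
  finally show ?thesis by simp
qed

lemma entire_power_series:
  assumes "f holomorphic_on UNIV"
  obtains a where "\<And>w. (\<lambda>n. a n * w ^ n) sums f w"
    and "\<And>w. (\<lambda>n. (of_nat n * a n) * w ^ n) sums (w * deriv f w)"
    and "a 0 = f 0"
proof
  define a where "a n = (deriv ^^ n) f 0 / fact n" for n
  show s: "(\<lambda>n. a n * w ^ n) sums f w" for w
    using holomorphic_power_series[of f 0 "cmod w + 1" w] assms
    by (auto simp: a_def intro: holomorphic_on_subset)
  show "a 0 = f 0" by (simp add: a_def)
  show "(\<lambda>n. (of_nat n * a n) * w ^ n) sums (w * deriv f w)" for w
  proof -
    have sm: "summable (\<lambda>n. a n * x ^ n)" for x using s by (auto simp: sums_iff)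
    have "((\<lambda>x. \<Sum>n. a n * x ^ n) has_field_derivative (\<Sum>n. diffs a n * w ^ n)) (at w)"
      by (rule termdiffs_strong_converges_everywhere) (rule sm)
    moreover have "(\<lambda>x. \<Sum>n. a n * x ^ n) = f" using s by (auto simp: sums_iff)
    ultimately have d: "deriv f w = (\<Sum>n. diffs a n * w ^ n)" by (simp add: DERIV_imp_deriv)
    have "summable (\<lambda>n. diffs a n * w ^ n)"
      by (rule termdiff_converges_all) (rule sm)
    then have "(\<lambda>n. diffs a n * w ^ n) sums deriv f w" by (simp add: d summable_sums)
    then have "(\<lambda>n. w * (diffs a n * w ^ n)) sums (w * deriv f w)" by (rule sums_mult)
    then have "(\<lambda>n. (of_nat (Suc n) * a (Suc n)) * w ^ Suc n) sums (w * deriv f w)"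
      by (simp add: diffs_def mult_ac)
    then show ?thesis by (subst (asm) sums_Suc_iff) simp
  qed
qed

text \<open>
  Parseval's identity for a radial weight supported in a disc. On the disc the partial sums are
  uniformly bounded, so dominated convergence applies, and orthogonality leaves only the diagonal.
\<close>

lemma radial_inner_product_sums:
  fixes g :: "real \<Rightarrow> real" and a b :: "nat \<Rightarrow> complex"
  assumes [measurable]: "g \<in> borel_measurable borel"
    and gB: "\<And>r. \<bar>g r\<bar> \<le> B" and gR: "\<And>r. r > R \<Longrightarrow> g r = 0" and R: "R \<ge> 0"
    and F: "\<And>w. (\<lambda>n. a n * w ^ n) sums F w" and G: "\<And>w. (\<lambda>n. b n * w ^ n) sums G w"
  shows "(\<lambda>n. a n * cnj (b n) * (\<integral>w. complex_of_real (g (cmod w)) * (w ^ n * cnj (w ^ n)) \<partial>lborel))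
    sums (\<integral>w. complex_of_real (g (cmod w)) * (F w * cnj (G w)) \<partial>lborel)"
proof -
  define S where "S N w = (\<Sum>n<N. a n * w ^ n)" for N w
  define T where "T N w = (\<Sum>n<N. b n * w ^ n)" for N w
  have [measurable]: "S N \<in> borel_measurable borel" "T N \<in> borel_measurable borel" for N
    unfolding S_def[abs_def] T_def[abs_def] by measurable
  have bound: "\<exists>A\<ge>0. \<forall>N w. cmod w \<le> R \<longrightarrow> cmod (\<Sum>n<N. c n * w ^ n) \<le> A"
    if c: "\<And>w. (\<lambda>n. c n * w ^ n) sums H w" for c :: "nat \<Rightarrow> complex" and H
  proof (intro exI[of _ "\<Sum>n. cmod (c n * of_real R ^ n)"] conjI allI impI)
    have "summable (\<lambda>n. c n * of_real (R + 1) ^ n)" using c by (auto simp: sums_iff)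
    then have sm: "summable (\<lambda>n. cmod (c n * of_real R ^ n))"
      by (rule powser_insidea) (use R in simp)
    show "0 \<le> (\<Sum>n. cmod (c n * of_real R ^ n))" by (intro suminf_nonneg sm) auto
    fix N and w :: complex assume w: "cmod w \<le> R"
    have "cmod (\<Sum>n<N. c n * w ^ n) \<le> (\<Sum>n<N. cmod (c n * of_real R ^ n))"
      using w R by (intro sum_norm_le) (auto simp: norm_mult norm_power intro!: mult_left_mono power_mono)
    also have "\<dots> \<le> (\<Sum>n. cmod (c n * of_real R ^ n))"
      by (intro sum_le_suminf sm) auto
    finally show "cmod (\<Sum>n<N. c n * w ^ n) \<le> (\<Sum>n. cmod (c n * of_real R ^ n))" .
  qed
  obtain A where A: "A \<ge> 0" "\<And>N w. cmod w \<le> R \<Longrightarrow> cmod (S N w) \<le> A"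
    using bound[OF F] unfolding S_def by blast
  obtain A' where A': "A' \<ge> 0" "\<And>N w. cmod w \<le> R \<Longrightarrow> cmod (T N w) \<le> A'"
    using bound[OF G] unfolding T_def by blast
  have B0: "B \<ge> 0" using gB[of 0] by linarith
  have SF: "(\<lambda>N. S N w) \<longlonglongrightarrow> F w" for w using F[of w] by (simp add: sums_def S_def)
  have TG: "(\<lambda>N. T N w) \<longlonglongrightarrow> G w" for w using G[of w] by (simp add: sums_def T_def)
  have [measurable]: "F \<in> borel_measurable borel" "G \<in> borel_measurable borel"
    by (rule borel_measurable_LIMSEQ_metric[OF _ SF] borel_measurable_LIMSEQ_metric[OF _ TG]; simp)+
  have lim: "(\<lambda>N. \<integral>w. complex_of_real (g (cmod w)) * (S N w * cnj (T N w)) \<partial>lborel)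
      \<longlonglongrightarrow> (\<integral>w. complex_of_real (g (cmod w)) * (F w * cnj (G w)) \<partial>lborel)"
  proof (rule integral_dominated_convergence[where w = "\<lambda>w. B * A * A' * indicator (cball 0 R) w"])
    show "integrable lborel (\<lambda>w::complex. B * A * A' * indicator (cball 0 R) w)"
      by (intro integrable_mult_right integrable_real_indicator)
        (simp_all add: emeasure_cball[OF R])
    show "AE w in lborel. (\<lambda>N. complex_of_real (g (cmod w)) * (S N w * cnj (T N w)))
        \<longlonglongrightarrow> complex_of_real (g (cmod w)) * (F w * cnj (G w))"
      by (intro AE_I2 tendsto_intros SF TG)
    show "AE w in lborel. norm (complex_of_real (g (cmod w)) * (S N w * cnj (T N w)))
        \<le> B * A * A' * indicator (cball 0 R) w" for N
    proof (rule AE_I2)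
      fix w :: complex
      show "norm (complex_of_real (g (cmod w)) * (S N w * cnj (T N w))) \<le> B * A * A' * indicator (cball 0 R) w"
      proof (cases "cmod w \<le> R")
        case True
        then have "norm (complex_of_real (g (cmod w)) * (S N w * cnj (T N w))) \<le> B * (A * A')"
          unfolding norm_mult by (intro mult_mono) (use gB A A' B0 in auto)
        then show ?thesis using True by (simp add: mult.assoc)
      next
        case False
        then show ?thesis using gR[of "cmod w"] by simp
      qed
    qed
  qed measurable
  have mono_int: "integrable lborel (\<lambda>w. complex_of_real (g (cmod w)) * (w ^ n * cnj (w ^ m)))" for n m
  proof (rule Bochner_Integration.integrable_bound[where f = "\<lambda>w::complex. (B * R ^ n * R ^ m) * indicator (cball 0 R) w"])
    show "integrable lborel (\<lambda>w::complex. (B * R ^ n * R ^ m) * indicator (cball 0 R) w)"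
      by (intro integrable_mult_right integrable_real_indicator)
        (simp_all add: emeasure_cball[OF R])
    show "AE w in lborel. norm (complex_of_real (g (cmod w)) * (w ^ n * cnj (w ^ m)))
        \<le> norm ((B * R ^ n * R ^ m) * indicator (cball 0 R) w :: real)"
    proof (rule AE_I2)
      fix w :: complex
      show "norm (complex_of_real (g (cmod w)) * (w ^ n * cnj (w ^ m)))
        \<le> norm ((B * R ^ n * R ^ m) * indicator (cball 0 R) w :: real)"
      proof (cases "cmod w \<le> R")
        case True
        then have "norm (complex_of_real (g (cmod w)) * (w ^ n * cnj (w ^ m))) \<le> B * (R ^ n * R ^ m)"
          unfolding norm_mult by (intro mult_mono) (use gB B0 R in \<open>auto simp: norm_power intro: power_mono\<close>)
        then show ?thesis using True B0 R by (simp add: mult.assoc)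
      next
        case False
        then show ?thesis using gR[of "cmod w"] by simp
      qed
    qed
  qed measurable
  have "(\<integral>w. complex_of_real (g (cmod w)) * (S N w * cnj (T N w)) \<partial>lborel)
    = (\<Sum>n<N. a n * cnj (b n) * (\<integral>w. complex_of_real (g (cmod w)) * (w ^ n * cnj (w ^ n)) \<partial>lborel))" for N
  proof -
    let ?M = "\<lambda>n m. \<integral>w. complex_of_real (g (cmod w)) * (w ^ n * cnj (w ^ m)) \<partial>lborel"
    have "(\<integral>w. complex_of_real (g (cmod w)) * (S N w * cnj (T N w)) \<partial>lborel)
      = (\<integral>w. (\<Sum>n<N. \<Sum>m<N. (a n * cnj (b m)) * (complex_of_real (g (cmod w)) * (w ^ n * cnj (w ^ m)))) \<partial>lborel)"
    proof (intro Bochner_Integration.integral_cong refl)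
      fix w
      have "S N w * cnj (T N w) = (\<Sum>n<N. \<Sum>m<N. (a n * w ^ n) * cnj (b m * w ^ m))"
        by (simp only: S_def T_def cnj_sum sum_product)
      then show "complex_of_real (g (cmod w)) * (S N w * cnj (T N w))
        = (\<Sum>n<N. \<Sum>m<N. (a n * cnj (b m)) * (complex_of_real (g (cmod w)) * (w ^ n * cnj (w ^ m))))"
        by (simp add: sum_distrib_left mult_ac)
    qed
    also have "\<dots> = (\<Sum>n<N. \<Sum>m<N. (a n * cnj (b m)) * ?M n m)"
      by (subst Bochner_Integration.integral_sum; (intro Bochner_Integration.integrable_sum integrable_mult_right mono_int)?)+
        (simp add: Bochner_Integration.integral_sum mono_int)
    also have "\<dots> = (\<Sum>n<N. \<Sum>m<N. if m = n then (a n * cnj (b n)) * ?M n n else 0)"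
      using radial_monomials_orthogonal[of g] by (intro sum.cong refl) auto
    also have "\<dots> = (\<Sum>n<N. a n * cnj (b n) * ?M n n)"
      by (intro sum.cong refl) (simp add: sum.delta)
    finally show ?thesis .
  qed
  with lim show ?thesis by (simp add: sums_def)
qed

lemma cutoff_limit:
  fixes h :: "complex \<Rightarrow> complex"
  assumes h: "integrable lborel h"
  shows "(\<lambda>N. \<integral>w. complex_of_real (indicator {0..real N} (cmod w)) * h w \<partial>lborel) \<longlonglongrightarrow> (\<integral>w. h w \<partial>lborel)"
proof (rule integral_dominated_convergence[where w = "\<lambda>w. cmod (h w)"])
  have [measurable]: "h \<in> borel_measurable borel" using h by auto
  show "h \<in> borel_measurable lborel" by measurable
  show "(\<lambda>w. complex_of_real (indicator {0..real N} (cmod w)) * h w) \<in> borel_measurable lborel" for N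
    by measurable
  show "integrable lborel (\<lambda>w. cmod (h w))" using h by (rule integrable_norm)
  show "AE w in lborel. (\<lambda>N. complex_of_real (indicator {0..real N} (cmod w)) * h w) \<longlonglongrightarrow> h w"
  proof (rule AE_I2)
    fix w
    obtain M where "cmod w \<le> real M" using real_arch_simple by blast
    then have "\<forall>\<^sub>F N in sequentially. complex_of_real (indicator {0..real N} (cmod w)) * h w = h w"
      by (auto simp: eventually_sequentially intro!: exI[of _ M])
    then show "(\<lambda>N. complex_of_real (indicator {0..real N} (cmod w)) * h w) \<longlonglongrightarrow> h w"
      by (rule tendsto_eventually)
  qed
qed (auto simp: norm_mult indicator_def)

lemma cutoff_bounded:
  fixes \<rho> :: "real \<Rightarrow> real"
  assumes "continuous_on UNIV \<rho>"
  shows "\<exists>B. \<forall>r. \<bar>\<rho> r * indicator {0..real N} r\<bar> \<le> B"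
proof -
  have "compact (\<rho> ` {0..real N})"
    by (intro compact_continuous_image continuous_on_subset[OF assms]) auto
  then have "bounded (\<rho> ` {0..real N})" by (rule compact_imp_bounded)
  then obtain B where B: "\<forall>x\<in>{0..real N}. \<bar>\<rho> x\<bar> \<le> B"
    unfolding bounded_iff by (metis imageI real_norm_def)
  then have "B \<ge> 0" using abs_ge_zero[of "\<rho> 0"] by (force intro: order_trans)
  with B show ?thesis by (intro exI[of _ B]) (auto simp: indicator_def)
qed

text \<open>
  Replacing the weight by its restriction to large discs: a closed condition that holds for all these
  sums holds for the full integral. The conditions of interest are vanishing and being real.
\<close>

lemma radial_inner_product_limit:
  fixes \<rho> :: "real \<Rightarrow> real"
  assumes \<rho>: "continuous_on UNIV \<rho>"
    and F: "\<And>w. (\<lambda>n. a n * w ^ n) sums F w" and G: "\<And>w. (\<lambda>n. b n * w ^ n) sums G w"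
    and int: "integrable lborel (\<lambda>w. complex_of_real (\<rho> (cmod w)) * (F w * cnj (G w)))"
    and C: "closed C"
    and C_partial: "\<And>g N. (\<And>r. g r = \<rho> r * indicator {0..real N} r) \<Longrightarrow> g \<in> borel_measurable borel \<Longrightarrow>
      (\<Sum>n. a n * cnj (b n) * (\<integral>w. complex_of_real (g (cmod w)) * (w ^ n * cnj (w ^ n)) \<partial>lborel)) \<in> C"
  shows "(\<integral>w. complex_of_real (\<rho> (cmod w)) * (F w * cnj (G w)) \<partial>lborel) \<in> C"
proof (rule Lim_in_closed_set[OF C _ _ cutoff_limit[OF int]])
  have [measurable]: "\<rho> \<in> borel_measurable borel" using \<rho> by (rule borel_measurable_continuous_onI)
  show "\<forall>\<^sub>F N in sequentially. (\<integral>w. complex_of_real (indicator {0..real N} (cmod w)) *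
      (complex_of_real (\<rho> (cmod w)) * (F w * cnj (G w))) \<partial>lborel) \<in> C"
  proof (rule always_eventually, rule allI)
    fix N
    define g where "g r = \<rho> r * indicator {0..real N} r" for r
    have g: "g \<in> borel_measurable borel" unfolding g_def[abs_def] by measurable
    obtain B where B: "\<And>r. \<bar>g r\<bar> \<le> B" using cutoff_bounded[OF \<rho>, of N] unfolding g_def by blast
    have "(\<integral>w. complex_of_real (indicator {0..real N} (cmod w)) *
        (complex_of_real (\<rho> (cmod w)) * (F w * cnj (G w))) \<partial>lborel)
      = (\<integral>w. complex_of_real (g (cmod w)) * (F w * cnj (G w)) \<partial>lborel)"
      by (simp add: g_def mult_ac)
    also have "\<dots> = (\<Sum>n. a n * cnj (b n) * (\<integral>w. complex_of_real (g (cmod w)) * (w ^ n * cnj (w ^ n)) \<partial>lborel))"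
      by (rule sums_unique, rule radial_inner_product_sums[OF g B _ _ F G, of "real N"])
        (auto simp: g_def indicator_def)
    also have "\<dots> \<in> C" by (rule C_partial[OF g_def g])
    finally show "(\<integral>w. complex_of_real (indicator {0..real N} (cmod w)) *
        (complex_of_real (\<rho> (cmod w)) * (F w * cnj (G w))) \<partial>lborel) \<in> C" .
  qed
qed simp

lemma gaussian_mean_value:
  assumes hol: "f holomorphic_on UNIV"
    and int: "integrable lborel (\<lambda>w. complex_of_real (exp (- (cmod w)\<^sup>2)) * f w)"
  shows "(\<integral>w. complex_of_real (exp (- (cmod w)\<^sup>2)) * f w \<partial>lborel) = complex_of_real pi * f 0"
proof -
  obtain a where a: "\<And>w. (\<lambda>n. a n * w ^ n) sums f w"
    and "\<And>w. (\<lambda>n. (of_nat n * a n) * w ^ n) sums (w * deriv f w)" and a0: "a 0 = f 0"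
    by (rule entire_power_series[OF hol]) (rule that; assumption)
  define b :: "nat \<Rightarrow> complex" where "b n = (if n = 0 then 1 else 0)" for n
  have b: "(\<lambda>n. b n * w ^ n) sums 1" for w
  proof -
    have "(\<lambda>n. b n * w ^ n) = (\<lambda>n. if n = 0 then w ^ n else 0)" by (auto simp: b_def)
    then show ?thesis using sums_single[of 0 "\<lambda>n. w ^ n"] by simp
  qed
  have c: "(\<lambda>n. (f 0 * b n) * w ^ n) sums f 0" for w
    using sums_mult[OF b[of w], of "f 0"] by (simp add: mult.assoc)
  let ?\<rho> = "\<lambda>r::real. exp (- r\<^sup>2)"
  have \<rho>: "continuous_on UNIV ?\<rho>" by (intro continuous_intros)
  have gi: "integrable lborel (\<lambda>w. complex_of_real (exp (- (cmod w)\<^sup>2)))"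
    using integrable_poly_gaussian[of 1 0] by simp
  \<comment> \<open>Only the constant coefficient of \<open>f\<close> contributes, so \<open>f - f 0\<close> integrates to zero.\<close>
  have "(\<integral>w. complex_of_real (?\<rho> (cmod w)) * ((f w - f 0) * cnj 1) \<partial>lborel) \<in> {0}"
  proof (rule radial_inner_product_limit[OF \<rho> _ b])
    show "(\<lambda>n. (a n - f 0 * b n) * w ^ n) sums (f w - f 0)" for w
      using sums_diff[OF a c, of w] by (simp add: left_diff_distrib)
    show "integrable lborel (\<lambda>w. complex_of_real (?\<rho> (cmod w)) * ((f w - f 0) * cnj 1))"
      using Bochner_Integration.integrable_diff[OF int integrable_mult_left[OF gi, of "f 0"]]
      by (simp add: right_diff_distrib)
    have "(a n - f 0 * b n) * cnj (b n) = 0" for n by (simp add: b_def a0)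
    then show "(\<Sum>n. (a n - f 0 * b n) * cnj (b n) *
        (\<integral>w. complex_of_real (g (cmod w)) * (w ^ n * cnj (w ^ n)) \<partial>lborel)) \<in> {0}" for g :: "real \<Rightarrow> real"
      by (simp only: mult_zero_left suminf_zero) simp
  qed simp
  then have "(\<integral>w. complex_of_real (exp (- (cmod w)\<^sup>2)) * f w - complex_of_real (exp (- (cmod w)\<^sup>2)) * f 0 \<partial>lborel) = 0"
    by (simp add: right_diff_distrib)
  then show ?thesis
    using int gi integral_gaussian by (simp add: Bochner_Integration.integral_diff)
qed

text \<open>
  On coefficients the integral is \<open>\<Sum> n |a_n|^2 c_n\<close> with real \<open>c_n\<close>. Its imaginary part is
  \<open>-1/2\<close> times the integral of \<open>\<rho>\<close> against the angular derivative of \<open>|p|^2\<close>, so that the lemma is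
  the infinitesimal form of rotation invariance.
\<close>

lemma radial_angular_derivative_real:
  assumes hol: "p holomorphic_on UNIV" and \<rho>: "continuous_on UNIV \<rho>"
    and int: "integrable lborel (\<lambda>w. complex_of_real (\<rho> (cmod w)) * ((w * deriv p w) * cnj (p w)))"
  shows "Im (\<integral>w. complex_of_real (\<rho> (cmod w)) * ((w * deriv p w) * cnj (p w)) \<partial>lborel) = 0"
proof -
  obtain a where a: "\<And>w. (\<lambda>n. a n * w ^ n) sums p w"
    and a': "\<And>w. (\<lambda>n. (of_nat n * a n) * w ^ n) sums (w * deriv p w)" and "a 0 = p 0"
    by (rule entire_power_series[OF hol]) (rule that; assumption)
  have "(\<integral>w. complex_of_real (\<rho> (cmod w)) * ((w * deriv p w) * cnj (p w)) \<partial>lborel) \<in> \<real>"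
  proof (rule radial_inner_product_limit[OF \<rho> a' a int closed_complex_Reals])
    fix g :: "real \<Rightarrow> real" and N
    assume gdef: "\<And>r. g r = \<rho> r * indicator {0..real N} r" and g: "g \<in> borel_measurable borel"
    obtain B where B: "\<And>r. \<bar>g r\<bar> \<le> B" using cutoff_bounded[OF \<rho>, of N] unfolding gdef by blast
    let ?t = "\<lambda>n. of_nat n * a n * cnj (a n) *
        (\<integral>w. complex_of_real (g (cmod w)) * (w ^ n * cnj (w ^ n)) \<partial>lborel)"
    have "?t sums (\<integral>w. complex_of_real (g (cmod w)) * ((w * deriv p w) * cnj (p w)) \<partial>lborel)"
      by (rule radial_inner_product_sums[OF g B _ _ a' a, of "real N"]) (auto simp: gdef indicator_def)
    moreover have "?t n \<in> \<real>" for n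
    proof -
      have "(\<integral>w. complex_of_real (g (cmod w)) * (w ^ n * cnj (w ^ n)) \<partial>lborel)
        = (\<integral>w. complex_of_real (g (cmod w) * (cmod (w ^ n))\<^sup>2) \<partial>lborel)"
        by (simp only: complex_norm_square of_real_mult)
      moreover have "of_nat n * a n * cnj (a n) = complex_of_real (real n * (cmod (a n))\<^sup>2)"
        by (simp only: complex_norm_square of_real_mult mult.assoc of_real_of_nat_eq)
      ultimately show ?thesis
        by (simp only: integral_complex_of_real) (simp only: of_real_mult[symmetric] Reals_of_real)
    qed
    ultimately have "(\<integral>w. complex_of_real (g (cmod w)) * ((w * deriv p w) * cnj (p w)) \<partial>lborel) \<in> \<real>"
      unfolding sums_def by (intro Lim_in_closed_set[OF closed_complex_Reals]) (auto intro!: always_eventually sum_in_Reals)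
    then show "(\<Sum>n. ?t n) \<in> \<real>"
      using \<open>?t sums _\<close> by (simp add: sums_iff)
  qed
  then show ?thesis by (simp add: complex_is_Real_iff)
qed

section \<open>The reproducing kernel\<close>

definition fock_kernel :: "complex \<Rightarrow> complex \<Rightarrow> complex" where
  "fock_kernel z w = complex_of_real (1 / pi * exp (- (cmod z)\<^sup>2 / 2)) * exp (cnj w * z - complex_of_real ((cmod w)\<^sup>2 / 2))"

lemma fock_kernel_measurable [measurable (raw)]:
  assumes [measurable]: "f \<in> borel_measurable M" "g \<in> borel_measurable M"
  shows "(\<lambda>x. fock_kernel (f x) (g x)) \<in> borel_measurable M"
  unfolding fock_kernel_def by measurable

lemma fock_projection_kernel: "fock_projection u z = (\<integral>w. fock_kernel z w * u w \<partial>lborel)"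
  unfolding fock_projection_def fock_kernel_def
  by (simp only: mult.assoc integral_mult_right_zero)

lemma norm_fock_kernel: "cmod (fock_kernel z w) = 1 / pi * exp (- (cmod (z - w))\<^sup>2 / 2)"
proof -
  have "- (cmod z)\<^sup>2 / 2 + Re (cnj w * z - complex_of_real ((cmod w)\<^sup>2 / 2)) = - (cmod (z - w))\<^sup>2 / 2"
  proof -
    have "(cmod (z - w))\<^sup>2 = (cmod z)\<^sup>2 - 2 * Re (cnj w * z) + (cmod w)\<^sup>2"
      unfolding cmod_power2 by (simp add: power2_eq_square algebra_simps)
    then show ?thesis by (simp add: diff_divide_distrib add_divide_distrib)
  qed
  then show ?thesis
    unfolding fock_kernel_def norm_mult norm_exp_eq_Re norm_of_real
    by (simp only: abs_mult abs_exp_cancel mult.assoc exp_add[symmetric]) simp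
qed

lemma fock_kernel_cnj: "cnj (fock_kernel z w) = fock_kernel w z"
proof -
  define E where "E z w = cnj w * z - complex_of_real ((cmod w)\<^sup>2 / 2) - complex_of_real ((cmod z)\<^sup>2 / 2)" for z w
  have eq: "fock_kernel z w = complex_of_real (1 / pi) * exp (E z w)" for z w
  proof -
    have "E z w = complex_of_real (- (cmod z)\<^sup>2 / 2) + (cnj w * z - complex_of_real ((cmod w)\<^sup>2 / 2))"
      by (simp add: E_def)
    then show ?thesis unfolding fock_kernel_def by (simp only: exp_add exp_of_real of_real_mult mult.assoc)
  qed
  have "cnj (E z w) = E w z" by (simp add: E_def mult.commute)
  then show ?thesis unfolding eq by (simp only: complex_cnj_mult complex_cnj_complex_of_real exp_cnj)
qed

lemma fock_kernel_square_integrable: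
  "square_integrable (fock_kernel z)" "L2_norm (fock_kernel z) \<le> 1"
proof -
  have "(\<integral>\<^sup>+w. ennreal (cmod (fock_kernel z w))^2 \<partial>lborel)
    = (\<integral>\<^sup>+w. ennreal (1 / pi\<^sup>2) * ennreal (exp (- 1 * (cmod (z - w))\<^sup>2)) \<partial>lborel)"
    by (intro nn_integral_cong) (simp add: norm_fock_kernel ennreal_power power_mult_distrib power_divide
        flip: exp_of_nat_mult exp_double ennreal_mult)
  also have "\<dots> = ennreal (1 / pi\<^sup>2) * (\<integral>\<^sup>+w. ennreal (exp (- 1 * (cmod (z - w))\<^sup>2)) \<partial>lborel)"
    by (rule nn_integral_cmult) measurable
  also have "\<dots> = ennreal (1 / pi\<^sup>2) * ennreal (pi / 1)"
    by (subst nn_integral_lborel_reflect[of "\<lambda>w. ennreal (exp (- 1 * (cmod w)\<^sup>2))"])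
      (simp_all only: nn_integral_gaussian zero_less_one, measurable)
  also have "\<dots> = ennreal (1 / pi)"
    by (simp add: power2_eq_square flip: ennreal_mult)
  also have "\<dots> \<le> ennreal (1\<^sup>2)" using pi_gt3 by (intro ennreal_leI) simp
  finally have *: "(\<integral>\<^sup>+w. ennreal (cmod (fock_kernel z w))^2 \<partial>lborel) \<le> ennreal (1\<^sup>2)" .
  show "square_integrable (fock_kernel z)" "L2_norm (fock_kernel z) \<le> 1"
    using square_integrableI_bound[OF _ *] by auto
qed

text \<open>
  After the translation \<open>w = z + \<zeta>\<close> the integrand is \<open>exp(-|\<zeta>|^2)\<close> times the entire function
  \<open>f(z + \<zeta>) exp(-conj(z) \<zeta>)\<close>, whose Gaussian mean is its value at \<open>\<zeta> = 0\<close>.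
\<close>

lemma fock_reproducing:
  assumes "u \<in> bargmann_fock"
  shows "fock_projection u z = u z"
proof -
  obtain f where hol: "f holomorphic_on UNIV"
    and u: "\<And>z. u z = complex_of_real (exp (- (cmod z)\<^sup>2 / 2)) * f z" and sq: "square_integrable u"
    using assms unfolding bargmann_fock_def by blast
  have [measurable]: "u \<in> borel_measurable borel" using sq by auto
  define \<Phi> where "\<Phi> w = exp (cnj w * z - complex_of_real ((cmod w)\<^sup>2 / 2)) * u w" for w
  have [measurable]: "\<Phi> \<in> borel_measurable borel" unfolding \<Phi>_def by measurable
  define c where "c = complex_of_real (1 / pi * exp (- (cmod z)\<^sup>2 / 2))"
  have c0: "c \<noteq> 0" by (simp add: c_def)
  have "integrable lborel (\<lambda>w. fock_kernel z w * u w)"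
    by (intro L2_cross_integrable fock_kernel_square_integrable sq)
  then have "integrable lborel (\<lambda>w. c * \<Phi> w)"
    by (simp add: \<Phi>_def c_def fock_kernel_def mult.assoc)
  then have \<Phi>_int: "integrable lborel \<Phi>"
    using integrable_mult_right[of "inverse c" lborel "\<lambda>w. c * \<Phi> w"] c0
    by (simp flip: mult.assoc)
  have shift: "\<Phi> (\<zeta> + z) = complex_of_real (exp (- (cmod \<zeta>)\<^sup>2)) * (f (\<zeta> + z) * exp (- cnj z * \<zeta>))" for \<zeta>
  proof -
    have "cnj (\<zeta> + z) * z - complex_of_real ((cmod (\<zeta> + z))\<^sup>2 / 2) + complex_of_real (- (cmod (\<zeta> + z))\<^sup>2 / 2)
        = complex_of_real (- (cmod \<zeta>)\<^sup>2) + (- cnj z * \<zeta>)"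
    proof -
      have "complex_of_real ((cmod (\<zeta> + z))\<^sup>2) = (\<zeta> + z) * cnj (\<zeta> + z)"
        and "complex_of_real ((cmod \<zeta>)\<^sup>2) = \<zeta> * cnj \<zeta>"
        by (simp_all only: complex_norm_square)
      then show ?thesis by (simp add: algebra_simps)
    qed
    then have "exp (cnj (\<zeta> + z) * z - complex_of_real ((cmod (\<zeta> + z))\<^sup>2 / 2)) * complex_of_real (exp (- (cmod (\<zeta> + z))\<^sup>2 / 2))
        = complex_of_real (exp (- (cmod \<zeta>)\<^sup>2)) * exp (- cnj z * \<zeta>)"
      unfolding exp_of_real[symmetric] exp_add[symmetric] by simp
    then show ?thesis unfolding \<Phi>_def u by (simp add: mult_ac)
  qed
  have "(\<integral>w. \<Phi> w \<partial>lborel) = (\<integral>\<zeta>. \<Phi> (\<zeta> + z) \<partial>lborel)"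
    by (rule integral_lborel_translate[symmetric]) measurable
  also have "\<dots> = (\<integral>\<zeta>. complex_of_real (exp (- (cmod \<zeta>)\<^sup>2)) * (f (\<zeta> + z) * exp (- cnj z * \<zeta>)) \<partial>lborel)"
    by (simp only: shift)
  also have "\<dots> = complex_of_real pi * (f (0 + z) * exp (- cnj z * 0))"
  proof (rule gaussian_mean_value)
    have "(f \<circ> (\<lambda>\<zeta>. \<zeta> + z)) holomorphic_on UNIV"
      by (intro holomorphic_on_compose holomorphic_intros holomorphic_on_subset[OF hol]) auto
    then show "(\<lambda>\<zeta>. f (\<zeta> + z) * exp (- cnj z * \<zeta>)) holomorphic_on UNIV"
      by (intro holomorphic_intros) (simp add: o_def)
    show "integrable lborel (\<lambda>w. complex_of_real (exp (- (cmod w)\<^sup>2)) * (f (w + z) * exp (- cnj z * w)))"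
      using integrable_lborel_translate[OF \<Phi>_int, of z] by (simp add: shift)
  qed
  finally have I: "(\<integral>w. \<Phi> w \<partial>lborel) = complex_of_real pi * (f (0 + z) * exp (- cnj z * 0))" .
  show ?thesis unfolding fock_projection_def \<Phi>_def[symmetric] I by (simp add: u)
qed

text \<open>
  Cauchy-Schwarz in the reproducing formula. The kernel has norm \<open>1 / sqrt \<pi>\<close> in each variable.
\<close>

lemma fock_pointwise_bound:
  assumes "u \<in> bargmann_fock"
  shows "cmod (u z) \<le> L2_norm u"
proof -
  have sq: "square_integrable u" using assms by (simp add: bargmann_fock_def)
  have "cmod (u z) = cmod (\<integral>w. fock_kernel z w * u w \<partial>lborel)"
    using fock_reproducing[OF assms, of z] by (simp add: fock_projection_kernel)
  also have "\<dots> \<le> L2_norm (fock_kernel z) * L2_norm u"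
    by (rule L2_cauchy_schwarz'[OF fock_kernel_square_integrable(1) sq])
  also have "\<dots> \<le> 1 * L2_norm u"
    by (intro mult_right_mono fock_kernel_square_integrable) simp
  finally show ?thesis by simp
qed

section \<open>The projection maps into the Fock space\<close>

text \<open>
  Up to the factor \<open>\<pi>\<close>, the entire function that multiplies the Gaussian in the projection of \<open>g\<close>.
\<close>

definition bargmann_integral :: "(complex \<Rightarrow> complex) \<Rightarrow> complex \<Rightarrow> complex" where
  "bargmann_integral g z = (\<integral>w. exp (cnj w * z - complex_of_real ((cmod w)\<^sup>2 / 2)) * g w \<partial>lborel)"

lemma norm_one_plus_norm [simp]: "cmod (1 + complex_of_real (cmod w)) = 1 + cmod w"
proof -
  have "1 + complex_of_real (cmod w) = complex_of_real (1 + cmod w)" by simp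
  then show ?thesis by (simp only: norm_of_real) simp
qed

lemma exp_weight_square_integrable:
  assumes "r \<ge> 0"
  shows "square_integrable (\<lambda>w. complex_of_real ((1 + cmod w) ^ n * exp (cmod w * r - (cmod w)\<^sup>2 / 2)))"
proof -
  let ?e = "\<lambda>w. (1 + cmod w) ^ n * exp (cmod w * r - (cmod w)\<^sup>2 / 2)"
  have "(?e w)\<^sup>2 \<le> exp (2 * r\<^sup>2) * ((1 + cmod w) ^ (2 * n) * exp (- (1/2) * (cmod w)\<^sup>2))" for w
  proof -
    have "0 \<le> (cmod w / 2 - r)\<^sup>2" by simp
    then have "2 * (cmod w * r - (cmod w)\<^sup>2 / 2) \<le> 2 * r\<^sup>2 + - (1/2) * (cmod w)\<^sup>2"
      by (simp add: power2_eq_square field_simps)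
    then have "exp (2 * (cmod w * r - (cmod w)\<^sup>2 / 2)) \<le> exp (2 * r\<^sup>2) * exp (- (1/2) * (cmod w)\<^sup>2)"
      unfolding exp_add[symmetric] by simp
    then have "(1 + cmod w) ^ (2 * n) * exp (2 * (cmod w * r - (cmod w)\<^sup>2 / 2))
      \<le> (1 + cmod w) ^ (2 * n) * (exp (2 * r\<^sup>2) * exp (- (1/2) * (cmod w)\<^sup>2))"
      by (rule mult_left_mono) simp
    then show ?thesis
      unfolding power_mult_distrib power_mult[symmetric] exp_double[symmetric]
      by (simp only: mult_ac)
  qed
  then have le: "norm ((?e w)\<^sup>2) \<le> norm (exp (2 * r\<^sup>2) * ((1 + cmod w) ^ (2 * n) * exp (- (1/2) * (cmod w)\<^sup>2)))" for w
    by simp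
  have "integrable lborel (\<lambda>w::complex. exp (2 * r\<^sup>2) * ((1 + cmod w) ^ (2 * n) * exp (- (1/2) * (cmod w)\<^sup>2)))"
    by (intro integrable_mult_right integrable_poly_gaussian) simp
  then have "integrable lborel (\<lambda>w. (?e w)\<^sup>2)"
    by (rule Bochner_Integration.integrable_bound) (use le in \<open>auto simp del: norm_mult norm_power real_norm_def\<close>)
  then show ?thesis by (simp add: square_integrable_def norm_mult norm_power power_mult_distrib)
qed

lemma bargmann_integrand_bound:
  "cmod (exp (cnj w * z - complex_of_real ((cmod w)\<^sup>2 / 2))) \<le> exp (cmod w * cmod z - (cmod w)\<^sup>2 / 2)"
proof -
  have "Re (cnj w * z) \<le> cmod w * cmod z"
    using complex_Re_le_cmod[of "cnj w * z"] by (simp add: norm_mult)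
  then show ?thesis by (simp add: norm_exp_eq_Re)
qed

lemma bargmann_integrable:
  assumes g: "square_integrable g"
    and h: "h \<in> borel_measurable borel" "\<And>w. cmod (h w) \<le> (1 + cmod w) ^ n"
  shows "integrable lborel (\<lambda>w. exp (cnj w * z - complex_of_real ((cmod w)\<^sup>2 / 2)) * (h w * g w))"
proof -
  have [measurable]: "g \<in> borel_measurable borel" "h \<in> borel_measurable borel" using g h by auto
  have *: "integrable lborel (\<lambda>w. complex_of_real ((1 + cmod w) ^ n * exp (cmod w * cmod z - (cmod w)\<^sup>2 / 2)) * g w)"
    by (intro L2_cross_integrable exp_weight_square_integrable g) simp
  show ?thesis
  proof (rule Bochner_Integration.integrable_bound[OF *])
    have "cmod (exp (cnj w * z - complex_of_real ((cmod w)\<^sup>2 / 2)) * (h w * g w))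
        \<le> exp (cmod w * cmod z - (cmod w)\<^sup>2 / 2) * ((1 + cmod w) ^ n * cmod (g w))" for w
      unfolding norm_mult by (intro mult_mono bargmann_integrand_bound h) auto
    then show "AE w in lborel. norm (exp (cnj w * z - complex_of_real ((cmod w)\<^sup>2 / 2)) * (h w * g w))
        \<le> norm (complex_of_real ((1 + cmod w) ^ n * exp (cmod w * cmod z - (cmod w)\<^sup>2 / 2)) * g w)"
      by (intro AE_I2) (simp add: norm_mult norm_power mult_ac)
  qed measurable
qed

text \<open>
  Differentiation under the integral sign: the second-order remainder of the exponential is at most
  \<open>|h|^2 |w|^2 exp |w|\<close> for \<open>|h| \<le> 1\<close>, which the Gaussian makes integrable against \<open>g\<close>.
\<close>

lemma bargmann_integral_has_derivative:
  assumes g: "square_integrable g"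
  shows "(bargmann_integral g has_field_derivative bargmann_integral (\<lambda>w. cnj w * g w) z) (at z)"
proof -
  have [measurable]: "g \<in> borel_measurable borel" using g by auto
  let ?E = "\<lambda>z w. exp (cnj w * z - complex_of_real ((cmod w)\<^sup>2 / 2))"
  have i0: "integrable lborel (\<lambda>w. ?E z w * g w)" for z
    using bargmann_integrable[OF g, of "\<lambda>_. 1" 0] by simp
  have i1: "integrable lborel (\<lambda>w. ?E z w * (cnj w * g w))" for z
    by (rule bargmann_integrable[OF g, where n = 1]) auto
  define m where "m w = (1 + cmod w) ^ 2 * exp (cmod w * (cmod z + 1) - (cmod w)\<^sup>2 / 2) * cmod (g w)" for w
  have mi: "integrable lborel m"
  proof -
    have "integrable lborel (\<lambda>w. complex_of_real ((1 + cmod w) ^ 2 * exp (cmod w * (cmod z + 1) - (cmod w)\<^sup>2 / 2)) * g w)"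
      by (intro L2_cross_integrable exp_weight_square_integrable g) simp
    from integrable_norm[OF this] show ?thesis
      by (simp add: m_def[abs_def] norm_mult norm_power)
  qed
  have bound: "cmod ((bargmann_integral g (z + h) - bargmann_integral g z) / h - bargmann_integral (\<lambda>w. cnj w * g w) z)
      \<le> cmod h * (\<integral>w. m w \<partial>lborel)" if h: "h \<noteq> 0" "cmod h \<le> 1" for h
  proof -
    let ?d = "\<lambda>w. ?E z w * ((exp (cnj w * h) - 1 - cnj w * h) * g w)"
    have eq: "?E (z + h) w * g w - ?E z w * g w - h * (?E z w * (cnj w * g w)) = ?d w" for w
    proof -
      have "?E (z + h) w = ?E z w * exp (cnj w * h)"
        by (simp add: algebra_simps flip: exp_add)
      then show ?thesis by (simp only:) (simp add: algebra_simps)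
    qed
    have int: "integrable lborel ?d"
      unfolding eq[symmetric] by (intro Bochner_Integration.integrable_diff integrable_mult_right i0 i1)
    have "bargmann_integral g (z + h) - bargmann_integral g z - h * bargmann_integral (\<lambda>w. cnj w * g w) z = (\<integral>w. ?d w \<partial>lborel)"
      unfolding eq[symmetric] bargmann_integral_def using i0 i1 by simp
    moreover have "cmod (\<integral>w. ?d w \<partial>lborel) \<le> (\<integral>w. (cmod h)\<^sup>2 * m w \<partial>lborel)"
    proof (rule order_trans[OF integral_norm_bound integral_mono])
      show "integrable lborel (\<lambda>w. (cmod h)\<^sup>2 * m w)" using mi by simp
      show "cmod (?d w) \<le> (cmod h)\<^sup>2 * m w" for w
      proof -
        have "cmod (exp (cnj w * h) - (\<Sum>k\<le>1. (cnj w * h) ^ k / fact k))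
            \<le> exp \<bar>Re (cnj w * h)\<bar> * (cmod (cnj w * h)) ^ Suc 1 / fact 1"
          by (rule Taylor_exp)
        then have "cmod (exp (cnj w * h) - 1 - cnj w * h) \<le> exp \<bar>Re (cnj w * h)\<bar> * (cmod w * cmod h)\<^sup>2"
          by (simp add: norm_mult power2_eq_square diff_diff_eq)
        also have "\<dots> \<le> exp (cmod w) * ((1 + cmod w)\<^sup>2 * (cmod h)\<^sup>2)"
        proof (intro mult_mono)
          have "\<bar>Re (cnj w * h)\<bar> \<le> cmod w * cmod h"
            using abs_Re_le_cmod[of "cnj w * h"] by (simp add: norm_mult)
          also have "\<dots> \<le> cmod w * 1" by (intro mult_left_mono h) simp
          finally show "exp \<bar>Re (cnj w * h)\<bar> \<le> exp (cmod w)" by simp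
          show "(cmod w * cmod h)\<^sup>2 \<le> (1 + cmod w)\<^sup>2 * (cmod h)\<^sup>2"
            unfolding power_mult_distrib by (intro mult_right_mono power_mono) auto
        qed auto
        finally have "cmod (?d w) \<le> exp (cmod w * cmod z - (cmod w)\<^sup>2 / 2) *
            ((exp (cmod w) * ((1 + cmod w)\<^sup>2 * (cmod h)\<^sup>2)) * cmod (g w))"
          unfolding norm_mult by (intro mult_mono bargmann_integrand_bound) auto
        also have "\<dots> = (cmod h)\<^sup>2 * m w"
        proof -
          have "exp (cmod w * (cmod z + 1) - (cmod w)\<^sup>2 / 2) = exp (cmod w * cmod z - (cmod w)\<^sup>2 / 2) * exp (cmod w)"
            by (simp add: distrib_left flip: exp_add)
          then show ?thesis unfolding m_def by (simp only: mult_ac)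
        qed
        finally show ?thesis .
      qed
    qed (use int in \<open>auto intro: integrable_norm\<close>)
    ultimately have *: "cmod (bargmann_integral g (z + h) - bargmann_integral g z - h * bargmann_integral (\<lambda>w. cnj w * g w) z)
        \<le> (cmod h)\<^sup>2 * (\<integral>w. m w \<partial>lborel)" by simp
    have "(bargmann_integral g (z + h) - bargmann_integral g z) / h - bargmann_integral (\<lambda>w. cnj w * g w) z
      = (bargmann_integral g (z + h) - bargmann_integral g z - h * bargmann_integral (\<lambda>w. cnj w * g w) z) / h"
      using h by (simp add: diff_divide_distrib)
    also have "cmod \<dots> \<le> ((cmod h)\<^sup>2 * (\<integral>w. m w \<partial>lborel)) / cmod h"
      unfolding norm_divide by (intro divide_right_mono *) simp
    also have "\<dots> = cmod h * (\<integral>w. m w \<partial>lborel)" using h by (simp add: power2_eq_square)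
    finally show ?thesis .
  qed
  have "((\<lambda>h. (bargmann_integral g (z + h) - bargmann_integral g z) / h - bargmann_integral (\<lambda>w. cnj w * g w) z) \<longlongrightarrow> 0) (at 0)"
  proof (rule Lim_null_comparison)
    show "\<forall>\<^sub>F h in at 0. cmod ((bargmann_integral g (z + h) - bargmann_integral g z) / h - bargmann_integral (\<lambda>w. cnj w * g w) z)
      \<le> cmod h * (\<integral>w. m w \<partial>lborel)"
      unfolding eventually_at by (rule exI[of _ 1]) (auto intro!: bound)
    show "((\<lambda>h. cmod h * (\<integral>w. m w \<partial>lborel)) \<longlongrightarrow> 0) (at 0)"
      by (auto intro!: tendsto_eq_intros)
  qed
  then show ?thesis by (simp add: DERIV_def LIM_zero_iff)
qed

lemma fock_projection_bargmann_integral: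
  "fock_projection g z = complex_of_real (exp (- (cmod z)\<^sup>2 / 2)) * (complex_of_real (1 / pi) * bargmann_integral g z)"
  by (simp add: fock_projection_def bargmann_integral_def)

lemma bargmann_integral_holomorphic:
  "square_integrable g \<Longrightarrow> bargmann_integral g holomorphic_on UNIV"
  using bargmann_integral_has_derivative by (meson field_differentiable_at_within field_differentiable_def holomorphic_on_def)

lemma fock_projection_measurable:
  assumes "square_integrable g"
  shows "fock_projection g \<in> borel_measurable borel"
proof -
  have "continuous_on UNIV (bargmann_integral g)"
    using bargmann_integral_holomorphic[OF assms] by (rule holomorphic_on_imp_continuous_on)
  then have [measurable]: "bargmann_integral g \<in> borel_measurable borel" by (rule borel_measurable_continuous_onI)
  show ?thesis unfolding fock_projection_bargmann_integral[abs_def] by measurable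
qed

section \<open>Polynomial weights\<close>

text \<open>
  The class contains \<open><z>\<close> and all its truncations \<open>min <z> R\<close>. The estimates below use no other property
  of the weight, so that their constants do not depend on \<open>R\<close>.
\<close>

definition fock_weight :: "(complex \<Rightarrow> real) \<Rightarrow> bool" where
  "fock_weight \<omega> \<longleftrightarrow> (\<forall>z. 1 \<le> \<omega> z) \<and> (\<forall>z w. \<bar>\<omega> z - \<omega> w\<bar> \<le> cmod (z - w))"

definition weigh :: "(complex \<Rightarrow> real) \<Rightarrow> nat \<Rightarrow> (complex \<Rightarrow> complex) \<Rightarrow> complex \<Rightarrow> complex" where
  "weigh \<omega> k u z = complex_of_real (\<omega> z ^ k) * u z"

lemma fock_weight_ge1: "fock_weight \<omega> \<Longrightarrow> 1 \<le> \<omega> z"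
  and fock_weight_lipschitz: "fock_weight \<omega> \<Longrightarrow> \<bar>\<omega> z - \<omega> w\<bar> \<le> cmod (z - w)"
  by (auto simp: fock_weight_def)

lemma fock_weight_measurable [measurable_dest]:
  assumes "fock_weight \<omega>" shows "\<omega> \<in> borel_measurable borel"
proof -
  have "continuous_on UNIV \<omega>"
    unfolding continuous_on_iff
  proof (intro ballI allI impI)
    fix z :: complex and e :: real assume "e > 0"
    then show "\<exists>d>0. \<forall>w\<in>UNIV. dist w z < d \<longrightarrow> dist (\<omega> w) (\<omega> z) < e"
      using fock_weight_lipschitz[OF assms] by (intro exI[of _ e]) (auto simp: dist_norm intro: le_less_trans)
  qed
  then show ?thesis by (rule borel_measurable_continuous_onI)
qed

lemma fock_weight_pos: "fock_weight \<omega> \<Longrightarrow> 0 < \<omega> z"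
  using fock_weight_ge1[of \<omega> z] by linarith

lemma fock_weight_compare:
  assumes "fock_weight \<omega>" shows "\<omega> z \<le> \<omega> w * (1 + cmod (z - w))"
proof -
  have "\<omega> z \<le> \<omega> w + 1 * cmod (z - w)" using fock_weight_lipschitz[OF assms, of z w] by simp
  also have "\<dots> \<le> \<omega> w + \<omega> w * cmod (z - w)"
    by (intro add_left_mono mult_right_mono fock_weight_ge1 assms) simp
  finally show ?thesis by (simp add: distrib_left)
qed

lemma japanese_bracket_weight: "fock_weight japanese_bracket"
  unfolding fock_weight_def
proof (intro conjI allI)
  show "1 \<le> japanese_bracket z" for z by (simp add: japanese_bracket_def)
  show "\<bar>japanese_bracket z - japanese_bracket w\<bar> \<le> cmod (z - w)" for z w
  proof -
    have n: "japanese_bracket z = norm (1::real, z)" for z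
      by (simp add: japanese_bracket_def norm_Pair)
    have "\<bar>norm (1::real, z) - norm (1::real, w)\<bar> \<le> norm ((1::real, z) - (1, w))"
      by (rule norm_triangle_ineq3)
    then show ?thesis unfolding n by (simp add: norm_Pair)
  qed
qed

lemma truncated_weight:
  assumes "R \<ge> 1" shows "fock_weight (\<lambda>z. min (japanese_bracket z) R)"
  unfolding fock_weight_def
proof (intro conjI allI)
  show "1 \<le> min (japanese_bracket z) R" for z
    using fock_weight_ge1[OF japanese_bracket_weight] assms by simp
  show "\<bar>min (japanese_bracket z) R - min (japanese_bracket w) R\<bar> \<le> cmod (z - w)" for z w
    using fock_weight_lipschitz[OF japanese_bracket_weight, of z w] by (auto simp: min_def)
qed

lemma weighted_eq_weigh: "weighted (real k) u = weigh japanese_bracket k u"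
proof
  fix z
  have "japanese_bracket z > 0" by (rule fock_weight_pos[OF japanese_bracket_weight])
  then show "weighted (real k) u z = weigh japanese_bracket k u z"
    by (simp add: weighted_def weigh_def powr_realpow)
qed

lemma weigh_measurable [measurable (raw)]:
  assumes [measurable]: "fock_weight \<omega>" "u \<in> borel_measurable borel"
  shows "weigh \<omega> k u \<in> borel_measurable borel"
  unfolding weigh_def[abs_def] by measurable

lemma norm_weigh: "fock_weight \<omega> \<Longrightarrow> cmod (weigh \<omega> k u z) = \<omega> z ^ k * cmod (u z)"
  using fock_weight_pos[of \<omega> z] by (simp add: weigh_def norm_mult norm_power)

lemma weigh_mono_exponent:
  assumes \<omega>: "fock_weight \<omega>" and jk: "j \<le> k" and [measurable]: "u \<in> borel_measurable borel"
    and sq: "square_integrable (weigh \<omega> k u)"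
  shows "square_integrable (weigh \<omega> j u)" "L2_norm (weigh \<omega> j u) \<le> L2_norm (weigh \<omega> k u)"
proof -
  have "cmod (weigh \<omega> j u z) \<le> 1 * cmod (weigh \<omega> k u z)" for z
    using fock_weight_ge1[OF \<omega>] jk by (simp add: norm_weigh[OF \<omega>] mult_right_mono power_increasing)
  from square_integrable_mono[OF sq _ this] weigh_measurable[OF \<omega>, of u j]
  show "square_integrable (weigh \<omega> j u)" "L2_norm (weigh \<omega> j u) \<le> L2_norm (weigh \<omega> k u)" by auto
qed

lemma weigh_0 [simp]: "weigh \<omega> 0 u = u" by (simp add: weigh_def fun_eq_iff)

section \<open>Schur estimates for the kernel\<close>

text \<open>
  The modulus of the kernel as a function of \<open>z - w\<close>, with the loss \<open>(1 + |z - w|)^n\<close> that is incurred when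
  \<open>n\<close> powers of a weight are moved from one variable to the other.
\<close>

definition schur_density :: "nat \<Rightarrow> complex \<Rightarrow> real" where
  "schur_density n z = 1 / pi * ((1 + cmod z) ^ n * exp (- (cmod z)\<^sup>2 / 2))"

definition schur_const :: "nat \<Rightarrow> real" where
  "schur_const n = (\<integral>z. schur_density n z \<partial>lborel)"

lemma schur_density_measurable [measurable]: "schur_density n \<in> borel_measurable borel"
  unfolding schur_density_def[abs_def] by measurable

lemma schur_density_nonneg [simp]: "schur_density n z \<ge> 0"
  by (simp add: schur_density_def)

lemma schur_const_nonneg [simp]: "schur_const n \<ge> 0"
  unfolding schur_const_def by (rule integral_nonneg_AE) simp

lemma nn_integral_schur_density: "(\<integral>\<^sup>+z. ennreal (schur_density n z) \<partial>lborel) = ennreal (schur_const n)"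
proof -
  have "integrable lborel (schur_density n)"
    unfolding schur_density_def[abs_def] using integrable_poly_gaussian[of "1/2" n] by simp
  then show ?thesis unfolding schur_const_def by (rule nn_integral_eq_integral) simp
qed

lemma schur_young:
  assumes b: "square_integrable b"
  shows "(\<integral>\<^sup>+z. (\<integral>\<^sup>+w. ennreal (schur_density n (z - w)) * ennreal (cmod (b w)) \<partial>lborel)\<^sup>2 \<partial>lborel)
    \<le> ennreal ((schur_const n * L2_norm b)\<^sup>2)"
proof -
  have [measurable]: "b \<in> borel_measurable borel" using b by auto
  have "(\<integral>\<^sup>+z. (\<integral>\<^sup>+w. ennreal (schur_density n (z - w)) * ennreal (cmod (b w)) \<partial>lborel)\<^sup>2 \<partial>lborel)
    \<le> (\<integral>\<^sup>+z. ennreal (schur_density n z) \<partial>lborel)\<^sup>2 * (\<integral>\<^sup>+z. (ennreal (cmod (b z)))\<^sup>2 \<partial>lborel)"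
    by (rule young_inequality) auto
  also have "\<dots> = ennreal ((schur_const n * L2_norm b)\<^sup>2)"
    by (simp only: nn_integral_schur_density nn_integral_sq_eq[OF b] power_mult_distrib)
      (simp add: ennreal_mult ennreal_power)
  finally show ?thesis .
qed

text \<open>
  Moving \<open>\<omega>(z)^k\<close> to the other variable by \<open>fock_weight_compare\<close> dominates the left side by a convolution
  with \<open>schur_density k\<close>.
\<close>

lemma fock_projection_weigh:
  assumes \<omega>: "fock_weight \<omega>" and [measurable]: "g \<in> borel_measurable borel"
    and g: "square_integrable (weigh \<omega> k g)"
  shows "square_integrable (weigh \<omega> k (fock_projection g))"
    and "L2_norm (weigh \<omega> k (fock_projection g)) \<le> schur_const k * L2_norm (weigh \<omega> k g)"
proof -
  have g0: "square_integrable g" using weigh_mono_exponent(1)[OF \<omega> _ _ g, of 0] by simp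
  have pm: "fock_projection g \<in> borel_measurable borel" by (rule fock_projection_measurable[OF g0])
  have "ennreal (cmod (weigh \<omega> k (fock_projection g) z))
     \<le> (\<integral>\<^sup>+w. ennreal (schur_density k (z - w)) * ennreal (cmod (weigh \<omega> k g w)) \<partial>lborel)" for z
  proof -
    have "ennreal (cmod (weigh \<omega> k (fock_projection g) z))
       = ennreal (\<omega> z ^ k) * ennreal (cmod (\<integral>w. fock_kernel z w * g w \<partial>lborel))"
      using fock_weight_pos[OF \<omega>, of z] by (simp add: norm_weigh[OF \<omega>] fock_projection_kernel ennreal_mult)
    also have "\<dots> \<le> ennreal (\<omega> z ^ k) * (\<integral>\<^sup>+w. ennreal (cmod (fock_kernel z w * g w)) \<partial>lborel)"
      by (intro mult_left_mono integral_norm_bound_ennreal L2_cross_integrable fock_kernel_square_integrable g0) simp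
    also have "\<dots> = (\<integral>\<^sup>+w. ennreal (\<omega> z ^ k) * ennreal (cmod (fock_kernel z w * g w)) \<partial>lborel)"
      by (rule nn_integral_cmult[symmetric]) measurable
    also have "\<dots> \<le> (\<integral>\<^sup>+w. ennreal (schur_density k (z - w)) * ennreal (cmod (weigh \<omega> k g w)) \<partial>lborel)"
    proof (rule nn_integral_mono)
      fix w
      have "\<omega> z ^ k \<le> (\<omega> w * (1 + cmod (z - w))) ^ k"
        using fock_weight_compare[OF \<omega>, of z w] fock_weight_pos[OF \<omega>, of z] by (intro power_mono) auto
      then have "\<omega> z ^ k * cmod (fock_kernel z w * g w) \<le> (\<omega> w * (1 + cmod (z - w))) ^ k * cmod (fock_kernel z w * g w)"
        by (rule mult_right_mono) simp
      also have "\<dots> = schur_density k (z - w) * cmod (weigh \<omega> k g w)"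
        by (simp add: norm_mult norm_fock_kernel schur_density_def norm_weigh[OF \<omega>] power_mult_distrib mult_ac)
      finally show "ennreal (\<omega> z ^ k) * ennreal (cmod (fock_kernel z w * g w))
         \<le> ennreal (schur_density k (z - w)) * ennreal (cmod (weigh \<omega> k g w))"
        using fock_weight_pos[OF \<omega>, of z] by (simp add: ennreal_leI flip: ennreal_mult)
    qed
    finally show ?thesis .
  qed
  then have "(\<integral>\<^sup>+z. ennreal (cmod (weigh \<omega> k (fock_projection g) z))^2 \<partial>lborel)
     \<le> (\<integral>\<^sup>+z. (\<integral>\<^sup>+w. ennreal (schur_density k (z - w)) * ennreal (cmod (weigh \<omega> k g w)) \<partial>lborel)\<^sup>2 \<partial>lborel)"
    by (intro nn_integral_mono power_mono) auto
  also have "\<dots> \<le> ennreal ((schur_const k * L2_norm (weigh \<omega> k g))\<^sup>2)" by (rule schur_young[OF g])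
  finally have *: "(\<integral>\<^sup>+z. ennreal (cmod (weigh \<omega> k (fock_projection g) z))^2 \<partial>lborel)
    \<le> ennreal ((schur_const k * L2_norm (weigh \<omega> k g))\<^sup>2)" .
  show "square_integrable (weigh \<omega> k (fock_projection g))"
    "L2_norm (weigh \<omega> k (fock_projection g)) \<le> schur_const k * L2_norm (weigh \<omega> k g)"
    using square_integrableI_bound[OF weigh_measurable[OF \<omega> pm] *] by auto
qed

lemma fock_projection_in_fock:
  assumes "square_integrable g"
  shows "fock_projection g \<in> bargmann_fock"
proof -
  have "square_integrable (weigh japanese_bracket 0 (fock_projection g))"
    using assms by (intro fock_projection_weigh japanese_bracket_weight) auto
  then show ?thesis
    unfolding bargmann_fock_def fock_projection_bargmann_integral[abs_def]
    using bargmann_integral_holomorphic[OF assms]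
    by (auto intro!: exI[of _ "\<lambda>z. complex_of_real (1 / pi) * bargmann_integral g z"] holomorphic_intros)
qed

text \<open>
  The workhorse for double integrals against the kernel: Cauchy-Schwarz in \<open>z\<close> and Young's inequality
  in \<open>w\<close>.
\<close>

lemma schur_test:
  fixes \<Psi> :: "complex \<Rightarrow> complex \<Rightarrow> complex"
  assumes [measurable]: "case_prod \<Psi> \<in> borel_measurable (borel \<Otimes>\<^sub>M borel)"
    and a: "square_integrable a" and b: "square_integrable b"
    and le: "\<And>z w. cmod (\<Psi> z w) \<le> C * (cmod (a z) * (schur_density n (z - w) * cmod (b w)))" and C: "C \<ge> 0"
  shows "integrable (lborel \<Otimes>\<^sub>M lborel) (case_prod \<Psi>)"
    and "cmod (\<integral>z. (\<integral>w. \<Psi> z w \<partial>lborel) \<partial>lborel) \<le> C * (schur_const n * L2_norm a * L2_norm b)"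
proof -
  have [measurable]: "a \<in> borel_measurable borel" "b \<in> borel_measurable borel" using a b by auto
  let ?B = "C * (schur_const n * L2_norm a * L2_norm b)"
  let ?Y = "\<lambda>z. \<integral>\<^sup>+w. ennreal (schur_density n (z - w)) * ennreal (cmod (b w)) \<partial>lborel"
  have m: "case_prod \<Psi> \<in> borel_measurable (lborel \<Otimes>\<^sub>M lborel)" by measurable
  have "(\<integral>\<^sup>+z. ennreal (cmod (a z)) * ?Y z \<partial>lborel)\<^sup>2 \<le> ennreal ((schur_const n * L2_norm a * L2_norm b)\<^sup>2)"
  proof -
    have "(\<integral>\<^sup>+z. ennreal (cmod (a z)) * ?Y z \<partial>lborel)\<^sup>2
        \<le> (\<integral>\<^sup>+z. (ennreal (cmod (a z)))\<^sup>2 \<partial>lborel) * (\<integral>\<^sup>+z. (?Y z)\<^sup>2 \<partial>lborel)"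
      by (rule Cauchy_Schwarz_nn_integral) measurable
    also have "\<dots> \<le> ennreal ((L2_norm a)\<^sup>2) * ennreal ((schur_const n * L2_norm b)\<^sup>2)"
      by (intro mult_mono schur_young[OF b]) (simp_all add: nn_integral_sq_eq[OF a])
    also have "\<dots> = ennreal ((schur_const n * L2_norm a * L2_norm b)\<^sup>2)"
      by (simp add: power_mult_distrib mult_ac flip: ennreal_mult)
    finally show ?thesis .
  qed
  then have *: "(\<integral>\<^sup>+z. ennreal (cmod (a z)) * ?Y z \<partial>lborel)\<^sup>2 \<le> (ennreal (schur_const n * L2_norm a * L2_norm b))\<^sup>2"
    by (simp add: ennreal_power)
  have aY: "(\<integral>\<^sup>+z. ennreal (cmod (a z)) * ?Y z \<partial>lborel) \<le> ennreal (schur_const n * L2_norm a * L2_norm b)"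
  proof (cases "\<integral>\<^sup>+z. ennreal (cmod (a z)) * ?Y z \<partial>lborel" rule: ennreal_cases)
    case (real r)
    then have "r\<^sup>2 \<le> (schur_const n * L2_norm a * L2_norm b)\<^sup>2"
      using * by (simp add: ennreal_power)
    then have "r \<le> schur_const n * L2_norm a * L2_norm b" by (rule power2_le_imp_le) simp
    then show ?thesis using real by (simp add: ennreal_leI)
  next
    case top
    then show ?thesis using * by (simp add: ennreal_power top_unique)
  qed
  have "(\<integral>\<^sup>+z. (\<integral>\<^sup>+w. ennreal (cmod (\<Psi> z w)) \<partial>lborel) \<partial>lborel)
     \<le> (\<integral>\<^sup>+z. (\<integral>\<^sup>+w. ennreal C * (ennreal (cmod (a z)) * (ennreal (schur_density n (z - w)) * ennreal (cmod (b w)))) \<partial>lborel) \<partial>lborel)"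
    using le C by (intro nn_integral_mono) (simp add: ennreal_leI flip: ennreal_mult)
  also have "\<dots> = ennreal C * (\<integral>\<^sup>+z. ennreal (cmod (a z)) * ?Y z \<partial>lborel)"
    by (simp add: nn_integral_cmult)
  also have "\<dots> \<le> ennreal C * ennreal (schur_const n * L2_norm a * L2_norm b)"
    by (intro mult_left_mono aY) simp
  also have "\<dots> = ennreal ?B" using C by (simp flip: ennreal_mult)
  finally have main: "(\<integral>\<^sup>+z. (\<integral>\<^sup>+w. ennreal (cmod (\<Psi> z w)) \<partial>lborel) \<partial>lborel) \<le> ennreal ?B" .
  have pair: "(\<integral>\<^sup>+x. ennreal (cmod (case_prod \<Psi> x)) \<partial>(lborel \<Otimes>\<^sub>M lborel)) \<le> ennreal ?B"
    using main lborel.nn_integral_fst[of "\<lambda>x. ennreal (cmod (case_prod \<Psi> x))" lborel] m by simp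
  show int: "integrable (lborel \<Otimes>\<^sub>M lborel) (case_prod \<Psi>)"
    using m pair by (auto simp: integrable_iff_bounded intro: le_less_trans)
  have "ennreal (cmod (\<integral>x. case_prod \<Psi> x \<partial>(lborel \<Otimes>\<^sub>M lborel))) \<le> ennreal ?B"
    using integral_norm_bound_ennreal[OF int] pair by (rule order_trans)
  then have "cmod (\<integral>x. case_prod \<Psi> x \<partial>(lborel \<Otimes>\<^sub>M lborel)) \<le> ?B"
    using C by (simp add: ennreal_le_iff)
  then show "cmod (\<integral>z. (\<integral>w. \<Psi> z w \<partial>lborel) \<partial>lborel) \<le> ?B"
    using lborel_pair.integral_fst'[OF int] by simp
qed

section \<open>The commutator of a weight with the projection\<close>

lemma power_difference_bound:
  fixes x y M :: real
  assumes "0 \<le> x" "x \<le> M" "0 \<le> y" "y \<le> M"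
  shows "\<bar>x ^ n - y ^ n\<bar> \<le> real n * \<bar>x - y\<bar> * M ^ (n - 1)"
proof (cases n)
  case (Suc m)
  have "\<bar>x ^ Suc m - y ^ Suc m\<bar> \<le> real (Suc m) * \<bar>x - y\<bar> * M ^ m" for m
  proof (induction m)
    case (Suc m)
    have "x ^ Suc (Suc m) - y ^ Suc (Suc m) = x * (x ^ Suc m - y ^ Suc m) + (x - y) * y ^ Suc m"
      by (simp add: algebra_simps)
    also have "\<bar>\<dots>\<bar> \<le> x * \<bar>x ^ Suc m - y ^ Suc m\<bar> + \<bar>x - y\<bar> * y ^ Suc m"
      using assms by (intro order_trans[OF abs_triangle_ineq] add_mono) (auto simp: abs_mult)
    also have "\<dots> \<le> M * (real (Suc m) * \<bar>x - y\<bar> * M ^ m) + \<bar>x - y\<bar> * M ^ Suc m"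
      using assms by (intro add_mono mult_mono Suc.IH power_mono) auto
    also have "\<dots> = real (Suc (Suc m)) * \<bar>x - y\<bar> * M ^ Suc m" by (simp add: algebra_simps)
    finally show ?case .
  qed simp
  then show ?thesis using Suc by simp
qed simp

text \<open>
  The exponent is shifted by two because the remainder vanishes for the exponents 0 and 1.
\<close>

lemma power_taylor_bound:
  fixes x y M :: real
  assumes "0 \<le> x" "x \<le> M" "0 \<le> y" "y \<le> M"
  shows "\<bar>x ^ (n + 2) - y ^ (n + 2) - real (n + 2) * y ^ (n + 1) * (x - y)\<bar> \<le> (real (n + 2))\<^sup>2 * M ^ n * (x - y)\<^sup>2"
proof (induction n)
  case 0
  have "x * x - y * y - 2 * y * (x - y) = (x - y)\<^sup>2" by (simp add: power2_eq_square algebra_simps)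
  then show ?case by simp
next
  case (Suc n)
  let ?e = "x ^ (n + 2) - y ^ (n + 2) - real (n + 2) * y ^ (n + 1) * (x - y)"
  have "x ^ (Suc n + 2) - y ^ (Suc n + 2) - real (Suc n + 2) * y ^ (Suc n + 1) * (x - y)
      = x * ?e + real (n + 2) * y ^ (n + 1) * (x - y)\<^sup>2"
    by (simp add: power2_eq_square algebra_simps)
  also have "\<bar>\<dots>\<bar> \<le> x * \<bar>?e\<bar> + real (n + 2) * y ^ (n + 1) * (x - y)\<^sup>2"
    using assms by (intro order_trans[OF abs_triangle_ineq] add_mono) (auto simp: abs_mult)
  also have "\<dots> \<le> M * ((real (n + 2))\<^sup>2 * M ^ n * (x - y)\<^sup>2) + real (n + 2) * M ^ (n + 1) * (x - y)\<^sup>2"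
    by (rule add_mono[OF mult_mono[OF assms(2) Suc.IH] mult_right_mono[OF mult_left_mono[OF power_mono]]])
      (use assms in auto)
  also have "\<dots> = ((real (n + 2))\<^sup>2 + real (n + 2)) * (M ^ Suc n * (x - y)\<^sup>2)"
    by (simp add: algebra_simps)
  also have "\<dots> \<le> (real (Suc n + 2))\<^sup>2 * (M ^ Suc n * (x - y)\<^sup>2)"
  proof (rule mult_right_mono)
    show "(real (n + 2))\<^sup>2 + real (n + 2) \<le> (real (Suc n + 2))\<^sup>2"
      by (simp add: power2_eq_square algebra_simps)
  qed (use assms in auto)
  finally show ?case by (simp add: mult.assoc)
qed

lemma bargmann_fock_square_integrable: "u \<in> bargmann_fock \<Longrightarrow> square_integrable u"
  by (simp add: bargmann_fock_def)

lemma bargmann_fock_measurable [measurable_dest]: "u \<in> bargmann_fock \<Longrightarrow> u \<in> borel_measurable borel"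
  by (simp add: bargmann_fock_def square_integrable_measurable)

lemma fock_reproducing_cnj:
  assumes "u \<in> bargmann_fock"
  shows "(\<integral>z. cnj (u z) * fock_kernel z w \<partial>lborel) = cnj (u w)"
proof -
  have "cnj (u w) = cnj (\<integral>z. fock_kernel w z * u z \<partial>lborel)"
    using fock_reproducing[OF assms, of w] by (simp add: fock_projection_kernel)
  also have "\<dots> = (\<integral>z. cnj (fock_kernel w z * u z) \<partial>lborel)" by (rule Bochner_Integration.integral_cnj[symmetric])
  finally show ?thesis by (simp add: fock_kernel_cnj mult.commute)
qed

lemma kernel_pair_bound:
  assumes \<omega>: "fock_weight \<omega>" and q: "\<bar>q\<bar> \<le> C * ((1 + cmod (z - w)) ^ n * (\<omega> z ^ i * \<omega> w ^ j))"
  shows "cmod (complex_of_real q * (cnj (u z) * fock_kernel z w * y w))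
    \<le> C * (cmod (weigh \<omega> i u z) * (schur_density n (z - w) * cmod (weigh \<omega> j y w)))"
proof -
  have "cmod (complex_of_real q * (cnj (u z) * fock_kernel z w * y w))
    \<le> (C * ((1 + cmod (z - w)) ^ n * (\<omega> z ^ i * \<omega> w ^ j))) * (cmod (u z) * cmod (fock_kernel z w) * cmod (y w))"
    unfolding norm_mult norm_of_real complex_mod_cnj by (intro mult_right_mono q) auto
  then show ?thesis
    by (simp add: norm_weigh[OF \<omega>] schur_density_def norm_fock_kernel mult_ac)
qed

text \<open>
  With the weight at \<open>w\<close> instead of \<open>z\<close>, the integral over \<open>z\<close> is the reproducing formula for \<open>u\<close>; with
  the weight at \<open>z\<close>, the integral over \<open>w\<close> is the projection of \<open>y\<close>. The Schur test justifies
  the exchange of integrals.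
\<close>

lemma weight_commutator:
  assumes u: "u \<in> bargmann_fock" and \<omega>: "fock_weight \<omega>" and wu: "square_integrable (weigh \<omega> k u)"
    and ym [measurable]: "y \<in> borel_measurable borel" and wy: "square_integrable (weigh \<omega> k y)"
  defines "\<Psi> \<equiv> \<lambda>z w. complex_of_real (\<omega> z ^ (2 * k) - \<omega> w ^ (2 * k)) * (cnj (u z) * fock_kernel z w * y w)"
  shows "integrable (lborel \<Otimes>\<^sub>M lborel) (case_prod \<Psi>)"
    and "(\<integral>z. complex_of_real (\<omega> z ^ (2 * k)) * (cnj (u z) * fock_projection y z) \<partial>lborel)
       = (\<integral>w. complex_of_real (\<omega> w ^ (2 * k)) * (cnj (u w) * y w) \<partial>lborel) + (\<integral>z. (\<integral>w. \<Psi> z w \<partial>lborel) \<partial>lborel)"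
proof -
  have [measurable]: "u \<in> borel_measurable borel" "\<omega> \<in> borel_measurable borel" using u \<omega> by auto
  let ?g = "\<lambda>z. \<omega> z ^ (2 * k)"
  define \<Phi>1 where "\<Phi>1 z w = complex_of_real (?g z) * (cnj (u z) * fock_kernel z w * y w)" for z w
  define \<Phi>2 where "\<Phi>2 z w = complex_of_real (?g w) * (cnj (u z) * fock_kernel z w * y w)" for z w
  have pos: "0 < \<omega> z" for z by (rule fock_weight_pos[OF \<omega>])
  have bound: "?g z \<le> 1 * ((1 + cmod (z - w)) ^ k * (\<omega> z ^ k * \<omega> w ^ k))"
    "?g z \<le> 1 * ((1 + cmod (w - z)) ^ k * (\<omega> w ^ k * \<omega> z ^ k))" for z w
  proof -
    have "\<omega> z ^ k \<le> (\<omega> w * (1 + cmod (z - w))) ^ k"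
      using fock_weight_compare[OF \<omega>, of z w] pos[of z] by (intro power_mono) auto
    then have "\<omega> z ^ k * \<omega> z ^ k \<le> \<omega> z ^ k * (\<omega> w * (1 + cmod (z - w))) ^ k"
      by (rule mult_left_mono) (use pos[of z] in simp)
    then show "?g z \<le> 1 * ((1 + cmod (z - w)) ^ k * (\<omega> z ^ k * \<omega> w ^ k))"
      by (simp add: power_mult_distrib power_mult power2_eq_square mult_ac)
    then show "?g z \<le> 1 * ((1 + cmod (w - z)) ^ k * (\<omega> w ^ k * \<omega> z ^ k))"
      by (simp add: norm_minus_commute mult_ac)
  qed
  have m1: "case_prod \<Phi>1 \<in> borel_measurable (borel \<Otimes>\<^sub>M borel)"
    unfolding \<Phi>1_def[abs_def] by measurable
  have m2: "case_prod \<Phi>2 \<in> borel_measurable (borel \<Otimes>\<^sub>M borel)"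
    unfolding \<Phi>2_def[abs_def] by measurable
  have i1: "integrable (lborel \<Otimes>\<^sub>M lborel) (case_prod \<Phi>1)"
  proof (rule schur_test(1)[OF m1 wu wy])
    show "cmod (\<Phi>1 z w) \<le> 1 * (cmod (weigh \<omega> k u z) * (schur_density k (z - w) * cmod (weigh \<omega> k y w)))" for z w
      unfolding \<Phi>1_def by (rule kernel_pair_bound[OF \<omega>]) (use bound(1)[of z w] pos[of z] in simp)
  qed simp
  have i2: "integrable (lborel \<Otimes>\<^sub>M lborel) (case_prod \<Phi>2)"
  proof (rule schur_test(1)[OF m2 wu wy])
    show "cmod (\<Phi>2 z w) \<le> 1 * (cmod (weigh \<omega> k u z) * (schur_density k (z - w) * cmod (weigh \<omega> k y w)))" for z w
      unfolding \<Phi>2_def by (rule kernel_pair_bound[OF \<omega>]) (use bound(2)[of w z] pos[of w] in simp)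
  qed simp
  have \<Psi>: "\<Psi> = (\<lambda>z w. \<Phi>1 z w - \<Phi>2 z w)"
    by (simp add: \<Psi>_def \<Phi>1_def \<Phi>2_def fun_eq_iff left_diff_distrib)
  then show "integrable (lborel \<Otimes>\<^sub>M lborel) (case_prod \<Psi>)"
    using Bochner_Integration.integrable_diff[OF i1 i2] by (simp add: case_prod_unfold)
  have e1: "(\<integral>w. \<Phi>1 z w \<partial>lborel) = complex_of_real (?g z) * (cnj (u z) * fock_projection y z)" for z
    by (simp add: \<Phi>1_def fock_projection_kernel mult.assoc)
  have "(\<integral>z. (\<integral>w. \<Psi> z w \<partial>lborel) \<partial>lborel) = (\<integral>x. case_prod \<Psi> x \<partial>(lborel \<Otimes>\<^sub>M lborel))"
    using lborel_pair.integral_fst'[of "case_prod \<Psi>"] \<open>integrable _ (case_prod \<Psi>)\<close> by simp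
  also have "\<dots> = (\<integral>x. case_prod \<Phi>1 x \<partial>(lborel \<Otimes>\<^sub>M lborel)) - (\<integral>x. case_prod \<Phi>2 x \<partial>(lborel \<Otimes>\<^sub>M lborel))"
    unfolding \<Psi> using Bochner_Integration.integral_diff[OF i1 i2] by (simp add: case_prod_unfold)
  also have "(\<integral>x. case_prod \<Phi>1 x \<partial>(lborel \<Otimes>\<^sub>M lborel)) = (\<integral>z. (\<integral>w. \<Phi>1 z w \<partial>lborel) \<partial>lborel)"
    using lborel_pair.integral_fst'[OF i1] by simp
  also have "(\<integral>x. case_prod \<Phi>2 x \<partial>(lborel \<Otimes>\<^sub>M lborel)) = (\<integral>w. (\<integral>z. \<Phi>2 z w \<partial>lborel) \<partial>lborel)"
    using lborel_pair.integral_snd[OF i2] by simp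
  also have "\<dots> = (\<integral>w. complex_of_real (?g w) * (cnj (u w) * y w) \<partial>lborel)"
  proof (rule Bochner_Integration.integral_cong[OF refl])
    fix w
    have "(\<integral>z. \<Phi>2 z w \<partial>lborel) = (\<integral>z. (complex_of_real (?g w) * y w) * (cnj (u z) * fock_kernel z w) \<partial>lborel)"
      by (simp add: \<Phi>2_def mult_ac)
    also have "\<dots> = (complex_of_real (?g w) * y w) * cnj (u w)"
      by (simp only: integral_mult_right_zero fock_reproducing_cnj[OF u])
    finally show "(\<integral>z. \<Phi>2 z w \<partial>lborel) = complex_of_real (?g w) * (cnj (u w) * y w)" by (simp add: mult_ac)
  qed
  finally show "(\<integral>z. complex_of_real (\<omega> z ^ (2 * k)) * (cnj (u z) * fock_projection y z) \<partial>lborel)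
       = (\<integral>w. complex_of_real (\<omega> w ^ (2 * k)) * (cnj (u w) * y w) \<partial>lborel) + (\<integral>z. (\<integral>w. \<Psi> z w \<partial>lborel) \<partial>lborel)"
    by (simp add: e1)
qed

abbreviation (input) mass :: "(complex \<Rightarrow> complex) \<Rightarrow> complex \<Rightarrow> complex" where
  "mass v w \<equiv> complex_of_real ((cmod (v w))\<^sup>2)"

lemma weigh_density:
  assumes v: "v \<in> bargmann_fock" and \<omega>: "fock_weight \<omega>" and [measurable]: "u \<in> borel_measurable borel"
    and wu: "square_integrable (weigh \<omega> k u)"
  shows "square_integrable (weigh \<omega> k (\<lambda>w. mass v w * u w))"
    and "L2_norm (weigh \<omega> k (\<lambda>w. mass v w * u w)) \<le> (L2_norm v)\<^sup>2 * L2_norm (weigh \<omega> k u)"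
proof -
  have [measurable]: "v \<in> borel_measurable borel" using v by auto
  have m: "weigh \<omega> k (\<lambda>w. mass v w * u w) \<in> borel_measurable borel"
    by (rule weigh_measurable[OF \<omega>]) measurable
  have le: "cmod (weigh \<omega> k (\<lambda>w. mass v w * u w) z) \<le> (L2_norm v)\<^sup>2 * cmod (weigh \<omega> k u z)" for z
  proof -
    have "(cmod (v z))\<^sup>2 * (\<omega> z ^ k * cmod (u z)) \<le> (L2_norm v)\<^sup>2 * (\<omega> z ^ k * cmod (u z))"
      using fock_weight_pos[OF \<omega>, of z] by (intro mult_right_mono power_mono fock_pointwise_bound v) auto
    then show ?thesis by (simp add: norm_weigh[OF \<omega>] norm_mult norm_power mult_ac)
  qed
  show "square_integrable (weigh \<omega> k (\<lambda>w. mass v w * u w))"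
    "L2_norm (weigh \<omega> k (\<lambda>w. mass v w * u w)) \<le> (L2_norm v)\<^sup>2 * L2_norm (weigh \<omega> k u)"
    using square_integrable_mono[OF wu m le] by simp_all
qed

text \<open>
  Half the time derivative of the squared weighted norm of \<open>u\<close> along \<open>u' = -i \<Pi>(|v|^2 u)\<close>.
\<close>

definition weighted_current :: "(complex \<Rightarrow> real) \<Rightarrow> nat \<Rightarrow> (complex \<Rightarrow> complex) \<Rightarrow> (complex \<Rightarrow> complex) \<Rightarrow> real" where
  "weighted_current \<omega> k u v =
     Im (\<integral>z. complex_of_real (\<omega> z ^ (2 * k)) * (cnj (u z) * fock_projection (\<lambda>w. mass v w * u w) z) \<partial>lborel)"

text \<open>
  The term of \<open>weight_commutator\<close> without double integral is the integral of \<open>\<omega>^(2k) |u|^2 |v|^2\<close>, which is real.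
\<close>

lemma weighted_current_double_integral:
  assumes u: "u \<in> bargmann_fock" and v: "v \<in> bargmann_fock" and \<omega>: "fock_weight \<omega>"
    and wu: "square_integrable (weigh \<omega> k u)"
  defines "\<Psi> \<equiv> \<lambda>z w. complex_of_real (\<omega> z ^ (2 * k) - \<omega> w ^ (2 * k)) * (cnj (u z) * fock_kernel z w * (mass v w * u w))"
  shows "integrable (lborel \<Otimes>\<^sub>M lborel) (case_prod \<Psi>)"
    and "weighted_current \<omega> k u v = Im (\<integral>z. (\<integral>w. \<Psi> z w \<partial>lborel) \<partial>lborel)"
proof -
  have [measurable]: "u \<in> borel_measurable borel" "v \<in> borel_measurable borel" using u v by auto
  have ym: "(\<lambda>w. mass v w * u w) \<in> borel_measurable borel" by measurable
  note wy = weigh_density(1)[OF v \<omega> _ wu]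
  note comm = weight_commutator[OF u \<omega> wu ym wy]
  show "integrable (lborel \<Otimes>\<^sub>M lborel) (case_prod \<Psi>)"
    unfolding \<Psi>_def using comm(1) by simp
  have "cnj (u w) * (mass v w * u w) = complex_of_real ((cmod (v w))\<^sup>2 * (cmod (u w))\<^sup>2)" for w
    by (simp only: of_real_mult complex_norm_square[of "u w"] mult_ac)
  then have "(\<integral>w. complex_of_real (\<omega> w ^ (2 * k)) * (cnj (u w) * (mass v w * u w)) \<partial>lborel)
     = complex_of_real (\<integral>w. \<omega> w ^ (2 * k) * ((cmod (v w))\<^sup>2 * (cmod (u w))\<^sup>2) \<partial>lborel)"
    by (simp only: of_real_mult[symmetric] integral_complex_of_real)
  then show "weighted_current \<omega> k u v = Im (\<integral>z. (\<integral>w. \<Psi> z w \<partial>lborel) \<partial>lborel)"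
    unfolding weighted_current_def \<Psi>_def using comm(2) by simp
qed

text \<open>
  The difference of the weights is at most \<open>2k |z - w|\<close> times the \<open>(2k - 1)\<close>-st power of the larger one.
  These powers are shared between the two variables, \<open>k - 1\<close> at \<open>z\<close> and \<open>k\<close> at \<open>w\<close>. For \<open>k = 0\<close> the bound
  is zero, which is the conservation of the unweighted norm.
\<close>

lemma weighted_current_bound:
  assumes u: "u \<in> bargmann_fock" and v: "v \<in> bargmann_fock" and \<omega>: "fock_weight \<omega>"
    and wu: "square_integrable (weigh \<omega> k u)"
  shows "\<bar>weighted_current \<omega> k u v\<bar>
    \<le> 2 * real k * schur_const (2 * k) * (L2_norm v)\<^sup>2 * (L2_norm (weigh \<omega> (k - 1) u) * L2_norm (weigh \<omega> k u))"
proof -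
  have [measurable]: "u \<in> borel_measurable borel" "v \<in> borel_measurable borel" "\<omega> \<in> borel_measurable borel"
    using u v \<omega> by auto
  define \<Psi> where "\<Psi> z w = complex_of_real (\<omega> z ^ (2 * k) - \<omega> w ^ (2 * k)) * (cnj (u z) * fock_kernel z w * (mass v w * u w))" for z w
  note cur = weighted_current_double_integral[OF u v \<omega> wu]
  have pos: "0 < \<omega> z" for z by (rule fock_weight_pos[OF \<omega>])
  have q: "\<bar>\<omega> z ^ (2 * k) - \<omega> w ^ (2 * k)\<bar>
      \<le> (2 * real k) * ((1 + cmod (z - w)) ^ (2 * k) * (\<omega> z ^ (k - 1) * \<omega> w ^ k))" for z w
  proof (cases k)
    case (Suc j)
    define d where "d = cmod (z - w)"
    define M where "M = max (\<omega> z) (\<omega> w)"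
    have M1: "M \<le> \<omega> z * (1 + d)" "M \<le> \<omega> w * (1 + d)"
      using fock_weight_compare[OF \<omega>, of z w] fock_weight_compare[OF \<omega>, of w z] pos[of z] pos[of w]
      by (auto simp: M_def d_def norm_minus_commute algebra_simps)
    have M0: "0 \<le> M" using pos[of z] by (simp add: M_def)
    have "\<bar>\<omega> z ^ (2 * k) - \<omega> w ^ (2 * k)\<bar> \<le> real (2 * k) * \<bar>\<omega> z - \<omega> w\<bar> * M ^ (2 * k - 1)"
      by (rule power_difference_bound) (use pos[of z] pos[of w] in \<open>auto simp: M_def\<close>)
    also have "\<dots> \<le> real (2 * k) * (1 + d) * ((\<omega> z * (1 + d)) ^ j * (\<omega> w * (1 + d)) ^ k)"
    proof (intro mult_mono)
      show "\<bar>\<omega> z - \<omega> w\<bar> \<le> 1 + d" using fock_weight_lipschitz[OF \<omega>, of z w] by (simp add: d_def)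
      have "M ^ (2 * k - 1) = M ^ j * M ^ k" by (simp add: Suc flip: power_add) (simp add: mult_2)
      also have "\<dots> \<le> (\<omega> z * (1 + d)) ^ j * (\<omega> w * (1 + d)) ^ k"
        using M0 pos[of z] pos[of w] by (intro mult_mono power_mono M1) (auto simp: d_def)
      finally show "M ^ (2 * k - 1) \<le> (\<omega> z * (1 + d)) ^ j * (\<omega> w * (1 + d)) ^ k" .
    qed (use M0 in \<open>auto simp: d_def\<close>)
    also have "\<dots> = (2 * real k) * ((1 + d) ^ (2 * k) * (\<omega> z ^ (k - 1) * \<omega> w ^ k))"
      by (simp add: Suc power_mult_distrib power_mult power2_eq_square mult_ac)
    finally show ?thesis by (simp add: d_def)
  qed simp
  have m: "case_prod \<Psi> \<in> borel_measurable (borel \<Otimes>\<^sub>M borel)" unfolding \<Psi>_def[abs_def] by measurable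
  have "\<bar>weighted_current \<omega> k u v\<bar> \<le> cmod (\<integral>z. (\<integral>w. \<Psi> z w \<partial>lborel) \<partial>lborel)"
    unfolding cur(2) \<Psi>_def by (rule abs_Im_le_cmod)
  also have "\<dots> \<le> (2 * real k) * (schur_const (2 * k) * L2_norm (weigh \<omega> (k - 1) u) * L2_norm (weigh \<omega> k (\<lambda>w. mass v w * u w)))"
  proof (rule schur_test(2)[OF m weigh_mono_exponent(1)[OF \<omega> _ _ wu] weigh_density(1)[OF v \<omega> _ wu]])
    show "cmod (\<Psi> z w) \<le> (2 * real k) * (cmod (weigh \<omega> (k - 1) u z) *
        (schur_density (2 * k) (z - w) * cmod (weigh \<omega> k (\<lambda>w. mass v w * u w) w)))" for z w
      unfolding \<Psi>_def by (rule kernel_pair_bound[OF \<omega> q])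
  qed auto
  also have "\<dots> \<le> (2 * real k) * (schur_const (2 * k) * L2_norm (weigh \<omega> (k - 1) u) * ((L2_norm v)\<^sup>2 * L2_norm (weigh \<omega> k u)))"
    by (intro mult_left_mono weigh_density(2)[OF v \<omega> _ wu]) auto
  finally show ?thesis by (simp add: mult_ac)
qed


section \<open>Cancellation of the leading order\<close>

lemma japanese_bracket_sq: "(japanese_bracket z)\<^sup>2 = 1 + (cmod z)\<^sup>2"
  by (simp add: japanese_bracket_def)

text \<open>
  On the entire factor, \<open>\<Pi>\<close> composed with multiplication by \<open>conj w\<close> is differentiation, and \<open>w u\<close> is again an
  element of the Fock space, reproduced by \<open>\<Pi>\<close>. Hence multiplication by \<open>|w|^2\<close> followed by \<open>\<Pi>\<close> acts as \<open>f \<mapsto> (z f)'\<close>.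
\<close>

lemma fock_projection_norm_sq:
  assumes hol: "f holomorphic_on UNIV"
    and u: "\<And>z. u z = complex_of_real (exp (- (cmod z)\<^sup>2 / 2)) * f z"
    and w1: "square_integrable (weigh japanese_bracket 1 u)"
  shows "fock_projection (\<lambda>w. complex_of_real ((cmod w)\<^sup>2) * u w) z
    = complex_of_real (exp (- (cmod z)\<^sup>2 / 2)) * (f z + z * deriv f z)"
proof -
  have um [measurable]: "u \<in> borel_measurable borel"
  proof -
    have [measurable]: "f \<in> borel_measurable borel"
      using hol by (intro borel_measurable_continuous_onI holomorphic_on_imp_continuous_on)
    show ?thesis unfolding u[abs_def] by measurable
  qed
  let ?g = "\<lambda>w. w * u w"
  have le: "cmod (?g w) \<le> 1 * cmod (weigh japanese_bracket 1 u w)" for w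
  proof -
    have "cmod w \<le> japanese_bracket w" by (simp add: japanese_bracket_def real_le_rsqrt)
    then show ?thesis by (simp add: norm_weigh[OF japanese_bracket_weight] norm_mult mult_right_mono)
  qed
  have gsq: "square_integrable ?g"
    by (rule square_integrable_mono(1)[OF w1 _ le]) simp_all
  have gin: "?g \<in> bargmann_fock"
    unfolding bargmann_fock_def using gsq hol
    by (auto intro!: exI[of _ "\<lambda>w. w * f w"] holomorphic_intros simp: u mult_ac)
  have BI': "bargmann_integral ?g z = complex_of_real pi * (z * f z)" for z
    using fock_reproducing[OF gin, of z] unfolding fock_projection_bargmann_integral u
    by (simp add: field_simps)
  have BI: "bargmann_integral ?g = (\<lambda>z. complex_of_real pi * (z * f z))" by (rule ext) (rule BI')
  have fd: "(f has_field_derivative deriv f z) (at z)"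
    using hol by (simp add: holomorphic_derivI)
  have "((\<lambda>z. complex_of_real pi * (z * f z)) has_field_derivative complex_of_real pi * (f z + z * deriv f z)) (at z)"
    using fd by (auto intro!: derivative_eq_intros)
  moreover have "((\<lambda>z. complex_of_real pi * (z * f z)) has_field_derivative bargmann_integral (\<lambda>w. cnj w * (w * u w)) z) (at z)"
    using bargmann_integral_has_derivative[OF gsq, of z] unfolding BI .
  ultimately have "bargmann_integral (\<lambda>w. cnj w * (w * u w)) z = complex_of_real pi * (f z + z * deriv f z)"
    by (rule DERIV_unique[symmetric])
  moreover have "(\<lambda>w. complex_of_real ((cmod w)\<^sup>2) * u w) = (\<lambda>w. cnj w * (w * u w))"
    unfolding complex_norm_square by (simp add: fun_eq_iff mult_ac)
  ultimately show ?thesis unfolding fock_projection_bargmann_integral by simp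
qed

text \<open>
  Zero for \<open>k \<le> 1\<close>, where \<open>a^k\<close> is affine in \<open>a\<close>. This is why the difference of the norms is constant
  for these \<open>k\<close>.
\<close>

definition taylor_const :: "nat \<Rightarrow> real" where
  "taylor_const k = (if k \<le> 1 then 0 else 4 * (real k)\<^sup>2)"

lemma taylor_const_nonneg [simp]: "taylor_const k \<ge> 0"
  by (simp add: taylor_const_def)

text \<open>
  With the larger bracket \<open>M\<close>, the second-order remainder in \<open>a = <z>^2\<close> is of size \<open>M^(2k - 4) (a - b)^2\<close>,
  and \<open>|a - b| \<le> 2 |z - w| M\<close>.
\<close>

lemma bracket_taylor:
  fixes z w :: complex
  defines "a \<equiv> (japanese_bracket z)\<^sup>2" and "b \<equiv> (japanese_bracket w)\<^sup>2"
  shows "\<bar>a ^ k - b ^ k - real k * b ^ (k - 1) * (a - b)\<bar>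
    \<le> taylor_const k * ((1 + cmod (z - w)) ^ (2 * k) * (japanese_bracket z ^ (k - 1) * japanese_bracket w ^ (k - 1)))"
proof (cases "k \<le> 1")
  case True
  then have "k = 0 \<or> k = 1" by auto
  then show ?thesis by (auto simp: taylor_const_def)
next
  case False
  then obtain n where k: "k = n + 2" by (metis add.commute le_Suc_ex not_less_eq_eq numeral_2_eq_2 One_nat_def)
  define d where "d = cmod (z - w)"
  define M where "M = max (japanese_bracket z) (japanese_bracket w)"
  note \<omega> = japanese_bracket_weight
  have pos: "0 < japanese_bracket z" for z by (rule fock_weight_pos[OF \<omega>])
  have M0: "0 < M" using pos[of z] by (simp add: M_def)
  have M1: "M \<le> japanese_bracket z * (1 + d)" "M \<le> japanese_bracket w * (1 + d)"
    using fock_weight_compare[OF \<omega>, of z w] fock_weight_compare[OF \<omega>, of w z] pos[of z] pos[of w]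
    by (auto simp: M_def d_def norm_minus_commute algebra_simps)
  have "\<bar>a ^ (n + 2) - b ^ (n + 2) - real (n + 2) * b ^ (n + 1) * (a - b)\<bar> \<le> (real (n + 2))\<^sup>2 * (M\<^sup>2) ^ n * (a - b)\<^sup>2"
    by (rule power_taylor_bound)
      (use pos[of z] pos[of w] in \<open>auto simp: a_def b_def M_def intro!: power_mono\<close>)
  also have "\<dots> \<le> (real (n + 2))\<^sup>2 * (M\<^sup>2) ^ n * (4 * d\<^sup>2 * M\<^sup>2)"
  proof (rule mult_left_mono)
    have "\<bar>a - b\<bar> = \<bar>japanese_bracket z - japanese_bracket w\<bar> * (japanese_bracket z + japanese_bracket w)"
    proof -
      have "a - b = (japanese_bracket z - japanese_bracket w) * (japanese_bracket z + japanese_bracket w)"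
        by (simp add: a_def b_def power2_eq_square algebra_simps)
      then show ?thesis using pos[of z] pos[of w] by (simp add: abs_mult)
    qed
    also have "\<dots> \<le> d * (2 * M)"
      using fock_weight_lipschitz[OF \<omega>, of z w] pos[of z] pos[of w]
      by (intro mult_mono) (auto simp: d_def M_def)
    finally have "\<bar>a - b\<bar>\<^sup>2 \<le> (d * (2 * M))\<^sup>2" by (rule power_mono) simp
    then show "(a - b)\<^sup>2 \<le> 4 * d\<^sup>2 * M\<^sup>2" by (simp add: power_mult_distrib)
  qed simp
  also have "\<dots> = taylor_const k * (d\<^sup>2 * (M ^ (n + 1) * M ^ (n + 1)))"
    by (simp add: taylor_const_def k power_mult[symmetric] power2_eq_square power_mult_distrib mult_ac)
  also have "\<dots> \<le> taylor_const k * ((1 + d)\<^sup>2 * ((japanese_bracket z * (1 + d)) ^ (n + 1) * (japanese_bracket w * (1 + d)) ^ (n + 1)))"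
    using M0 pos[of z] pos[of w] by (intro mult_left_mono mult_mono power_mono M1) (auto simp: d_def)
  also have "\<dots> = taylor_const k * ((1 + d) ^ (2 * k) * (japanese_bracket z ^ (k - 1) * japanese_bracket w ^ (k - 1)))"
    by (simp add: k power_mult_distrib power_mult power2_eq_square mult_ac)
  finally show ?thesis by (simp add: k d_def)
qed


text \<open>
  The linear Taylor term \<open>k <w>^(2k - 2) (|z|^2 - |w|^2)\<close> of the weight difference depends on \<open>z\<close> only through
  \<open>|z|^2\<close>; its integral over \<open>z\<close> is evaluated by \<open>fock_projection_norm_sq\<close> and gives \<open>D\<close>. The remainder is
  left to the Schur test.
\<close>

lemma current_leading_order:
  assumes hol: "f holomorphic_on UNIV"
    and u: "\<And>z. u z = complex_of_real (exp (- (cmod z)\<^sup>2 / 2)) * f z"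
    and uin: "u \<in> bargmann_fock" and v: "v \<in> bargmann_fock"
    and k: "k \<ge> 1" and wu: "square_integrable (weigh japanese_bracket k u)"
  defines "D \<equiv> \<lambda>w. complex_of_real (real k * ((japanese_bracket w)\<^sup>2) ^ (k - 1)) * (mass v w * u w) *
      cnj (complex_of_real (exp (- (cmod w)\<^sup>2 / 2)) * (f w + w * deriv f w) - complex_of_real ((cmod w)\<^sup>2) * u w)"
  shows "integrable lborel D"
    and "\<bar>weighted_current japanese_bracket k u v - Im (\<integral>w. D w \<partial>lborel)\<bar>
      \<le> taylor_const k * schur_const (2 * k) * ((L2_norm v)\<^sup>2 * (L2_norm (weigh japanese_bracket (k - 1) u))\<^sup>2)"
proof -
  note \<omega> = japanese_bracket_weight
  have [measurable]: "u \<in> borel_measurable borel" "v \<in> borel_measurable borel" "japanese_bracket \<in> borel_measurable borel"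
    using uin v \<omega> by auto
  let ?J = "\<lambda>z. (japanese_bracket z)\<^sup>2"
  let ?y = "\<lambda>w. mass v w * u w"
  define \<Psi> where "\<Psi> z w = complex_of_real (japanese_bracket z ^ (2 * k) - japanese_bracket w ^ (2 * k)) * (cnj (u z) * fock_kernel z w * ?y w)" for z w
  define Q where "Q z w = complex_of_real (real k * (?J w) ^ (k - 1) * (?J z - ?J w)) * (cnj (u z) * fock_kernel z w * ?y w)" for z w
  define R where "R z w = complex_of_real (?J z ^ k - ?J w ^ k - real k * ?J w ^ (k - 1) * (?J z - ?J w)) * (cnj (u z) * fock_kernel z w * ?y w)" for z w
  have split: "\<Psi> z w = Q z w + R z w" for z w
    by (simp add: \<Psi>_def Q_def R_def power_mult left_diff_distrib)
  have \<Psi>i: "integrable (lborel \<Otimes>\<^sub>M lborel) (case_prod \<Psi>)"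
    using weighted_current_double_integral(1)[OF uin v \<omega> wu] unfolding \<Psi>_def .
  have cur: "weighted_current japanese_bracket k u v = Im (\<integral>z. (\<integral>w. \<Psi> z w \<partial>lborel) \<partial>lborel)"
    using weighted_current_double_integral(2)[OF uin v \<omega> wu] unfolding \<Psi>_def .
  have wu': "square_integrable (weigh japanese_bracket (k - 1) u)"
    and w1: "square_integrable (weigh japanese_bracket 1 u)"
    using k by (auto intro!: weigh_mono_exponent(1)[OF \<omega> _ _ wu])
  have Rm: "case_prod R \<in> borel_measurable (borel \<Otimes>\<^sub>M borel)" unfolding R_def[abs_def] by measurable
  have Rb: "cmod (R z w) \<le> taylor_const k * (cmod (weigh japanese_bracket (k - 1) u z) *
      (schur_density (2 * k) (z - w) * cmod (weigh japanese_bracket (k - 1) ?y w)))" for z w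
    unfolding R_def by (rule kernel_pair_bound[OF \<omega> bracket_taylor])
  note Rtest = schur_test[OF Rm wu' weigh_density(1)[OF v \<omega> _ wu'] Rb taylor_const_nonneg, simplified]
  have Qi: "integrable (lborel \<Otimes>\<^sub>M lborel) (case_prod Q)"
    using Bochner_Integration.integrable_diff[OF \<Psi>i Rtest(1)] by (simp add: split case_prod_unfold)
  have DQ: "(\<integral>z. Q z w \<partial>lborel) = D w" for w
  proof -
    have K1: "integrable lborel (\<lambda>z. fock_kernel w z * u z)"
      by (intro L2_cross_integrable fock_kernel_square_integrable bargmann_fock_square_integrable uin)
    have K2: "integrable lborel (\<lambda>z. fock_kernel w z * (complex_of_real ((cmod z)\<^sup>2) * u z))"
    proof -
      have "integrable lborel (\<lambda>z. exp (cnj z * w - complex_of_real ((cmod z)\<^sup>2 / 2)) * (complex_of_real ((cmod z)\<^sup>2) * u z))"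
        by (rule bargmann_integrable[OF bargmann_fock_square_integrable[OF uin], where n = 2])
          (auto simp: norm_power intro!: power_mono)
      then show ?thesis unfolding fock_kernel_def by (simp only: mult.assoc integrable_mult_right)
    qed
    have "(\<integral>z. Q z w \<partial>lborel) = (\<integral>z. (complex_of_real (real k * (?J w) ^ (k - 1)) * ?y w) *
        cnj (fock_kernel w z * (complex_of_real ((cmod z)\<^sup>2) * u z) - complex_of_real ((cmod w)\<^sup>2) * (fock_kernel w z * u z)) \<partial>lborel)"
      by (intro Bochner_Integration.integral_cong refl)
        (simp add: Q_def japanese_bracket_sq fock_kernel_cnj algebra_simps)
    also have "\<dots> = (complex_of_real (real k * (?J w) ^ (k - 1)) * ?y w) *
        cnj (fock_projection (\<lambda>z. complex_of_real ((cmod z)\<^sup>2) * u z) w - complex_of_real ((cmod w)\<^sup>2) * fock_projection u w)"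
      unfolding fock_projection_kernel
      by (simp only: integral_mult_right_zero Bochner_Integration.integral_cnj
          Bochner_Integration.integral_diff[OF K2 integrable_mult_right[OF K1]])
    also have "\<dots> = D w"
      unfolding fock_projection_norm_sq[OF hol u w1] fock_reproducing[OF uin] D_def by simp
    finally show ?thesis .
  qed
  show "integrable lborel D"
    using lborel_pair.integrable_snd[OF Qi] by (simp add: DQ)
  have "(\<integral>z. (\<integral>w. \<Psi> z w \<partial>lborel) \<partial>lborel) = (\<integral>x. case_prod \<Psi> x \<partial>(lborel \<Otimes>\<^sub>M lborel))"
    using lborel_pair.integral_fst'[OF \<Psi>i] by simp
  also have "\<dots> = (\<integral>x. case_prod Q x \<partial>(lborel \<Otimes>\<^sub>M lborel)) + (\<integral>x. case_prod R x \<partial>(lborel \<Otimes>\<^sub>M lborel))"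
    using Bochner_Integration.integral_add[OF Qi Rtest(1)] by (simp add: split case_prod_unfold)
  also have "(\<integral>x. case_prod Q x \<partial>(lborel \<Otimes>\<^sub>M lborel)) = (\<integral>w. D w \<partial>lborel)"
    using lborel_pair.integral_snd[OF Qi] by (simp add: DQ)
  also have "(\<integral>x. case_prod R x \<partial>(lborel \<Otimes>\<^sub>M lborel)) = (\<integral>z. (\<integral>w. R z w \<partial>lborel) \<partial>lborel)"
    using lborel_pair.integral_fst'[OF Rtest(1)] by simp
  finally have "\<bar>weighted_current japanese_bracket k u v - Im (\<integral>w. D w \<partial>lborel)\<bar> = \<bar>Im (\<integral>z. (\<integral>w. R z w \<partial>lborel) \<partial>lborel)\<bar>"
    by (simp add: cur)
  also have "\<dots> \<le> cmod (\<integral>z. (\<integral>w. R z w \<partial>lborel) \<partial>lborel)" by (rule abs_Im_le_cmod)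
  also have "\<dots> \<le> taylor_const k * (schur_const (2 * k) * L2_norm (weigh japanese_bracket (k - 1) u) * L2_norm (weigh japanese_bracket (k - 1) ?y))"
    by (rule schur_test(2)[OF Rm wu' weigh_density(1)[OF v \<omega> _ wu'] Rb taylor_const_nonneg]) simp
  also have "\<dots> \<le> taylor_const k * (schur_const (2 * k) * L2_norm (weigh japanese_bracket (k - 1) u) * ((L2_norm v)\<^sup>2 * L2_norm (weigh japanese_bracket (k - 1) u)))"
    by (intro mult_left_mono weigh_density(2)[OF v \<omega> _ wu']) auto
  finally show "\<bar>weighted_current japanese_bracket k u v - Im (\<integral>w. D w \<partial>lborel)\<bar>
      \<le> taylor_const k * schur_const (2 * k) * ((L2_norm v)\<^sup>2 * (L2_norm (weigh japanese_bracket (k - 1) u))\<^sup>2)"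
    by (simp add: power2_eq_square mult_ac)
qed

text \<open>
  The sum of the two leading terms involves \<open>f\<close> and \<open>h\<close>, up to real contributions, only through
  \<open>w p'(w) conj(p(w))\<close> with \<open>p = f h\<close>, because \<open>p' = f' h + f h'\<close>.
\<close>

lemma current_cancellation:
  assumes uin: "u \<in> bargmann_fock" and vin: "v \<in> bargmann_fock"
    and wu: "square_integrable (weigh japanese_bracket k u)" and wv: "square_integrable (weigh japanese_bracket k v)"
  shows "\<bar>weighted_current japanese_bracket k u v + weighted_current japanese_bracket k v u\<bar>
    \<le> taylor_const k * schur_const (2 * k) *
      ((L2_norm v)\<^sup>2 * (L2_norm (weigh japanese_bracket (k - 1) u))\<^sup>2 + (L2_norm u)\<^sup>2 * (L2_norm (weigh japanese_bracket (k - 1) v))\<^sup>2)"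
proof (cases "k = 0")
  case True
  then show ?thesis
    using weighted_current_bound[OF uin vin japanese_bracket_weight wu]
      weighted_current_bound[OF vin uin japanese_bracket_weight wv] by (simp add: taylor_const_def)
next
  case False
  then have k: "k \<ge> 1" by simp
  have [measurable]: "u \<in> borel_measurable borel" "v \<in> borel_measurable borel" "japanese_bracket \<in> borel_measurable borel"
    using uin vin japanese_bracket_weight by auto
  obtain f where f: "f holomorphic_on UNIV" and u: "\<And>z. u z = complex_of_real (exp (- (cmod z)\<^sup>2 / 2)) * f z"
    using uin unfolding bargmann_fock_def by blast
  obtain h where h: "h holomorphic_on UNIV" and v: "\<And>z. v z = complex_of_real (exp (- (cmod z)\<^sup>2 / 2)) * h z"
    using vin unfolding bargmann_fock_def by blast
  note Du = current_leading_order[OF f u uin vin k wu] and Dv = current_leading_order[OF h v vin uin k wv]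
  define D1 where "D1 w = complex_of_real (real k * ((japanese_bracket w)\<^sup>2) ^ (k - 1)) * (mass v w * u w) *
      cnj (complex_of_real (exp (- (cmod w)\<^sup>2 / 2)) * (f w + w * deriv f w) - complex_of_real ((cmod w)\<^sup>2) * u w)" for w
  define D2 where "D2 w = complex_of_real (real k * ((japanese_bracket w)\<^sup>2) ^ (k - 1)) * (mass u w * v w) *
      cnj (complex_of_real (exp (- (cmod w)\<^sup>2 / 2)) * (h w + w * deriv h w) - complex_of_real ((cmod w)\<^sup>2) * v w)" for w
  have i1: "integrable lborel D1" and i2: "integrable lborel D2"
    using Du(1) Dv(1) by (simp_all add: D1_def[abs_def] D2_def[abs_def])
  define \<rho> where "\<rho> r = real k * (1 + r\<^sup>2) ^ (k - 1) * exp (- (2 * r\<^sup>2))" for r :: real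
  define p where "p w = f w * h w" for w
  define X where "X w = 2 * real k * ((japanese_bracket w)\<^sup>2) ^ (k - 1) * (1 - (cmod w)\<^sup>2) * ((cmod (u w))\<^sup>2 * (cmod (v w))\<^sup>2)" for w
  have p: "p holomorphic_on UNIV" unfolding p_def[abs_def] using f h by (intro holomorphic_intros)
  have dp: "deriv p w = deriv f w * h w + f w * deriv h w" for w
    unfolding p_def[abs_def] using f h
    by (simp add: deriv_mult holomorphic_on_imp_differentiable_at algebra_simps)
  \<comment> \<open>\<open>X\<close> collects the real contributions.\<close>
  have key: "D1 w + D2 w = complex_of_real (X w) + cnj (complex_of_real (\<rho> (cmod w)) * ((w * deriv p w) * cnj (p w)))" for w
  proof -
    define e where "e = complex_of_real (exp (- (cmod w)\<^sup>2 / 2))"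
    define c where "c = complex_of_real (real k * ((japanese_bracket w)\<^sup>2) ^ (k - 1))"
    define s where "s = complex_of_real ((cmod w)\<^sup>2)"
    have ce: "cnj e = e" and cs: "cnj s = s" and cc: "cnj c = c" by (simp_all add: e_def s_def c_def)
    have e4: "complex_of_real (exp (- (2 * (cmod w)\<^sup>2))) = e * e * e * e"
      unfolding e_def of_real_mult[symmetric] exp_add[symmetric] by simp
    have \<rho>: "complex_of_real (\<rho> (cmod w)) = c * (e * e * e * e)"
      unfolding \<rho>_def c_def e4[symmetric] japanese_bracket_sq by simp
    have mv: "mass v w = (e * h w) * (e * cnj (h w))" and mu: "mass u w = (e * f w) * (e * cnj (f w))"
      unfolding complex_norm_square u v e_def[symmetric] complex_cnj_mult ce by simp_all
    have X: "complex_of_real (X w) = 2 * c * (1 - s) * (mass u w * mass v w)"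
      by (simp add: X_def c_def s_def)
    show ?thesis
      unfolding D1_def D2_def X \<rho> mv mu
      unfolding u v e_def[symmetric] c_def[symmetric] s_def[symmetric] dp
      unfolding p_def complex_cnj_mult complex_cnj_diff complex_cnj_add complex_cnj_cnj ce cs cc
      by (simp add: algebra_simps)
  qed
  have Xi: "integrable lborel (\<lambda>w. complex_of_real (X w))"
  proof -
    have "integrable lborel (\<lambda>w. 2 * real k * (L2_norm v)\<^sup>2 * (cmod (weigh japanese_bracket k u w))\<^sup>2)"
      using wu by (simp add: square_integrable_def)
    then have "integrable lborel X"
    proof (rule Bochner_Integration.integrable_bound)
      show "X \<in> borel_measurable lborel" unfolding X_def[abs_def] by measurable
      show "AE w in lborel. norm (X w) \<le> norm (2 * real k * (L2_norm v)\<^sup>2 * (cmod (weigh japanese_bracket k u w))\<^sup>2)"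
      proof (rule AE_I2)
        fix w
        have "\<bar>1 - (cmod w)\<^sup>2\<bar> \<le> (japanese_bracket w)\<^sup>2"
          unfolding japanese_bracket_sq using zero_le_power2[of "cmod w"] by linarith
        moreover have "(cmod (v w))\<^sup>2 \<le> (L2_norm v)\<^sup>2"
          by (intro power_mono fock_pointwise_bound vin) simp
        ultimately have "norm (X w) \<le> 2 * real k * ((japanese_bracket w)\<^sup>2) ^ (k - 1) * (japanese_bracket w)\<^sup>2 * ((cmod (u w))\<^sup>2 * (L2_norm v)\<^sup>2)"
          unfolding X_def real_norm_def abs_mult by (intro mult_mono) auto
        also have "\<dots> = 2 * real k * (L2_norm v)\<^sup>2 * ((((japanese_bracket w)\<^sup>2) ^ (k - 1) * (japanese_bracket w)\<^sup>2) * (cmod (u w))\<^sup>2)"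
          by (simp only: mult_ac)
        also have "((japanese_bracket w)\<^sup>2) ^ (k - 1) * (japanese_bracket w)\<^sup>2 = (japanese_bracket w ^ k)\<^sup>2"
          using k by (metis One_nat_def Suc_pred less_eq_Suc_le mult.commute power_Suc power_mult)
        also have "(japanese_bracket w ^ k)\<^sup>2 * (cmod (u w))\<^sup>2 = (cmod (weigh japanese_bracket k u w))\<^sup>2"
          by (simp add: norm_weigh[OF japanese_bracket_weight] power_mult_distrib)
        finally show "norm (X w) \<le> norm (2 * real k * (L2_norm v)\<^sup>2 * (cmod (weigh japanese_bracket k u w))\<^sup>2)"
          by simp
      qed
    qed
    then show ?thesis by simp
  qed
  have Pi: "integrable lborel (\<lambda>w. complex_of_real (\<rho> (cmod w)) * ((w * deriv p w) * cnj (p w)))"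
  proof -
    have "integrable lborel (\<lambda>w. D1 w + D2 w - complex_of_real (X w))" using i1 i2 Xi by simp
    then have "integrable lborel (\<lambda>w. cnj (complex_of_real (\<rho> (cmod w)) * ((w * deriv p w) * cnj (p w))))"
      unfolding key by simp
    then show ?thesis by (simp only: complex_integrable_cnj)
  qed
  have "Im ((\<integral>w. D1 w \<partial>lborel) + (\<integral>w. D2 w \<partial>lborel)) = Im (\<integral>w. D1 w + D2 w \<partial>lborel)"
    using i1 i2 by simp
  also have "(\<integral>w. D1 w + D2 w \<partial>lborel) = (\<integral>w. complex_of_real (X w) \<partial>lborel) + cnj (\<integral>w. complex_of_real (\<rho> (cmod w)) * ((w * deriv p w) * cnj (p w)) \<partial>lborel)"
    unfolding key using Xi Pi
    by (simp only: Bochner_Integration.integral_add integrable_cnj Bochner_Integration.integral_cnj)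
  also have "Im \<dots> = 0"
    using radial_angular_derivative_real[OF p _ Pi] by (simp add: \<rho>_def[abs_def] continuous_intros)
  finally have "Im (\<integral>w. D1 w \<partial>lborel) + Im (\<integral>w. D2 w \<partial>lborel) = 0" by simp
  then show ?thesis
    using Du(2)[folded D1_def] Dv(2)[folded D2_def]
    unfolding distrib_left[of "taylor_const k * schur_const (2 * k)"] by linarith
qed

section \<open>The Fock space as a Hilbert space\<close>

lemma bargmann_fock_iff:
  "u \<in> bargmann_fock \<longleftrightarrow> (\<lambda>z. complex_of_real (exp ((cmod z)\<^sup>2 / 2)) * u z) holomorphic_on UNIV \<and> square_integrable u"
proof
  assume "u \<in> bargmann_fock"
  then obtain f where f: "f holomorphic_on UNIV" "\<And>z. u z = complex_of_real (exp (- (cmod z)\<^sup>2 / 2)) * f z" "square_integrable u"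
    unfolding bargmann_fock_def by blast
  have "(\<lambda>z. complex_of_real (exp ((cmod z)\<^sup>2 / 2)) * u z) = f"
    by (simp add: f(2) fun_eq_iff flip: mult.assoc of_real_mult exp_add)
  with f show "(\<lambda>z. complex_of_real (exp ((cmod z)\<^sup>2 / 2)) * u z) holomorphic_on UNIV \<and> square_integrable u" by simp
next
  assume *: "(\<lambda>z. complex_of_real (exp ((cmod z)\<^sup>2 / 2)) * u z) holomorphic_on UNIV \<and> square_integrable u"
  have "u z = complex_of_real (exp (- (cmod z)\<^sup>2 / 2)) * (complex_of_real (exp ((cmod z)\<^sup>2 / 2)) * u z)" for z
    by (simp flip: mult.assoc of_real_mult exp_add)
  with * show "u \<in> bargmann_fock" unfolding bargmann_fock_def by blast
qed

lemma bargmann_fock_add: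
  assumes "u \<in> bargmann_fock" "v \<in> bargmann_fock" shows "(\<lambda>z. u z + v z) \<in> bargmann_fock"
  using assms square_integrable_add(1)[of u v]
  unfolding bargmann_fock_iff distrib_left by (auto intro: holomorphic_on_add)

lemma bargmann_fock_cmult:
  assumes "u \<in> bargmann_fock" shows "(\<lambda>z. c * u z) \<in> bargmann_fock"
  using assms square_integrable_cmult(1)[of u c] holomorphic_on_mult[of "\<lambda>_. c" UNIV "\<lambda>z. complex_of_real (exp ((cmod z)\<^sup>2 / 2)) * u z"]
  unfolding bargmann_fock_iff by (auto simp: mult_ac)

lemma bargmann_fock_zero: "(\<lambda>z. 0) \<in> bargmann_fock"
  by (simp add: bargmann_fock_iff)

lemma bargmann_fock_diff:
  assumes "u \<in> bargmann_fock" "v \<in> bargmann_fock" shows "(\<lambda>z. u z - v z) \<in> bargmann_fock"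
  using bargmann_fock_add[OF assms(1) bargmann_fock_cmult[OF assms(2), of "-1"]] by simp

text \<open>
  The elements of the space form a type, with the real part of the \<open>L2\<close> inner product. Only the real
  Hilbert space structure is used, since the nonlinearity is not complex linear.
\<close>

typedef fock = bargmann_fock
  morphisms fock_fun Fock
  using bargmann_fock_zero by blast

lemma fock_fun_in [simp, intro]: "fock_fun x \<in> bargmann_fock" by (rule fock_fun)

lemma fock_fun_square_integrable [simp, intro]: "square_integrable (fock_fun x)"
  by (rule bargmann_fock_square_integrable) simp

lemma fock_fun_measurable [measurable]: "fock_fun x \<in> borel_measurable borel"
  by (rule bargmann_fock_measurable) simp

lemma fock_eqI: "(\<And>z. fock_fun x z = fock_fun y z) \<Longrightarrow> x = y"
  using fock_fun_inject by blast

instantiation fock :: real_inner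
begin

definition "0 = Fock (\<lambda>z. 0)"
definition "x + y = Fock (\<lambda>z. fock_fun x z + fock_fun y z)"
definition "x - y = Fock (\<lambda>z. fock_fun x z - fock_fun y z)"
definition "- x = Fock (\<lambda>z. - fock_fun x z)"
definition "r *\<^sub>R x = Fock (\<lambda>z. complex_of_real r * fock_fun x z)" for x :: fock
definition "inner x y = Re (\<integral>z. fock_fun x z * cnj (fock_fun y z) \<partial>lborel)"
definition "norm x = L2_norm (fock_fun x)"
definition "sgn x = inverse (norm x) *\<^sub>R x" for x :: fock
definition "dist x y = norm (x - y)" for x y :: fock
definition "(uniformity :: (fock \<times> fock) filter) = (INF e\<in>{0 <..}. principal {(x, y). dist x y < e})"
definition "open (S :: fock set) = (\<forall>x\<in>S. \<forall>\<^sub>F (x', y) in uniformity. x' = x \<longrightarrow> y \<in> S)"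

lemma fock_fun_zero_raw: "fock_fun 0 z = 0"
  by (simp add: zero_fock_def Fock_inverse bargmann_fock_zero)
lemma fock_fun_add_raw: "fock_fun (x + y) z = fock_fun x z + fock_fun y z"
  by (simp add: plus_fock_def Fock_inverse bargmann_fock_add)
lemma fock_fun_diff_raw: "fock_fun (x - y) z = fock_fun x z - fock_fun y z"
  by (simp add: minus_fock_def Fock_inverse bargmann_fock_diff)
lemma fock_fun_uminus_raw: "fock_fun (- x) z = - fock_fun x z"
  using bargmann_fock_cmult[OF fock_fun_in, of "-1" x] by (simp add: uminus_fock_def Fock_inverse)
lemma fock_fun_scaleR_raw: "fock_fun (r *\<^sub>R x) z = complex_of_real r * fock_fun x z"
  by (simp add: scaleR_fock_def Fock_inverse bargmann_fock_cmult)

lemma fock_cross_integrable: "integrable lborel (\<lambda>z. fock_fun x z * cnj (fock_fun y z))"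
proof -
  have "square_integrable (\<lambda>z. cnj (fock_fun y z))"
    using fock_fun_square_integrable[of y] by (simp add: square_integrable_def)
  then show ?thesis by (intro L2_cross_integrable) auto
qed

instance
proof
  fix x y z :: fock and r s :: real
  show "x + y + z = x + (y + z)" "x + y = y + x" "0 + x = x" "- x + x = 0" "x - y = x + - y"
    "r *\<^sub>R (x + y) = r *\<^sub>R x + r *\<^sub>R y" "(r + s) *\<^sub>R x = r *\<^sub>R x + s *\<^sub>R x" "r *\<^sub>R s *\<^sub>R x = (r * s) *\<^sub>R x" "1 *\<^sub>R x = x"
    by (rule fock_eqI; simp add: fock_fun_zero_raw fock_fun_add_raw fock_fun_diff_raw fock_fun_uminus_raw
        fock_fun_scaleR_raw algebra_simps)+
  show "sgn x = inverse (norm x) *\<^sub>R x" by (rule sgn_fock_def)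
  show "dist x y = norm (x - y)" by (rule dist_fock_def)
  show "uniformity = (INF e\<in>{0 <..}. principal {(x :: fock, y). dist x y < e})" by (rule uniformity_fock_def)
  show "open S = (\<forall>x\<in>S. \<forall>\<^sub>F (x', y) in uniformity. x' = x \<longrightarrow> y \<in> S)" for S :: "fock set" by (rule open_fock_def)
  have "(\<integral>z. fock_fun y z * cnj (fock_fun x z) \<partial>lborel) = cnj (\<integral>z. fock_fun x z * cnj (fock_fun y z) \<partial>lborel)"
    by (subst Bochner_Integration.integral_cnj[symmetric]) (simp add: mult.commute)
  then show "inner x y = inner y x" by (simp add: inner_fock_def)
  show "inner (x + y) z = inner x z + inner y z"
    by (simp add: inner_fock_def fock_fun_add_raw distrib_right fock_cross_integrable)
  show "inner (r *\<^sub>R x) y = r * inner x y"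
    by (simp add: inner_fock_def fock_fun_scaleR_raw mult.assoc)
  have sq: "inner x x = (L2_norm (fock_fun x))\<^sup>2"
    unfolding inner_fock_def L2_norm_sq complex_norm_square[symmetric]
    by (simp only: integral_complex_of_real Re_complex_of_real)
  show "0 \<le> inner x x" by (simp add: sq)
  show "norm x = sqrt (inner x x)" by (simp add: sq norm_fock_def)
  show "inner x x = 0 \<longleftrightarrow> x = 0"
  proof
    assume "inner x x = 0"
    then have "L2_norm (fock_fun x) = 0" by (simp add: sq)
    then have "fock_fun x z = 0" for z
      using fock_pointwise_bound[of "fock_fun x" z] by simp
    then show "x = 0" by (intro fock_eqI) (simp add: fock_fun_zero_raw)
  next
    assume "x = 0"
    then show "inner x x = 0" by (simp add: inner_fock_def fock_fun_zero_raw)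
  qed
qed

end

lemmas fock_fun_simps [simp] =
  fock_fun_zero_raw fock_fun_add_raw fock_fun_diff_raw fock_fun_uminus_raw fock_fun_scaleR_raw

lemma norm_fock_fun_le: "cmod (fock_fun x z) \<le> norm x"
  unfolding norm_fock_def by (rule fock_pointwise_bound) simp

lemma L2_norm_fock_diff: "L2_norm (\<lambda>z. fock_fun x z - fock_fun y z) = norm (x - y)"
  by (simp add: norm_fock_def fock_fun_diff_raw[abs_def])

text \<open>
  By the pointwise bound a Cauchy sequence converges uniformly. After division by the Gaussian the
  convergence is locally uniform, so that the limit is entire, and Fatou's lemma gives convergence in norm.
\<close>

instance fock :: banach
proof
  fix X :: "nat \<Rightarrow> fock" assume X: "Cauchy X"
  define E where "E z = complex_of_real (exp ((cmod z)\<^sup>2 / 2))" for z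
  have "Cauchy (\<lambda>n. fock_fun (X n) z)" for z
  proof (rule metric_CauchyI)
    fix e :: real assume "e > 0"
    then obtain M where M: "\<And>m n. m \<ge> M \<Longrightarrow> n \<ge> M \<Longrightarrow> dist (X m) (X n) < e"
      using metric_CauchyD[OF X] by blast
    show "\<exists>M. \<forall>m\<ge>M. \<forall>n\<ge>M. dist (fock_fun (X m) z) (fock_fun (X n) z) < e"
    proof (intro exI[of _ M] allI impI)
      fix m n assume "m \<ge> M" "n \<ge> M"
      then show "dist (fock_fun (X m) z) (fock_fun (X n) z) < e"
        using M[of m n] norm_fock_fun_le[of "X m - X n" z] by (simp add: dist_norm)
    qed
  qed
  then have conv: "convergent (\<lambda>n. fock_fun (X n) z)" for z by (rule Cauchy_convergent)
  define g where "g z = lim (\<lambda>n. fock_fun (X n) z)" for z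
  have g: "(\<lambda>n. fock_fun (X n) z) \<longlonglongrightarrow> g z" for z
    using conv unfolding g_def convergent_LIMSEQ_iff .
  have unif: "\<exists>N. \<forall>n\<ge>N. square_integrable (\<lambda>z. fock_fun (X n) z - g z) \<and> L2_norm (\<lambda>z. fock_fun (X n) z - g z) \<le> e
      \<and> (\<forall>z. cmod (fock_fun (X n) z - g z) \<le> e)" if e: "e > 0" for e
  proof -
    obtain M where M: "\<And>m n. m \<ge> M \<Longrightarrow> n \<ge> M \<Longrightarrow> dist (X m) (X n) < e"
      using metric_CauchyD[OF X e] by blast
    show ?thesis
    proof (intro exI[of _ M] allI impI conjI)
      fix n assume n: "n \<ge> M"
      have lim: "(\<lambda>m. fock_fun (X n - X (m + M)) z) \<longlonglongrightarrow> fock_fun (X n) z - g z" for z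
        using LIMSEQ_ignore_initial_segment[OF g[of z], of M] by (auto intro!: tendsto_intros)
      have le: "norm (X n - X (m + M)) \<le> e" for m
        using M[OF n, of "m + M"] by (simp add: dist_norm)
      show "square_integrable (\<lambda>z. fock_fun (X n) z - g z)" "L2_norm (\<lambda>z. fock_fun (X n) z - g z) \<le> e"
        by (rule L2_Fatou[OF fock_fun_square_integrable le[unfolded norm_fock_def] lim])+
      show "cmod (fock_fun (X n) z - g z) \<le> e" for z
      proof (rule LIMSEQ_le_const2[OF tendsto_norm[OF lim]])
        show "\<exists>N. \<forall>m\<ge>N. cmod (fock_fun (X n - X (m + M)) z) \<le> e"
          using norm_fock_fun_le le order_trans by blast
      qed
    qed
  qed
  have "(\<lambda>z. E z * g z) holomorphic_on UNIV"
  proof (rule holomorphic_uniform_sequence)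
    show "(\<lambda>z. E z * fock_fun (X n) z) holomorphic_on UNIV" for n
      using fock_fun_in[of "X n"] unfolding bargmann_fock_iff E_def by simp
    fix x :: complex
    show "\<exists>d>0. cball x d \<subseteq> UNIV \<and> uniform_limit (cball x d) (\<lambda>n z. E z * fock_fun (X n) z) (\<lambda>z. E z * g z) sequentially"
    proof (intro exI[of _ 1] conjI)
      show "uniform_limit (cball x 1) (\<lambda>n z. E z * fock_fun (X n) z) (\<lambda>z. E z * g z) sequentially"
      proof (rule uniform_limitI)
        fix e :: real assume e: "e > 0"
        define B where "B = exp ((cmod x + 1)\<^sup>2 / 2)"
        have B: "B > 0" by (simp add: B_def)
        from unif[of "e / (2 * B)"] e B obtain N where N: "\<And>n z. n \<ge> N \<Longrightarrow> cmod (fock_fun (X n) z - g z) \<le> e / (2 * B)"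
          by auto
        show "\<forall>\<^sub>F n in sequentially. \<forall>z\<in>cball x 1. dist (E z * fock_fun (X n) z) (E z * g z) < e"
          unfolding eventually_sequentially
        proof (intro exI[of _ N] allI impI ballI)
          fix n z assume n: "n \<ge> N" and z: "z \<in> cball x 1"
          have "cmod z \<le> cmod x + 1"
            using z norm_triangle_ineq4[of x "x - z"] by (simp add: dist_norm)
          then have "cmod (E z) \<le> B" by (auto simp: E_def B_def intro!: power_mono)
          then have "cmod (E z) * cmod (fock_fun (X n) z - g z) \<le> B * (e / (2 * B))"
            by (intro mult_mono N n) (use B in auto)
          also have "\<dots> < e" using e B by simp
          finally show "dist (E z * fock_fun (X n) z) (E z * g z) < e"
            by (simp add: dist_norm norm_mult flip: right_diff_distrib)
        qed
      qed
    qed auto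
  qed auto
  moreover have "square_integrable g"
  proof -
    obtain N where "square_integrable (\<lambda>z. fock_fun (X N) z - g z)" using unif[of 1] by auto
    from square_integrable_diff(1)[OF fock_fun_square_integrable[of "X N"] this] show ?thesis by simp
  qed
  ultimately have "g \<in> bargmann_fock" unfolding bargmann_fock_iff E_def by simp
  then have gG: "fock_fun (Fock g) = g" by (rule Fock_inverse)
  have "X \<longlonglongrightarrow> Fock g"
  proof (rule metric_LIMSEQ_I)
    fix e :: real assume "e > 0"
    then obtain N where "\<forall>n\<ge>N. L2_norm (\<lambda>z. fock_fun (X n) z - g z) \<le> e / 2"
      using unif[of "e / 2"] by auto
    with \<open>e > 0\<close> show "\<exists>N. \<forall>n\<ge>N. dist (X n) (Fock g) < e"
      using L2_norm_fock_diff[of _ "Fock g"] unfolding gG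
      by (intro exI[of _ N]) (force simp: dist_norm)
  qed
  then show "convergent X" by (auto simp: convergent_def)
qed

section \<open>Weighted norms on the Fock space\<close>

definition wfinite :: "(complex \<Rightarrow> real) \<Rightarrow> nat \<Rightarrow> fock \<Rightarrow> bool" where
  "wfinite \<omega> k x \<longleftrightarrow> square_integrable (weigh \<omega> k (fock_fun x))"

definition wnorm :: "(complex \<Rightarrow> real) \<Rightarrow> nat \<Rightarrow> fock \<Rightarrow> real" where
  "wnorm \<omega> k x = L2_norm (weigh \<omega> k (fock_fun x))"

text \<open>
  The form is continuous on the Fock space for bounded weights, and can then be differentiated along curves.
\<close>

definition winner :: "(complex \<Rightarrow> real) \<Rightarrow> nat \<Rightarrow> fock \<Rightarrow> fock \<Rightarrow> real" where
  "winner \<omega> k x y = Re (\<integral>z. weigh \<omega> k (fock_fun x) z * cnj (weigh \<omega> k (fock_fun y) z) \<partial>lborel)"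

lemma wnorm_nonneg [simp]: "0 \<le> wnorm \<omega> k x" by (simp add: wnorm_def)

lemma wnorm_0: "wnorm \<omega> 0 x = norm x" by (simp add: wnorm_def norm_fock_def)

lemma wfinite_0 [simp]: "wfinite \<omega> 0 x" by (simp add: wfinite_def)

lemma weigh_add: "weigh \<omega> k (fock_fun (x + y)) = (\<lambda>z. weigh \<omega> k (fock_fun x) z + weigh \<omega> k (fock_fun y) z)"
  and weigh_diff: "weigh \<omega> k (fock_fun (x - y)) = (\<lambda>z. weigh \<omega> k (fock_fun x) z - weigh \<omega> k (fock_fun y) z)"
  and weigh_uminus: "weigh \<omega> k (fock_fun (- x)) = (\<lambda>z. (- 1) * weigh \<omega> k (fock_fun x) z)"
  and weigh_scaleR: "weigh \<omega> k (fock_fun (r *\<^sub>R x)) = (\<lambda>z. complex_of_real r * weigh \<omega> k (fock_fun x) z)"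
  by (auto simp: weigh_def algebra_simps)

lemma wfinite_add: "wfinite \<omega> k x \<Longrightarrow> wfinite \<omega> k y \<Longrightarrow> wfinite \<omega> k (x + y)"
  and wfinite_diff: "wfinite \<omega> k x \<Longrightarrow> wfinite \<omega> k y \<Longrightarrow> wfinite \<omega> k (x - y)"
  and wfinite_uminus: "wfinite \<omega> k x \<Longrightarrow> wfinite \<omega> k (- x)"
  and wfinite_scaleR: "wfinite \<omega> k x \<Longrightarrow> wfinite \<omega> k (r *\<^sub>R x)"
  unfolding wfinite_def weigh_add weigh_diff weigh_uminus weigh_scaleR
  by (intro square_integrable_add square_integrable_diff square_integrable_cmult; assumption)+

lemma wnorm_add: "wfinite \<omega> k x \<Longrightarrow> wfinite \<omega> k y \<Longrightarrow> wnorm \<omega> k (x + y) \<le> wnorm \<omega> k x + wnorm \<omega> k y"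
  and wnorm_scaleR: "wfinite \<omega> k x \<Longrightarrow> wnorm \<omega> k (r *\<^sub>R x) = \<bar>r\<bar> * wnorm \<omega> k x"
  unfolding wfinite_def wnorm_def weigh_add weigh_diff weigh_scaleR
  by (simp_all add: square_integrable_add(2) square_integrable_cmult(2))

lemma wnorm_uminus: "wfinite \<omega> k x \<Longrightarrow> wnorm \<omega> k (- x) = wnorm \<omega> k x"
  using wnorm_scaleR[of \<omega> k x "-1"] by simp

lemma square_integrable_cnj:
  "square_integrable f \<Longrightarrow> square_integrable (\<lambda>z. cnj (f z))" "L2_norm (\<lambda>z. cnj (f z)) = L2_norm f"
  by (auto simp: square_integrable_def L2_norm_def)

lemma winner_integrable:
  "wfinite \<omega> k x \<Longrightarrow> wfinite \<omega> k y \<Longrightarrow> integrable lborel (\<lambda>z. weigh \<omega> k (fock_fun x) z * cnj (weigh \<omega> k (fock_fun y) z))"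
  unfolding wfinite_def by (intro L2_cross_integrable square_integrable_cnj)

lemma winner_bound:
  assumes "wfinite \<omega> k x" "wfinite \<omega> k y"
  shows "\<bar>winner \<omega> k x y\<bar> \<le> wnorm \<omega> k x * wnorm \<omega> k y"
proof -
  have "\<bar>winner \<omega> k x y\<bar> \<le> cmod (\<integral>z. weigh \<omega> k (fock_fun x) z * cnj (weigh \<omega> k (fock_fun y) z) \<partial>lborel)"
    unfolding winner_def by (rule abs_Re_le_cmod)
  also have "\<dots> \<le> L2_norm (weigh \<omega> k (fock_fun x)) * L2_norm (\<lambda>z. cnj (weigh \<omega> k (fock_fun y) z))"
    using assms unfolding wfinite_def by (intro L2_cauchy_schwarz' square_integrable_cnj)
  finally show ?thesis by (simp add: wnorm_def square_integrable_cnj(2))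
qed

lemma winner_commute: "winner \<omega> k x y = winner \<omega> k y x"
proof -
  have "(\<integral>z. weigh \<omega> k (fock_fun x) z * cnj (weigh \<omega> k (fock_fun y) z) \<partial>lborel)
    = (\<integral>z. cnj (weigh \<omega> k (fock_fun y) z * cnj (weigh \<omega> k (fock_fun x) z)) \<partial>lborel)"
    by (simp add: mult.commute)
  then show ?thesis unfolding winner_def Bochner_Integration.integral_cnj by simp
qed

lemma winner_add_left:
  "wfinite \<omega> k x \<Longrightarrow> wfinite \<omega> k y \<Longrightarrow> wfinite \<omega> k z \<Longrightarrow> winner \<omega> k (x + y) z = winner \<omega> k x z + winner \<omega> k y z"
  by (simp add: winner_def weigh_add distrib_right winner_integrable)

lemma winner_scaleR_left: "winner \<omega> k (r *\<^sub>R x) y = r * winner \<omega> k x y"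
  by (simp add: winner_def weigh_scaleR mult.assoc)

lemma winner_self: "winner \<omega> k x x = (wnorm \<omega> k x)\<^sup>2"
  unfolding winner_def wnorm_def L2_norm_sq complex_norm_square[symmetric]
  by (simp only: integral_complex_of_real Re_complex_of_real)

lemma wfinite_bounded_weight:
  assumes \<omega>: "fock_weight \<omega>" and R: "\<And>z. \<omega> z \<le> R"
  shows "wfinite \<omega> k x" "wnorm \<omega> k x \<le> R ^ k * norm x"
proof -
  have R0: "0 \<le> R" using R[of 0] fock_weight_pos[OF \<omega>, of 0] by linarith
  have le: "cmod (weigh \<omega> k (fock_fun x) z) \<le> R ^ k * cmod (fock_fun x z)" for z
    unfolding norm_weigh[OF \<omega>] using fock_weight_pos[OF \<omega>, of z] R by (intro mult_right_mono power_mono) auto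
  have m: "weigh \<omega> k (fock_fun x) \<in> borel_measurable borel"
    by (rule weigh_measurable[OF \<omega>]) measurable
  from square_integrable_mono[OF fock_fun_square_integrable m le] R0
  show "wfinite \<omega> k x" "wnorm \<omega> k x \<le> R ^ k * norm x"
    by (simp_all add: wfinite_def wnorm_def norm_fock_def)
qed

lemma winner_bounded_bilinear:
  assumes \<omega>: "fock_weight \<omega>" and R: "\<And>z. \<omega> z \<le> R"
  shows "bounded_bilinear (winner \<omega> k)"
proof
  note fin = wfinite_bounded_weight(1)[OF \<omega> R]
  show "winner \<omega> k (x + y) z = winner \<omega> k x z + winner \<omega> k y z" for x y z by (intro winner_add_left fin)
  then show "winner \<omega> k z (x + y) = winner \<omega> k z x + winner \<omega> k z y" for x y z by (simp add: winner_commute[of _ _ z])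
  show "winner \<omega> k (r *\<^sub>R x) y = r *\<^sub>R winner \<omega> k x y" for r x y by (simp add: winner_scaleR_left)
  then show "winner \<omega> k y (r *\<^sub>R x) = r *\<^sub>R winner \<omega> k y x" for r x y by (simp add: winner_commute[of _ _ y])
  show "\<exists>K. \<forall>x y. norm (winner \<omega> k x y) \<le> norm x * norm y * K"
  proof (intro exI[of _ "R ^ k * R ^ k"] allI)
    fix x y
    have "norm (winner \<omega> k x y) \<le> wnorm \<omega> k x * wnorm \<omega> k y"
      using winner_bound[OF fin fin, of k x y] by simp
    also have "\<dots> \<le> (R ^ k * norm x) * (R ^ k * norm y)"
      by (intro mult_mono wfinite_bounded_weight(2)[OF \<omega> R]) (auto intro!: order_trans[OF wnorm_nonneg wfinite_bounded_weight(2)[OF \<omega> R]])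
    finally show "norm (winner \<omega> k x y) \<le> norm x * norm y * (R ^ k * R ^ k)" by (simp add: mult_ac)
  qed
qed

lemma wnorm_mono:
  assumes "fock_weight \<omega>" "j \<le> k" "wfinite \<omega> k x"
  shows "wfinite \<omega> j x" "wnorm \<omega> j x \<le> wnorm \<omega> k x"
  using weigh_mono_exponent[OF assms(1,2) fock_fun_measurable] assms(3) by (simp_all add: wfinite_def wnorm_def)

section \<open>The cubic nonlinearity\<close>

text \<open>
  Linear over the reals in each argument, conjugate linear over the complex numbers in the second one.
\<close>

definition fock_tri :: "fock \<Rightarrow> fock \<Rightarrow> fock \<Rightarrow> fock" where
  "fock_tri a b c = Fock (\<lambda>z. - \<i> * fock_projection (\<lambda>w. fock_fun a w * cnj (fock_fun b w) * fock_fun c w) z)"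

lemma weigh_triple:
  assumes \<omega>: "fock_weight \<omega>" and c: "wfinite \<omega> k c"
  shows "square_integrable (weigh \<omega> k (\<lambda>w. fock_fun a w * cnj (fock_fun b w) * fock_fun c w))"
    and "L2_norm (weigh \<omega> k (\<lambda>w. fock_fun a w * cnj (fock_fun b w) * fock_fun c w)) \<le> norm a * norm b * wnorm \<omega> k c"
proof -
  have m: "weigh \<omega> k (\<lambda>w. fock_fun a w * cnj (fock_fun b w) * fock_fun c w) \<in> borel_measurable borel"
    by (rule weigh_measurable[OF \<omega>]) measurable
  have le: "cmod (weigh \<omega> k (\<lambda>w. fock_fun a w * cnj (fock_fun b w) * fock_fun c w) z)
      \<le> (norm a * norm b) * cmod (weigh \<omega> k (fock_fun c) z)" for z
  proof -
    have "(cmod (fock_fun a z) * cmod (fock_fun b z)) * (\<omega> z ^ k * cmod (fock_fun c z))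
        \<le> (norm a * norm b) * (\<omega> z ^ k * cmod (fock_fun c z))"
      using fock_weight_pos[OF \<omega>, of z] by (intro mult_right_mono mult_mono norm_fock_fun_le) auto
    then show ?thesis by (simp add: norm_weigh[OF \<omega>] norm_mult mult_ac)
  qed
  show "square_integrable (weigh \<omega> k (\<lambda>w. fock_fun a w * cnj (fock_fun b w) * fock_fun c w))"
    "L2_norm (weigh \<omega> k (\<lambda>w. fock_fun a w * cnj (fock_fun b w) * fock_fun c w)) \<le> norm a * norm b * wnorm \<omega> k c"
    using square_integrable_mono[OF c[unfolded wfinite_def] m le] by (simp_all add: wnorm_def)
qed

lemma triple_square_integrable: "square_integrable (\<lambda>w. fock_fun a w * cnj (fock_fun b w) * fock_fun c w)"
  using weigh_triple(1)[OF japanese_bracket_weight wfinite_0, of a b c] by simp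

lemma fock_fun_tri:
  "fock_fun (fock_tri a b c) z = - \<i> * fock_projection (\<lambda>w. fock_fun a w * cnj (fock_fun b w) * fock_fun c w) z"
  unfolding fock_tri_def
  by (subst Fock_inverse) (rule bargmann_fock_cmult[OF fock_projection_in_fock[OF triple_square_integrable]], rule refl)

lemma
  assumes \<omega>: "fock_weight \<omega>" and c: "wfinite \<omega> k c"
  shows wfinite_tri: "wfinite \<omega> k (fock_tri a b c)"
    and wnorm_tri: "wnorm \<omega> k (fock_tri a b c) \<le> schur_const k * (norm a * norm b * wnorm \<omega> k c)"
proof -
  let ?y = "\<lambda>w. fock_fun a w * cnj (fock_fun b w) * fock_fun c w"
  have m: "?y \<in> borel_measurable borel" by measurable
  have eq: "weigh \<omega> k (fock_fun (fock_tri a b c)) = (\<lambda>z. - \<i> * weigh \<omega> k (fock_projection ?y) z)"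
    by (simp add: fun_eq_iff weigh_def fock_fun_tri)
  note P = fock_projection_weigh[OF \<omega> m weigh_triple(1)[OF \<omega> c]]
  show "wfinite \<omega> k (fock_tri a b c)"
    unfolding wfinite_def eq by (rule square_integrable_cmult(1)[OF P(1)])
  have "wnorm \<omega> k (fock_tri a b c) = L2_norm (weigh \<omega> k (fock_projection ?y))"
    unfolding wnorm_def eq square_integrable_cmult(2)[OF P(1)] by simp
  also have "\<dots> \<le> schur_const k * L2_norm (weigh \<omega> k ?y)" by (rule P(2))
  also have "\<dots> \<le> schur_const k * (norm a * norm b * wnorm \<omega> k c)"
    by (intro mult_left_mono weigh_triple(2)[OF \<omega> c]) simp
  finally show "wnorm \<omega> k (fock_tri a b c) \<le> schur_const k * (norm a * norm b * wnorm \<omega> k c)" .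
qed

lemma norm_tri: "norm (fock_tri a b c) \<le> schur_const 0 * (norm a * norm b * norm c)"
  using wnorm_tri[OF japanese_bracket_weight wfinite_0, of a b c] by (simp add: wnorm_0)

lemma fock_projection_add:
  assumes "square_integrable f" "square_integrable g"
  shows "fock_projection (\<lambda>w. f w + g w) z = fock_projection f z + fock_projection g z"
  using L2_cross_integrable[OF fock_kernel_square_integrable(1) assms(1)]
    L2_cross_integrable[OF fock_kernel_square_integrable(1) assms(2)]
  by (simp add: fock_projection_kernel distrib_left)

lemma fock_projection_cmult: "fock_projection (\<lambda>w. c * f w) z = c * fock_projection f z"
proof -
  have "fock_projection (\<lambda>w. c * f w) z = (\<integral>w. c * (fock_kernel z w * f w) \<partial>lborel)"
    by (simp add: fock_projection_kernel mult_ac)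
  then show ?thesis by (simp add: fock_projection_kernel)
qed

lemma fock_tri_add:
  "fock_tri (a + a') b c = fock_tri a b c + fock_tri a' b c"
  "fock_tri a (b + b') c = fock_tri a b c + fock_tri a b' c"
  "fock_tri a b (c + c') = fock_tri a b c + fock_tri a b c'"
  by (rule fock_eqI, simp add: fock_fun_tri distrib_left distrib_right fock_projection_add triple_square_integrable)+

lemma fock_tri_scaleR:
  "fock_tri (r *\<^sub>R a) b c = r *\<^sub>R fock_tri a b c"
  "fock_tri a (r *\<^sub>R b) c = r *\<^sub>R fock_tri a b c"
  "fock_tri a b (r *\<^sub>R c) = r *\<^sub>R fock_tri a b c"
  using fock_projection_cmult[of "complex_of_real r" "\<lambda>w. fock_fun a w * cnj (fock_fun b w) * fock_fun c w"]
  by (auto intro!: fock_eqI simp: fock_fun_tri mult_ac)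

lemma fock_tri_bounded_linear: "bounded_linear (fock_tri a b)"
  using norm_tri[of a b]
  by (intro bounded_linear_intro[where K = "schur_const 0 * (norm a * norm b)"])
    (auto simp: fock_tri_add fock_tri_scaleR mult_ac)

text \<open>
  Trilinear maps are treated as bilinear maps into a space of bounded linear operators, so that the
  product rule for bilinear maps applies twice.
\<close>

lemma fock_tri_bounded_bilinear: "bounded_bilinear (\<lambda>a b. Blinfun (fock_tri a b))"
proof
  have ap: "blinfun_apply (Blinfun (fock_tri a b)) = fock_tri a b" for a b
    by (rule bounded_linear_Blinfun_apply[OF fock_tri_bounded_linear])
  fix a a' b b' :: fock and r :: real
  show "Blinfun (fock_tri (a + a') b) = Blinfun (fock_tri a b) + Blinfun (fock_tri a' b)"
    "Blinfun (fock_tri a (b + b')) = Blinfun (fock_tri a b) + Blinfun (fock_tri a b')"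
    "Blinfun (fock_tri (r *\<^sub>R a) b) = r *\<^sub>R Blinfun (fock_tri a b)"
    "Blinfun (fock_tri a (r *\<^sub>R b)) = r *\<^sub>R Blinfun (fock_tri a b)"
    by (rule blinfun_eqI, simp add: ap blinfun.add_left blinfun.scaleR_left fock_tri_add fock_tri_scaleR)+
  have "norm (Blinfun (fock_tri a b)) \<le> norm a * norm b * schur_const 0" for a b
    by (rule norm_blinfun_bound) (use norm_tri[of a b] in \<open>auto simp: ap mult_ac\<close>)
  then show "\<exists>K. \<forall>a b. norm (Blinfun (fock_tri a b)) \<le> norm a * norm b * K" by blast
qed

lemma fock_tri_has_vector_derivative:
  assumes "(a has_vector_derivative a') (at t)" "(b has_vector_derivative b') (at t)" "(c has_vector_derivative c') (at t)"
  shows "((\<lambda>t. fock_tri (a t) (b t) (c t)) has_vector_derivative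
      (fock_tri (a t) (b t) c' + (fock_tri (a t) b' (c t) + fock_tri a' (b t) (c t)))) (at t)"
proof -
  have ap: "blinfun_apply (Blinfun (fock_tri a b)) = fock_tri a b" for a b
    by (rule bounded_linear_Blinfun_apply[OF fock_tri_bounded_linear])
  have "((\<lambda>t. blinfun_apply (Blinfun (fock_tri (a t) (b t))) (c t)) has_vector_derivative
      (blinfun_apply (Blinfun (fock_tri (a t) (b t))) c' +
       blinfun_apply (Blinfun (fock_tri (a t) b') + Blinfun (fock_tri a' (b t))) (c t))) (at t)"
    by (intro bounded_bilinear.has_vector_derivative[OF bounded_bilinear_blinfun_apply]
        bounded_bilinear.has_vector_derivative[OF fock_tri_bounded_bilinear] assms)
  then show ?thesis by (simp add: ap blinfun.add_left)
qed

lemma winner_tri: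
  assumes \<omega>: "fock_weight \<omega>" and u: "wfinite \<omega> k u"
  shows "winner \<omega> k u (fock_tri v v u) = weighted_current \<omega> k (fock_fun u) (fock_fun v)"
proof -
  let ?P = "fock_projection (\<lambda>w. mass (fock_fun v) w * fock_fun u w)"
  have y: "(\<lambda>w. fock_fun v w * cnj (fock_fun v w) * fock_fun u w) = (\<lambda>w. mass (fock_fun v) w * fock_fun u w)"
    by (simp only: complex_norm_square)
  have "(\<integral>z. weigh \<omega> k (fock_fun u) z * cnj (weigh \<omega> k (fock_fun (fock_tri v v u)) z) \<partial>lborel)
    = (\<integral>z. \<i> * cnj (complex_of_real (\<omega> z ^ (2 * k)) * (cnj (fock_fun u z) * ?P z)) \<partial>lborel)"
  proof (intro Bochner_Integration.integral_cong refl)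
    fix z
    have "complex_of_real (\<omega> z ^ (2 * k)) = complex_of_real (\<omega> z ^ k) * complex_of_real (\<omega> z ^ k)"
      by (simp add: mult_2 power_add)
    then show "weigh \<omega> k (fock_fun u) z * cnj (weigh \<omega> k (fock_fun (fock_tri v v u)) z)
        = \<i> * cnj (complex_of_real (\<omega> z ^ (2 * k)) * (cnj (fock_fun u z) * ?P z))"
      by (simp only: weigh_def fock_fun_tri y) simp
  qed
  also have "\<dots> = \<i> * cnj (\<integral>z. complex_of_real (\<omega> z ^ (2 * k)) * (cnj (fock_fun u z) * ?P z) \<partial>lborel)"
    by (simp only: integral_mult_right_zero Bochner_Integration.integral_cnj)
  finally show ?thesis unfolding winner_def weighted_current_def by simp
qed

section \<open>Global flows of bounded Lipschitz vector fields\<close>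

text \<open>
  In the norm \<open>sup exp(-2 L |t|) ||x(t)||\<close>, integration in time from \<open>0\<close> has norm at most \<open>1 / (2 L)\<close>.
\<close>

lemma exp_growth_bound:
  fixes P :: "real \<Rightarrow> 'a::real_normed_vector"
  assumes P0: "P 0 = 0" and d: "\<And>t. (P has_vector_derivative P' t) (at t)"
    and L: "L > 0" and b: "\<And>t. norm (P' t) \<le> K * exp (2 * L * \<bar>t\<bar>)"
  shows "norm (P t) \<le> K / (2 * L) * exp (2 * L * \<bar>t\<bar>)"
proof -
  have K0: "K \<ge> 0" using order_trans[OF norm_ge_zero b[of 0]] by simp
  have pos: "norm (Q t) \<le> K / (2 * L) * exp (2 * L * t)"
    if "Q 0 = 0" and dQ: "\<And>t. (Q has_vector_derivative Q' t) (at t)"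
      and bQ: "\<And>t. norm (Q' t) \<le> K * exp (2 * L * \<bar>t\<bar>)" and t: "t > 0" for Q Q' and t :: real
  proof -
    have "norm (Q t - Q 0) \<le> K / (2 * L) * exp (2 * L * t) - K / (2 * L) * exp (2 * L * 0)"
    proof (rule differentiable_bound_general[OF t, of Q _ Q' "\<lambda>s. K * exp (2 * L * s)"])
      show "continuous_on {0..t} Q"
        using dQ by (meson continuous_at_imp_continuous_on has_vector_derivative_continuous)
      show "((\<lambda>s. K / (2 * L) * exp (2 * L * s)) has_vector_derivative K * exp (2 * L * s)) (at s)" for s
        unfolding has_real_derivative_iff_has_vector_derivative[symmetric]
        using L by (auto intro!: derivative_eq_intros)
      show "norm (Q' s) \<le> K * exp (2 * L * s)" if "0 < s" for s using bQ[of s] that by simp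
    qed (use L in \<open>auto intro!: continuous_intros dQ\<close>)
    also have "\<dots> \<le> K / (2 * L) * exp (2 * L * t)" using K0 L by simp
    finally show ?thesis using \<open>Q 0 = 0\<close> by simp
  qed
  consider "t > 0" | "t = 0" | "t < 0" by linarith
  then show ?thesis
  proof cases
    case 1
    then show ?thesis using pos[OF P0 d b 1] by simp
  next
    case 2
    then show ?thesis using P0 K0 L by simp
  next
    case 3
    have "((\<lambda>s. P (- s)) has_vector_derivative (- P' (- s))) (at s)" for s
    proof -
      have "((\<lambda>x::real. - x) has_vector_derivative - 1) (at s)"
        unfolding has_real_derivative_iff_has_vector_derivative[symmetric]
        by (auto intro!: derivative_eq_intros)
      from vector_diff_chain_at[OF this d] show ?thesis by (simp add: o_def)
    qed
    from pos[OF _ this, of "- t"] 3 P0 b[of "- _"] show ?thesis by simp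
  qed
qed

lemma antiderivative_exists:
  fixes f :: "real \<Rightarrow> 'a::banach"
  assumes f: "continuous_on UNIV f"
  shows "\<exists>P. P 0 = 0 \<and> (\<forall>t. (P has_vector_derivative f t) (at t))"
proof -
  define P where "P t = integral {0..t} f - integral {t..0} f" for t
  have int: "f integrable_on {a..b}" for a b
    by (intro integrable_continuous_real continuous_on_subset[OF f]) auto
  have P: "P t = integral {- n..t} f - integral {- n..0} f" if "- n < t" "0 < n" for n t
  proof (cases "0 \<le> t")
    case True
    then have "integral {t..0} f = 0" by (cases "t = 0") auto
    then show ?thesis
      using Henstock_Kurzweil_Integration.integral_combine[OF _ True int, of "- n"] that by (simp add: P_def algebra_simps)
  next
    case False
    then show ?thesis
      using Henstock_Kurzweil_Integration.integral_combine[OF _ _ int, of "- n" t 0] that by (simp add: P_def algebra_simps)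
  qed
  have "(P has_vector_derivative f t) (at t)" for t
  proof -
    define n where "n = \<bar>t\<bar> + 1"
    have "((\<lambda>u. integral {- n..u} f) has_vector_derivative f t) (at t within {- n..n})"
      by (rule integral_has_vector_derivative) (auto simp: n_def intro: continuous_on_subset[OF f])
    then have "((\<lambda>u. integral {- n..u} f) has_vector_derivative f t) (at t)"
      by (subst (asm) at_within_interior) (auto simp: n_def)
    then have "((\<lambda>u. integral {- n..u} f - integral {- n..0} f) has_vector_derivative f t) (at t)"
      by (auto intro!: derivative_eq_intros)
    then show ?thesis
    proof (rule has_vector_derivative_transform_within_open[where S = "{- n<..<n}"])
      show "integral {- n..y} f - integral {- n..0} f = P y" if "y \<in> {- n<..<n}" for y
        using that by (intro P[symmetric]) (auto simp: n_def)
    qed (auto simp: n_def)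
  qed
  moreover have "P 0 = 0" by (simp add: P_def)
  ultimately show ?thesis by blast
qed

text \<open>
  In the norm of \<open>exp_growth_bound\<close> the Picard operator is a contraction with factor \<open>1/2\<close> on the whole
  real line. The unknown is \<open>y(t) = exp(-2 L |t|) (x(t) - x0)\<close>, which is bounded because the field is.
\<close>

lemma bounded_lipschitz_flow:
  fixes F :: "'a::banach \<Rightarrow> 'a"
  assumes lip: "\<And>x y. norm (F x - F y) \<le> L * norm (x - y)" and L: "L > 0"
    and M: "\<And>x. norm (F x) \<le> M"
  obtains x where "x 0 = x0" "\<And>t. (x has_vector_derivative F (x t)) (at t)"
proof -
  define path where "path y t = x0 + exp (2 * L * \<bar>t\<bar>) *\<^sub>R apply_bcontfun y t" for y :: "real \<Rightarrow>\<^sub>C 'a" and t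
  define anti where "anti f = (SOME P. P 0 = 0 \<and> (\<forall>t. (P has_vector_derivative f t) (at t)))" for f :: "real \<Rightarrow> 'a"
  have anti: "anti f 0 = 0" "(anti f has_vector_derivative f t) (at t)" if "continuous_on UNIV f" for f t
    using someI_ex[OF antiderivative_exists[OF that]] unfolding anti_def by blast+
  have Fc: "continuous_on UNIV F"
  proof (rule lipschitz_on_continuous_on)
    show "L-lipschitz_on UNIV F" using lip L by (intro lipschitz_onI) (auto simp: dist_norm)
  qed
  have cont: "continuous_on UNIV (\<lambda>t. F (path y t))" for y
    unfolding path_def by (intro continuous_on_compose2[OF Fc] continuous_intros) auto
  have M0: "M \<ge> 0" using order_trans[OF norm_ge_zero M] .
  \<comment> \<open>The Picard operator, in the unknown \<open>y\<close>.\<close>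
  define G where "G y = Bcontfun (\<lambda>t. exp (- (2 * L * \<bar>t\<bar>)) *\<^sub>R anti (\<lambda>t. F (path y t)) t)" for y
  have G: "apply_bcontfun (G y) t = exp (- (2 * L * \<bar>t\<bar>)) *\<^sub>R anti (\<lambda>t. F (path y t)) t" for y t
  proof -
    let ?A = "anti (\<lambda>t. F (path y t))"
    have "(\<lambda>t. exp (- (2 * L * \<bar>t\<bar>)) *\<^sub>R ?A t) \<in> bcontfun"
    proof (rule bcontfun_normI[where b = "M / (2 * L)"])
      have "continuous_on UNIV ?A"
        using anti(2)[OF cont] by (meson continuous_at_imp_continuous_on has_vector_derivative_continuous)
      then show "continuous_on UNIV (\<lambda>t. exp (- (2 * L * \<bar>t\<bar>)) *\<^sub>R ?A t)"
        by (intro continuous_intros)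
      fix t
      have "norm (?A t) \<le> M / (2 * L) * exp (2 * L * \<bar>t\<bar>)"
      proof (rule exp_growth_bound[OF anti(1)[OF cont] anti(2)[OF cont] L])
        fix t
        have "norm (F (path y t)) \<le> M * 1" using M by simp
        also have "\<dots> \<le> M * exp (2 * L * \<bar>t\<bar>)" using L M0 by (intro mult_left_mono) auto
        finally show "norm (F (path y t)) \<le> M * exp (2 * L * \<bar>t\<bar>)" .
      qed
      then show "norm (exp (- (2 * L * \<bar>t\<bar>)) *\<^sub>R ?A t) \<le> M / (2 * L)"
        by (simp add: exp_minus field_simps)
    qed
    then show ?thesis unfolding G_def by (simp add: Bcontfun_inverse)
  qed
  have "dist (G y1) (G y2) \<le> 1 / 2 * dist y1 y2" for y1 y2
  proof (rule dist_bound)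
    fix t
    let ?A1 = "anti (\<lambda>t. F (path y1 t))" and ?A2 = "anti (\<lambda>t. F (path y2 t))"
    have "norm (?A1 t - ?A2 t) \<le> (L * dist y1 y2) / (2 * L) * exp (2 * L * \<bar>t\<bar>)"
    proof (rule exp_growth_bound[OF _ _ L, where P' = "\<lambda>t. F (path y1 t) - F (path y2 t)"])
      show "?A1 0 - ?A2 0 = 0" using anti(1)[OF cont] by simp
      show "((\<lambda>t. ?A1 t - ?A2 t) has_vector_derivative F (path y1 t) - F (path y2 t)) (at t)" for t
        by (intro derivative_intros anti(2) cont)
      fix t
      have "norm (F (path y1 t) - F (path y2 t)) \<le> L * norm (path y1 t - path y2 t)" by (rule lip)
      also have "path y1 t - path y2 t = exp (2 * L * \<bar>t\<bar>) *\<^sub>R (apply_bcontfun y1 t - apply_bcontfun y2 t)"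
        by (simp add: path_def scaleR_diff_right)
      also have "L * norm \<dots> = L * dist (apply_bcontfun y1 t) (apply_bcontfun y2 t) * exp (2 * L * \<bar>t\<bar>)"
        by (simp add: dist_norm)
      also have "\<dots> \<le> L * dist y1 y2 * exp (2 * L * \<bar>t\<bar>)"
        using L by (intro mult_right_mono mult_left_mono dist_bounded) auto
      finally show "norm (F (path y1 t) - F (path y2 t)) \<le> L * dist y1 y2 * exp (2 * L * \<bar>t\<bar>)" .
    qed
    then have A: "norm (?A1 t - ?A2 t) \<le> 1 / 2 * dist y1 y2 * exp (2 * L * \<bar>t\<bar>)" using L by simp
    have "apply_bcontfun (G y1) t - apply_bcontfun (G y2) t = exp (- (2 * L * \<bar>t\<bar>)) *\<^sub>R (?A1 t - ?A2 t)"
      by (simp only: G scaleR_diff_right)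
    then have "dist (apply_bcontfun (G y1) t) (apply_bcontfun (G y2) t) = exp (- (2 * L * \<bar>t\<bar>)) * norm (?A1 t - ?A2 t)"
      by (simp add: dist_norm)
    also have "\<dots> \<le> exp (- (2 * L * \<bar>t\<bar>)) * (1 / 2 * dist y1 y2 * exp (2 * L * \<bar>t\<bar>))"
      by (intro mult_left_mono A) simp
    also have "\<dots> = 1 / 2 * dist y1 y2" by (simp add: exp_minus)
    finally show "dist (apply_bcontfun (G y1) t) (apply_bcontfun (G y2) t) \<le> 1 / 2 * dist y1 y2" .
  qed
  then obtain y where y: "G y = y"
    using banach_fix_type[of "1/2" G] by auto
  have path_eq: "path y t = x0 + anti (\<lambda>t. F (path y t)) t" for t
  proof -
    have "exp (2 * L * \<bar>t\<bar>) *\<^sub>R apply_bcontfun y t = anti (\<lambda>t. F (path y t)) t"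
      by (subst y[symmetric], subst G) (simp add: exp_minus)
    then show ?thesis by (simp add: path_def)
  qed
  show thesis
  proof (rule that[of "path y"])
    show "path y 0 = x0" using path_eq[of 0] anti(1)[OF cont] by simp
    show "(path y has_vector_derivative F (path y t)) (at t)" for t
    proof -
      have "((\<lambda>t. x0 + anti (\<lambda>t. F (path y t)) t) has_vector_derivative F (path y t)) (at t)"
        by (auto intro!: derivative_eq_intros anti(2) cont)
      then show ?thesis unfolding path_eq[symmetric] .
    qed
  qed
qed

text \<open>
  Each use of the equation halves the bound on the difference of the two solutions.
\<close>

lemma bounded_lipschitz_flow_unique:
  fixes F :: "'a::real_normed_vector \<Rightarrow> 'a"
  assumes lip: "\<And>x y. norm (F x - F y) \<le> L * norm (x - y)" and L: "L > 0"
    and M: "\<And>x. norm (F x) \<le> M"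
    and x: "\<And>t. (x has_vector_derivative F (x t)) (at t)" and y: "\<And>t. (y has_vector_derivative F (y t)) (at t)"
    and init: "x 0 = y 0"
  shows "x t = y t"
proof -
  have M0: "M \<ge> 0" using order_trans[OF norm_ge_zero M] .
  let ?D = "\<lambda>t. x t - y t"
  have D: "(?D has_vector_derivative F (x t) - F (y t)) (at t)" for t
    by (intro derivative_intros x y)
  have halving: "norm (?D t) \<le> (M / L) / 2 ^ n * exp (2 * L * \<bar>t\<bar>)" for n t
  proof (induction n arbitrary: t)
    case 0
    have "norm (?D t) \<le> (2 * M) / (2 * L) * exp (2 * L * \<bar>t\<bar>)"
    proof (rule exp_growth_bound[OF _ D L])
      fix t
      have "norm (F (x t) - F (y t)) \<le> 2 * M * 1"
        using norm_triangle_ineq4[of "F (x t)" "F (y t)"] M[of "x t"] M[of "y t"] by linarith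
      also have "\<dots> \<le> 2 * M * exp (2 * L * \<bar>t\<bar>)" using L M0 by (intro mult_left_mono) auto
      finally show "norm (F (x t) - F (y t)) \<le> 2 * M * exp (2 * L * \<bar>t\<bar>)" .
    qed (simp add: init)
    then show ?case by simp
  next
    case (Suc n)
    have "norm (?D t) \<le> (L * ((M / L) / 2 ^ n)) / (2 * L) * exp (2 * L * \<bar>t\<bar>)"
    proof (rule exp_growth_bound[OF _ D L])
      fix t
      have "norm (F (x t) - F (y t)) \<le> L * norm (?D t)" by (rule lip)
      also have "\<dots> \<le> L * ((M / L) / 2 ^ n * exp (2 * L * \<bar>t\<bar>))" using L by (intro mult_left_mono Suc.IH) simp
      finally show "norm (F (x t) - F (y t)) \<le> L * ((M / L) / 2 ^ n) * exp (2 * L * \<bar>t\<bar>)" by (simp only: mult.assoc)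
    qed (simp add: init)
    then show ?case using L by (simp add: field_simps)
  qed
  have "(\<lambda>n. (M / L) / 2 ^ n * exp (2 * L * \<bar>t\<bar>)) \<longlonglongrightarrow> 0"
    by real_asymp
  then have "norm (?D t) \<le> 0"
    by (rule LIMSEQ_le_const) (use halving in auto)
  then show ?thesis by simp
qed

section \<open>The flow in the Fock space\<close>

text \<open>
  The radial retraction onto a ball. It multiplies each vector by a real number, so that the clipped system
  still conserves the norms.
\<close>

definition clip :: "real \<Rightarrow> 'a::real_normed_vector \<Rightarrow> 'a" where
  "clip R x = (if norm x \<le> R then x else (R / norm x) *\<^sub>R x)"

lemma clip_inside: "norm x \<le> R \<Longrightarrow> clip R x = x" by (simp add: clip_def)

lemma clip_scaling: "\<exists>s. clip R x = s *\<^sub>R x"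
  unfolding clip_def by (metis scaleR_one)

lemma norm_clip: "R \<ge> 0 \<Longrightarrow> norm (clip R x) \<le> R" by (auto simp: clip_def)

lemma clip_lipschitz:
  assumes R: "R \<ge> 0"
  shows "norm (clip R x - clip R y) \<le> 2 * norm (x - y)"
proof -
  have one: "norm (x - (R / norm y) *\<^sub>R y) \<le> 2 * norm (x - y)" if "norm x \<le> R" "R < norm y" for x y :: 'a
  proof -
    have "norm (y - (R / norm y) *\<^sub>R y) = norm y - R"
    proof -
      have "y - (R / norm y) *\<^sub>R y = (1 - R / norm y) *\<^sub>R y" by (simp add: scaleR_left_diff_distrib)
      moreover have y0: "norm y > 0" using that R by linarith
      moreover have "0 \<le> 1 - R / norm y" using that y0 by (simp add: divide_le_eq)
      moreover have "(1 - R / norm y) * norm y = norm y - R" using y0 by (simp add: left_diff_distrib)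
      ultimately show ?thesis by (metis abs_of_nonneg norm_scaleR)
    qed
    moreover have "norm (x - (R / norm y) *\<^sub>R y) \<le> norm (x - y) + norm (y - (R / norm y) *\<^sub>R y)"
      using norm_triangle_ineq[of "x - y" "y - (R / norm y) *\<^sub>R y"] by simp
    moreover have "norm y - norm x \<le> norm (x - y)" by (metis norm_minus_commute norm_triangle_ineq2)
    ultimately show ?thesis using that by linarith
  qed
  have two: "norm ((R / norm x) *\<^sub>R x - (R / norm y) *\<^sub>R y) \<le> 2 * norm (x - y)" if "R < norm x" "R < norm y"
  proof -
    have pos: "norm x > 0" "norm y > 0" using that R by auto
    \<comment> \<open>Both points lie outside the ball; \<open>(R / |x|) y\<close> serves as intermediate point.\<close>
    have "(R / norm x) *\<^sub>R x - (R / norm y) *\<^sub>R y = (R / norm x) *\<^sub>R ((x - y) + (1 - norm x / norm y) *\<^sub>R y)"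
      using pos by (simp add: scaleR_right_distrib scaleR_right_diff_distrib scaleR_left_diff_distrib)
    then have "norm ((R / norm x) *\<^sub>R x - (R / norm y) *\<^sub>R y) = R / norm x * norm ((x - y) + (1 - norm x / norm y) *\<^sub>R y)"
      using R pos by simp
    also have "\<dots> \<le> 1 * (norm (x - y) + norm (x - y))"
    proof (rule mult_mono)
      have "norm ((1 - norm x / norm y) *\<^sub>R y) = \<bar>norm y - norm x\<bar>"
      proof -
        have "norm ((1 - norm x / norm y) *\<^sub>R y) = \<bar>(1 - norm x / norm y) * norm y\<bar>" by (simp add: abs_mult)
        also have "(1 - norm x / norm y) * norm y = norm y - norm x" using pos by (simp add: field_simps)
        finally show ?thesis .
      qed
      also have "\<dots> \<le> norm (x - y)" by (metis norm_minus_commute norm_triangle_ineq3)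
      finally show "norm ((x - y) + (1 - norm x / norm y) *\<^sub>R y) \<le> norm (x - y) + norm (x - y)"
        by (intro order_trans[OF norm_triangle_ineq] add_mono) auto
    qed (use that pos R in auto)
    finally show ?thesis by simp
  qed
  show ?thesis
    using one[of x y] one[of y x] two
    by (cases "norm x \<le> R"; cases "norm y \<le> R") (auto simp: clip_def norm_minus_commute)
qed

lemma winner_0: "winner \<omega> 0 x y = inner x y" by (simp add: winner_def inner_fock_def)

text \<open>
  The symmetry of \<open>\<Pi>\<close> makes \<open>\<langle>\<Pi>(|v|^2 u), u\<rangle>\<close> the integral of \<open>|u|^2 |v|^2\<close>, and the factor \<open>-i\<close> removes its
  real part.
\<close>

lemma inner_tri_zero: "inner u (fock_tri v v u) = 0"
proof -
  have "inner u (fock_tri v v u) = weighted_current japanese_bracket 0 (fock_fun u) (fock_fun v)"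
    using winner_tri[OF japanese_bracket_weight wfinite_0, of u v] by (simp add: winner_0)
  also have "\<dots> = 0"
    using weighted_current_bound[OF fock_fun_in fock_fun_in japanese_bracket_weight, of 0 u v] by simp
  finally show ?thesis .
qed

text \<open>
  The real factor \<open>r\<close> allows for both signs in the system and for clipping.
\<close>

lemma norm_conserved:
  assumes "\<And>t. (u has_vector_derivative r t *\<^sub>R fock_tri (v t) (v t) (u t)) (at t)"
  shows "norm (u t) = norm (u 0)"
proof -
  have "((\<lambda>t. inner (u t) (u t)) has_real_derivative 0) (at t)" for t
  proof -
    have "((\<lambda>t. inner (u t) (u t)) has_vector_derivative
        (inner (u t) (r t *\<^sub>R fock_tri (v t) (v t) (u t)) + inner (r t *\<^sub>R fock_tri (v t) (v t) (u t)) (u t))) (at t)"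
      by (intro bounded_bilinear.has_vector_derivative[OF bounded_bilinear_inner] assms)
    then show ?thesis
      by (simp add: inner_tri_zero inner_commute[of "fock_tri _ _ _"] has_real_derivative_iff_has_vector_derivative)
  qed
  then have "inner (u t) (u t) = inner (u 0) (u 0)" by (intro DERIV_isconst_all) simp
  then show ?thesis by (simp add: norm_eq_sqrt_inner)
qed

definition fock_solution :: "(real \<Rightarrow> fock) \<Rightarrow> (real \<Rightarrow> fock) \<Rightarrow> bool" where
  "fock_solution u v \<longleftrightarrow>
     (\<forall>t. (u has_vector_derivative fock_tri (v t) (v t) (u t)) (at t)) \<and>
     (\<forall>t. (v has_vector_derivative - fock_tri (u t) (u t) (v t)) (at t))"

lemma fock_solution_norms:
  assumes "fock_solution u v"
  shows "norm (u t) = norm (u 0)" "norm (v t) = norm (v 0)"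
  using norm_conserved[of u "\<lambda>_. 1" v] norm_conserved[of v "\<lambda>_. -1" u] assms
  by (auto simp: fock_solution_def)

definition clipped_field :: "real \<Rightarrow> fock \<times> fock \<Rightarrow> fock \<times> fock" where
  "clipped_field R = (\<lambda>(u, v). (fock_tri (clip R v) (clip R v) (clip R u), - fock_tri (clip R u) (clip R u) (clip R v)))"

lemma fock_tri_clip_lipschitz:
  assumes R: "R \<ge> 0"
  shows "norm (fock_tri (clip R a) (clip R a) (clip R b) - fock_tri (clip R a') (clip R a') (clip R b'))
    \<le> schur_const 0 * R\<^sup>2 * (4 * norm (a - a') + 2 * norm (b - b'))"
proof -
  let ?c = "clip R"
  have neg: "fock_tri (- x) y z = - fock_tri x y z" "fock_tri x (- y) z = - fock_tri x y z" "fock_tri x y (- z) = - fock_tri x y z" for x y z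
    using fock_tri_scaleR(1)[of "-1" x y z] fock_tri_scaleR(2)[of x "-1" y z] fock_tri_scaleR(3)[of x y "-1" z] by simp_all
  have eq: "fock_tri (?c a) (?c a) (?c b) - fock_tri (?c a') (?c a') (?c b')
     = fock_tri (?c a - ?c a') (?c a) (?c b) + (fock_tri (?c a') (?c a - ?c a') (?c b) + fock_tri (?c a') (?c a') (?c b - ?c b'))"
    by (simp only: diff_conv_add_uminus fock_tri_add neg) simp
  have "norm (fock_tri (?c a) (?c a) (?c b) - fock_tri (?c a') (?c a') (?c b')) \<le> norm (fock_tri (?c a - ?c a') (?c a) (?c b)) +
      (norm (fock_tri (?c a') (?c a - ?c a') (?c b)) + norm (fock_tri (?c a') (?c a') (?c b - ?c b')))"
    unfolding eq by (intro order_trans[OF norm_triangle_ineq] add_left_mono norm_triangle_ineq)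
  also have "\<dots> \<le> schur_const 0 * ((2 * norm (a - a')) * R * R) +
      (schur_const 0 * (R * (2 * norm (a - a')) * R) + schur_const 0 * (R * R * (2 * norm (b - b'))))"
    by (intro add_mono order_trans[OF norm_tri] mult_left_mono mult_mono clip_lipschitz norm_clip R) (use R in auto)
  also have "\<dots> = schur_const 0 * R\<^sup>2 * (4 * norm (a - a') + 2 * norm (b - b'))"
    by (simp add: power2_eq_square algebra_simps)
  finally show ?thesis .
qed

lemma clipped_field_lipschitz:
  assumes R: "R \<ge> 0"
  shows "norm (clipped_field R x - clipped_field R y) \<le> (12 * schur_const 0 * R\<^sup>2 + 1) * norm (x - y)"
proof -
  obtain u v u' v' where x: "x = (u, v)" and y: "y = (u', v')" by (metis surj_pair)
  have nu: "norm (u - u') \<le> norm (x - y)" and nv: "norm (v - v') \<le> norm (x - y)"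
    using norm_fst_le[of "u - u'" "v - v'"] norm_snd_le[of "v - v'" "u - u'"] by (simp_all add: x y)
  let ?s = "schur_const 0 * R\<^sup>2"
  have "norm (clipped_field R x - clipped_field R y)
    \<le> ?s * (4 * norm (v - v') + 2 * norm (u - u')) + ?s * (4 * norm (u - u') + 2 * norm (v - v'))"
  proof -
    have "norm (clipped_field R x - clipped_field R y)
      \<le> norm (fock_tri (clip R v) (clip R v) (clip R u) - fock_tri (clip R v') (clip R v') (clip R u'))
        + norm (fock_tri (clip R u') (clip R u') (clip R v') - fock_tri (clip R u) (clip R u) (clip R v))"
      using norm_Pair_le[of "fock_tri (clip R v) (clip R v) (clip R u) - fock_tri (clip R v') (clip R v') (clip R u')"
          "fock_tri (clip R u') (clip R u') (clip R v') - fock_tri (clip R u) (clip R u) (clip R v)"]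
      by (simp add: clipped_field_def x y)
    also have "\<dots> \<le> ?s * (4 * norm (v - v') + 2 * norm (u - u')) + ?s * (4 * norm (u - u') + 2 * norm (v - v'))"
      using fock_tri_clip_lipschitz[OF R, of v u v' u'] fock_tri_clip_lipschitz[OF R, of u' v' u v]
      by (simp add: norm_minus_commute)
    finally show ?thesis .
  qed
  also have "\<dots> \<le> ?s * (4 * norm (x - y) + 2 * norm (x - y)) + ?s * (4 * norm (x - y) + 2 * norm (x - y))"
    by (intro add_mono mult_left_mono nu nv) auto
  also have "\<dots> \<le> (12 * schur_const 0 * R\<^sup>2 + 1) * norm (x - y)" by (simp add: algebra_simps)
  finally show ?thesis .
qed

lemma clipped_field_bounded:
  assumes R: "R \<ge> 0"
  shows "norm (clipped_field R x) \<le> 2 * (schur_const 0 * (R * R * R))"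
proof -
  have b: "norm (fock_tri (clip R a) (clip R a) (clip R b)) \<le> schur_const 0 * (R * R * R)" for a b
    by (intro order_trans[OF norm_tri] mult_left_mono mult_mono norm_clip R) (use R in auto)
  obtain u v where x: "x = (u, v)" by (metis surj_pair)
  show ?thesis
    using norm_Pair_le[of "fock_tri (clip R v) (clip R v) (clip R u)" "- fock_tri (clip R u) (clip R u) (clip R v)"]
      b[of v u] b[of u v] by (simp add: clipped_field_def x)
qed

lemma has_vector_derivative_Pair_iff:
  "((\<lambda>t. (u t, v t)) has_vector_derivative (u', v')) (at t) \<longleftrightarrow>
    (u has_vector_derivative u') (at t) \<and> (v has_vector_derivative v') (at t)"
proof
  assume *: "((\<lambda>t. (u t, v t)) has_vector_derivative (u', v')) (at t)"
  show "(u has_vector_derivative u') (at t) \<and> (v has_vector_derivative v') (at t)"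
    using bounded_linear.has_vector_derivative[OF bounded_linear_fst *]
      bounded_linear.has_vector_derivative[OF bounded_linear_snd *] by simp
qed (auto intro: has_vector_derivative_Pair)

text \<open>
  The norms are conserved also by the clipped system, so that the clipping is never active.
\<close>

lemma clipped_solution:
  assumes x: "\<And>t. ((\<lambda>t. (u t, v t)) has_vector_derivative clipped_field R (u t, v t)) (at t)"
    and R: "norm (u 0) \<le> R" "norm (v 0) \<le> R"
  shows "fock_solution u v"
proof -
  have du: "(u has_vector_derivative fock_tri (clip R (v t)) (clip R (v t)) (clip R (u t))) (at t)"
    and dv: "(v has_vector_derivative - fock_tri (clip R (u t)) (clip R (u t)) (clip R (v t))) (at t)" for t
    using x[of t] unfolding clipped_field_def by (simp_all add: has_vector_derivative_Pair_iff)
  obtain r where r: "\<And>x::fock. clip R x = r x *\<^sub>R x" using clip_scaling by metis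
  have "(u has_vector_derivative (r (v t) * r (v t) * r (u t)) *\<^sub>R fock_tri (v t) (v t) (u t)) (at t)" for t
    using du[of t] unfolding r by (simp add: fock_tri_scaleR mult_ac)
  from norm_conserved[OF this] R have nu: "norm (u t) \<le> R" for t by metis
  have "(v has_vector_derivative (- (r (u t) * r (u t) * r (v t))) *\<^sub>R fock_tri (u t) (u t) (v t)) (at t)" for t
    using dv[of t] unfolding r by (simp add: fock_tri_scaleR mult_ac)
  from norm_conserved[OF this] R have nv: "norm (v t) \<le> R" for t by metis
  show ?thesis using du dv unfolding fock_solution_def clip_inside[OF nu] clip_inside[OF nv] by blast
qed

lemma fock_solution_exists: "\<exists>u v. fock_solution u v \<and> u 0 = u0 \<and> v 0 = v0"
proof -
  \<comment> \<open>A level at which clipping does not affect the data.\<close>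
  define R where "R = max (norm u0) (norm v0)"
  have R: "R \<ge> 0" by (simp add: R_def le_max_iff_disj)
  obtain x where x0: "x 0 = (u0, v0)" and x: "\<And>t. (x has_vector_derivative clipped_field R (x t)) (at t)"
    by (rule bounded_lipschitz_flow[OF clipped_field_lipschitz[OF R] _ clipped_field_bounded[OF R]])
      (auto intro!: add_nonneg_pos)
  have "fock_solution (\<lambda>t. fst (x t)) (\<lambda>t. snd (x t))"
    by (rule clipped_solution[where R = R]) (use x in \<open>auto simp: x0 R_def\<close>)
  then show ?thesis using x0 by (intro exI[of _ "\<lambda>t. fst (x t)"] exI[of _ "\<lambda>t. snd (x t)"]) simp
qed

text \<open>
  By conservation of the norms, every solution solves the system clipped at the size of its data.
\<close>

lemma fock_solution_unique:
  assumes s: "fock_solution u v" and s': "fock_solution u' v'" and init: "u 0 = u' 0" "v 0 = v' 0"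
  shows "u t = u' t \<and> v t = v' t"
proof -
  define R where "R = max (norm (u 0)) (norm (v 0))"
  have R: "R \<ge> 0" by (simp add: R_def le_max_iff_disj)
  have field: "((\<lambda>t. (u t, v t)) has_vector_derivative clipped_field R (u t, v t)) (at t)"
    if "fock_solution u v" "norm (u 0) \<le> R" "norm (v 0) \<le> R" for u v t
  proof -
    have "norm (u t) \<le> R" "norm (v t) \<le> R" using fock_solution_norms[OF that(1), of t] that by simp_all
    then show ?thesis
      using that(1) by (simp add: has_vector_derivative_Pair_iff clipped_field_def clip_inside fock_solution_def)
  qed
  have "(u t, v t) = (u' t, v' t)"
    by (rule bounded_lipschitz_flow_unique[OF clipped_field_lipschitz[OF R] _ clipped_field_bounded[OF R]
          field[OF s] field[OF s']]) (auto simp: R_def init intro!: add_nonneg_pos)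
  then show ?thesis by simp
qed

section \<open>Growth of the weighted norms\<close>

lemma bounded_weight_energy_derivative:
  assumes \<omega>: "fock_weight \<omega>" and R: "\<And>z. \<omega> z \<le> R"
    and d: "(u has_vector_derivative \<sigma> *\<^sub>R fock_tri (v t) (v t) (u t)) (at t)"
  shows "((\<lambda>t. (wnorm \<omega> k (u t))\<^sup>2) has_real_derivative
    2 * \<sigma> * weighted_current \<omega> k (fock_fun (u t)) (fock_fun (v t))) (at t)"
proof -
  let ?u' = "\<sigma> *\<^sub>R fock_tri (v t) (v t) (u t)"
  have "((\<lambda>t. winner \<omega> k (u t) (u t)) has_vector_derivative (winner \<omega> k (u t) ?u' + winner \<omega> k ?u' (u t))) (at t)"
    by (intro bounded_bilinear.has_vector_derivative[OF winner_bounded_bilinear[OF \<omega> R]] d)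
  moreover have "winner \<omega> k ?u' (u t) = \<sigma> * weighted_current \<omega> k (fock_fun (u t)) (fock_fun (v t))"
    using winner_tri[OF \<omega> wfinite_bounded_weight(1)[OF \<omega> R]] by (simp add: winner_scaleR_left winner_commute[of _ _ "fock_tri _ _ _"])
  ultimately show ?thesis
    by (simp add: winner_self winner_commute[of _ _ "u t"] has_real_derivative_iff_has_vector_derivative mult.assoc)
qed

text \<open>
  The sign \<open>\<sigma>\<close> covers both equations and the reversal of time. By \<open>weighted_current_bound\<close>, the norm of
  order \<open>k + 1\<close> has a derivative of at most a constant times \<open>N^2\<close> times the norm of order \<open>k\<close>. Integrating the
  bound \<open>(1 + A N^2 t)^k\<close> of the latter gives the exponent \<open>k + 1\<close>; the initial norm of order \<open>k\<close> is
  at most that of order \<open>k + 1\<close>. The constant depends neither on the weight nor on its bound \<open>R\<close>.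
\<close>

lemma growth_forward:
  "\<exists>A>0. \<forall>\<omega> R \<sigma> u v N t. fock_weight \<omega> \<longrightarrow> (\<forall>z. \<omega> z \<le> R) \<longrightarrow> \<bar>\<sigma>\<bar> = 1 \<longrightarrow>
     (\<forall>t. (u has_vector_derivative \<sigma> *\<^sub>R fock_tri (v t) (v t) (u t)) (at t)) \<longrightarrow> (\<forall>t. norm (v t) = N) \<longrightarrow> 0 \<le> t \<longrightarrow>
     wnorm \<omega> k (u t) \<le> wnorm \<omega> k (u 0) * (1 + A * N\<^sup>2 * t) ^ k"
proof (induction k)
  case 0
  have "norm (u t) \<le> norm (u 0)" if "\<forall>t. (u has_vector_derivative \<sigma> *\<^sub>R fock_tri (v t) (v t) (u t)) (at t)" for \<sigma> u v t
    using norm_conserved[of u "\<lambda>_. \<sigma>" v t] that by simp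
  then show ?case unfolding wnorm_0 by (intro exI[of _ 1] conjI allI impI) simp_all
next
  case (Suc k)
  then obtain A where A: "A > 0" and IH: "\<And>\<omega> R \<sigma> u v N t. fock_weight \<omega> \<Longrightarrow> (\<And>z. \<omega> z \<le> R) \<Longrightarrow> \<bar>\<sigma>\<bar> = 1 \<Longrightarrow>
     (\<And>t. (u has_vector_derivative \<sigma> *\<^sub>R fock_tri (v t) (v t) (u t)) (at t)) \<Longrightarrow> (\<And>t. norm (v t) = N) \<Longrightarrow> 0 \<le> t \<Longrightarrow>
     wnorm \<omega> k (u t) \<le> wnorm \<omega> k (u 0) * (1 + A * N\<^sup>2 * t) ^ k" by blast
  define s where "s = schur_const (2 * Suc k)"
  have s0: "s \<ge> 0" by (simp add: s_def)
  define A' where "A' = A + 2 * s"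
  have A': "A' > 0" "A \<le> A'" "2 * s \<le> A'" using A s0 by (auto simp: A'_def)
  have "wnorm \<omega> (Suc k) (u t) \<le> wnorm \<omega> (Suc k) (u 0) * (1 + A' * N\<^sup>2 * t) ^ Suc k"
    if \<omega>: "fock_weight \<omega>" and R: "\<And>z. \<omega> z \<le> R" and \<sigma>: "\<bar>\<sigma>\<bar> = 1"
      and d: "\<And>t. (u has_vector_derivative \<sigma> *\<^sub>R fock_tri (v t) (v t) (u t)) (at t)"
      and N: "\<And>t. norm (v t) = N" and t: "0 \<le> t" for \<omega> R \<sigma> u v N t
    \<comment> \<open>The zero solution is separated because the norm is differentiated as a square root.\<close>
  proof (cases "u 0 = 0 \<or> t = 0")
    case True
    then have "u t = 0 \<or> t = 0" using norm_conserved[OF d, of t] by auto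
    moreover have "wnorm \<omega> (Suc k) 0 = 0"
      using wfinite_bounded_weight(2)[OF \<omega> R, of "Suc k" 0] wnorm_nonneg[of \<omega> "Suc k" 0] by simp
    ultimately show ?thesis using True A' t by (auto intro!: mult_nonneg_nonneg)
  next
    case False
    note fin = wfinite_bounded_weight(1)[OF \<omega> R]
    define m where "m \<tau> = wnorm \<omega> (Suc k) (u \<tau>)" for \<tau>
    have mpos: "m \<tau> > 0" for \<tau>
    proof -
      have "0 < norm (u \<tau>)" using norm_conserved[OF d, of \<tau>] False by simp
      also have "\<dots> \<le> m \<tau>" unfolding m_def using wnorm_mono(2)[OF \<omega> _ fin, of 0 "Suc k"] by (simp add: wnorm_0)
      finally show ?thesis .
    qed
    define c where "c \<tau> = weighted_current \<omega> (Suc k) (fock_fun (u \<tau>)) (fock_fun (v \<tau>))" for \<tau>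
    have dm: "(m has_real_derivative \<sigma> * c \<tau> / m \<tau>) (at \<tau>)" for \<tau>
    proof -
      have d1: "((\<lambda>\<tau>. (m \<tau>)\<^sup>2) has_real_derivative 2 * \<sigma> * c \<tau>) (at \<tau>)"
        unfolding m_def c_def by (rule bounded_weight_energy_derivative[OF \<omega> R d])
      have d2: "(sqrt has_real_derivative inverse (sqrt ((m \<tau>)\<^sup>2)) / 2) (at ((m \<tau>)\<^sup>2))"
        using mpos[of \<tau>] by (intro DERIV_real_sqrt) simp
      have "((\<lambda>\<tau>. sqrt ((m \<tau>)\<^sup>2)) has_real_derivative inverse (sqrt ((m \<tau>)\<^sup>2)) / 2 * (2 * \<sigma> * c \<tau>)) (at \<tau>)"
        by (rule DERIV_chain2[where f = sqrt, OF d2 d1])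
      moreover have sq: "sqrt ((m x)\<^sup>2) = m x" for x using mpos[of x] by simp
      ultimately have "(m has_real_derivative inverse (m \<tau>) / 2 * (2 * \<sigma> * c \<tau>)) (at \<tau>)" by (simp only: sq)
      then show ?thesis by (rule DERIV_cong) (simp add: inverse_eq_divide)
    qed
    have bound: "\<bar>\<sigma> * c \<tau> / m \<tau>\<bar> \<le> m 0 * (real (Suc k) * (A' * N\<^sup>2)) * (1 + A' * N\<^sup>2 * \<tau>) ^ k" if \<tau>: "0 < \<tau>" for \<tau>
    proof -
      have cb: "\<bar>c \<tau>\<bar> \<le> 2 * real (Suc k) * s * N\<^sup>2 * (wnorm \<omega> k (u \<tau>) * m \<tau>)"
        using weighted_current_bound[OF fock_fun_in fock_fun_in \<omega> fin[unfolded wfinite_def], of "Suc k" "u \<tau>" "v \<tau>"] N[of \<tau>]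
        by (simp only: c_def s_def m_def wnorm_def norm_fock_def diff_Suc_1)
      have "\<bar>\<sigma> * c \<tau> / m \<tau>\<bar> = \<bar>c \<tau>\<bar> / m \<tau>"
        using mpos[of \<tau>] \<sigma> by (simp add: abs_mult)
      also have "\<bar>c \<tau>\<bar> / m \<tau> \<le> 2 * real (Suc k) * s * N\<^sup>2 * (wnorm \<omega> k (u \<tau>) * m \<tau>) / m \<tau>"
        using mpos[of \<tau>] cb by (intro divide_right_mono) auto
      also have "\<dots> = (2 * s) * (real (Suc k) * N\<^sup>2 * wnorm \<omega> k (u \<tau>))"
        using mpos[of \<tau>] by simp
      also have "\<dots> \<le> A' * (real (Suc k) * N\<^sup>2 * (m 0 * (1 + A' * N\<^sup>2 * \<tau>) ^ k))"
      proof (intro mult_mono[OF A'(3)] mult_left_mono)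
        have "wnorm \<omega> k (u \<tau>) \<le> wnorm \<omega> k (u 0) * (1 + A * N\<^sup>2 * \<tau>) ^ k"
          by (rule IH[OF \<omega> R \<sigma> d N]) (use \<tau> in auto)
        also have "\<dots> \<le> m 0 * (1 + A' * N\<^sup>2 * \<tau>) ^ k"
          unfolding m_def using \<tau> A A'
          by (intro mult_mono wnorm_mono(2)[OF \<omega> _ fin] power_mono add_left_mono mult_right_mono) auto
        finally show "wnorm \<omega> k (u \<tau>) \<le> m 0 * (1 + A' * N\<^sup>2 * \<tau>) ^ k" .
      qed (use A' in auto)
      finally show ?thesis by (simp add: mult_ac)
    qed
    have "norm (m t - m 0) \<le> m 0 * (1 + A' * N\<^sup>2 * t) ^ Suc k - m 0 * (1 + A' * N\<^sup>2 * 0) ^ Suc k"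
    proof (rule differentiable_bound_general[where f' = "\<lambda>\<tau>. \<sigma> * c \<tau> / m \<tau>"])
      show "0 < t" using t False by simp
      show "continuous_on {0..t} m" using dm by (meson DERIV_isCont continuous_at_imp_continuous_on)
      show "((\<lambda>\<tau>. m 0 * (1 + A' * N\<^sup>2 * \<tau>) ^ Suc k) has_vector_derivative
          m 0 * (real (Suc k) * (A' * N\<^sup>2)) * (1 + A' * N\<^sup>2 * \<tau>) ^ k) (at \<tau>)" for \<tau>
        unfolding has_real_derivative_iff_has_vector_derivative[symmetric]
        by (rule derivative_eq_intros refl | simp)+
    qed (use dm bound in \<open>auto intro!: continuous_intros simp: has_real_derivative_iff_has_vector_derivative[symmetric]\<close>)
    then show ?thesis by (simp add: m_def)
  qed
  with A' show ?case by (intro exI[of _ A']) blast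
qed

lemma growth_both_directions:
  "\<exists>A>0. \<forall>\<omega> R \<sigma> u v N t. fock_weight \<omega> \<longrightarrow> (\<forall>z. \<omega> z \<le> R) \<longrightarrow> \<bar>\<sigma>\<bar> = 1 \<longrightarrow>
     (\<forall>t. (u has_vector_derivative \<sigma> *\<^sub>R fock_tri (v t) (v t) (u t)) (at t)) \<longrightarrow> (\<forall>t. norm (v t) = N) \<longrightarrow>
     wnorm \<omega> k (u t) \<le> wnorm \<omega> k (u 0) * (1 + A * N\<^sup>2 * \<bar>t\<bar>) ^ k"
proof -
  obtain A where A: "A > 0" and fwd: "\<And>\<omega> R \<sigma> u v N t. fock_weight \<omega> \<Longrightarrow> (\<And>z. \<omega> z \<le> R) \<Longrightarrow> \<bar>\<sigma>\<bar> = 1 \<Longrightarrow>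
     (\<And>t. (u has_vector_derivative \<sigma> *\<^sub>R fock_tri (v t) (v t) (u t)) (at t)) \<Longrightarrow> (\<And>t. norm (v t) = N) \<Longrightarrow> 0 \<le> t \<Longrightarrow>
     wnorm \<omega> k (u t) \<le> wnorm \<omega> k (u 0) * (1 + A * N\<^sup>2 * t) ^ k" using growth_forward[of k] by blast
  have "wnorm \<omega> k (u t) \<le> wnorm \<omega> k (u 0) * (1 + A * N\<^sup>2 * \<bar>t\<bar>) ^ k"
    if \<omega>: "fock_weight \<omega>" and R: "\<And>z. \<omega> z \<le> R" and \<sigma>: "\<bar>\<sigma>\<bar> = 1"
      and d: "\<And>t. (u has_vector_derivative \<sigma> *\<^sub>R fock_tri (v t) (v t) (u t)) (at t)"
      and N: "\<And>t. norm (v t) = N" for \<omega> R \<sigma> u v N t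
  proof (cases "0 \<le> t")
    case True
    then show ?thesis using fwd[OF \<omega> R \<sigma> d N True] by simp
  next
    case False
    have "((\<lambda>s. u (- s)) has_vector_derivative (- \<sigma>) *\<^sub>R fock_tri (v (- s)) (v (- s)) (u (- s))) (at s)" for s
    proof -
      have "((\<lambda>x::real. - x) has_vector_derivative - 1) (at s)"
        unfolding has_real_derivative_iff_has_vector_derivative[symmetric]
        by (auto intro!: derivative_eq_intros)
      from vector_diff_chain_at[OF this d] show ?thesis by (simp add: o_def)
    qed
    from fwd[OF \<omega> R _ this N, of "- t"] \<sigma> False show ?thesis by simp
  qed
  with A show ?thesis by blast
qed

text \<open>
  The truncation level starts at 1, since a weight is bounded below by 1.
\<close>

definition truncated_bracket :: "nat \<Rightarrow> complex \<Rightarrow> real" where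
  "truncated_bracket n z = min (japanese_bracket z) (real (Suc n))"

lemma truncated_bracket_weight: "fock_weight (truncated_bracket n)"
  unfolding truncated_bracket_def[abs_def] by (rule truncated_weight) simp

lemma truncated_bracket_le: "truncated_bracket n z \<le> real (Suc n)"
  by (simp add: truncated_bracket_def)

lemma wfinite_truncated [simp]: "wfinite (truncated_bracket n) k x"
  by (rule wfinite_bounded_weight(1)[OF truncated_bracket_weight truncated_bracket_le])

lemma wnorm_truncated_le:
  assumes "wfinite japanese_bracket k x"
  shows "wnorm (truncated_bracket n) k x \<le> wnorm japanese_bracket k x"
proof -
  have m: "weigh (truncated_bracket n) k (fock_fun x) \<in> borel_measurable borel"
    by (rule weigh_measurable[OF truncated_bracket_weight]) measurable
  have le: "cmod (weigh (truncated_bracket n) k (fock_fun x) z) \<le> 1 * cmod (weigh japanese_bracket k (fock_fun x) z)" for z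
    unfolding norm_weigh[OF truncated_bracket_weight] norm_weigh[OF japanese_bracket_weight] mult_1
    using fock_weight_pos[OF truncated_bracket_weight, of n z]
    by (intro mult_right_mono power_mono) (auto simp: truncated_bracket_def)
  show ?thesis
    using square_integrable_mono(2)[OF assms[unfolded wfinite_def] m le] by (simp add: wnorm_def)
qed

text \<open>
  For each \<open>z\<close> the truncation is eventually inactive, and Fatou's lemma applies.
\<close>

lemma wfinite_from_truncations:
  assumes B: "\<And>n. wnorm (truncated_bracket n) k x \<le> B"
  shows "wfinite japanese_bracket k x" "wnorm japanese_bracket k x \<le> B"
proof -
  have lim: "(\<lambda>n. weigh (truncated_bracket n) k (fock_fun x) z) \<longlonglongrightarrow> weigh japanese_bracket k (fock_fun x) z" for z
  proof (rule tendsto_eventually)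
    obtain N where N: "japanese_bracket z \<le> real N" using real_arch_simple by blast
    show "\<forall>\<^sub>F n in sequentially. weigh (truncated_bracket n) k (fock_fun x) z = weigh japanese_bracket k (fock_fun x) z"
      unfolding eventually_sequentially
      by (intro exI[of _ N]) (use N in \<open>auto simp: weigh_def truncated_bracket_def min_def\<close>)
  qed
  show "wfinite japanese_bracket k x" "wnorm japanese_bracket k x \<le> B"
    unfolding wfinite_def wnorm_def
    by (rule L2_Fatou[OF wfinite_truncated[unfolded wfinite_def] B[unfolded wnorm_def] lim])+
qed

text \<open>
  Fixing one constant per exponent makes it visibly independent of the solution.
\<close>

definition growth_const :: "nat \<Rightarrow> real" where
  "growth_const k = (SOME A. A > 0 \<and> (\<forall>\<omega> R \<sigma> u v N t. fock_weight \<omega> \<longrightarrow> (\<forall>z. \<omega> z \<le> R) \<longrightarrow> \<bar>\<sigma>\<bar> = 1 \<longrightarrow>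
     (\<forall>t. (u has_vector_derivative \<sigma> *\<^sub>R fock_tri (v t) (v t) (u t)) (at t)) \<longrightarrow> (\<forall>t. norm (v t) = N) \<longrightarrow>
     wnorm \<omega> k (u t) \<le> wnorm \<omega> k (u 0) * (1 + A * N\<^sup>2 * \<bar>t\<bar>) ^ k))"

lemma growth_const_pos: "growth_const k > 0"
  and growth_const_bound: "\<lbrakk>fock_weight \<omega>; \<And>z. \<omega> z \<le> R; \<bar>\<sigma>\<bar> = 1;
     \<And>t. (u has_vector_derivative \<sigma> *\<^sub>R fock_tri (v t) (v t) (u t)) (at t); \<And>t. norm (v t) = N\<rbrakk> \<Longrightarrow>
     wnorm \<omega> k (u t) \<le> wnorm \<omega> k (u 0) * (1 + growth_const k * N\<^sup>2 * \<bar>t\<bar>) ^ k"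
  using someI_ex[OF growth_both_directions[of k]] unfolding growth_const_def[symmetric] by blast+

lemma weighted_growth:
  assumes \<sigma>: "\<bar>\<sigma>\<bar> = 1" and d: "\<And>t. (u has_vector_derivative \<sigma> *\<^sub>R fock_tri (v t) (v t) (u t)) (at t)"
    and N: "\<And>t. norm (v t) = N" and fin: "wfinite japanese_bracket k (u 0)"
  shows "wfinite japanese_bracket k (u t)"
    and "wnorm japanese_bracket k (u t) \<le> wnorm japanese_bracket k (u 0) * (1 + growth_const k * N\<^sup>2 * \<bar>t\<bar>) ^ k"
proof -
  have "wnorm (truncated_bracket n) k (u t) \<le> wnorm japanese_bracket k (u 0) * (1 + growth_const k * N\<^sup>2 * \<bar>t\<bar>) ^ k" for n
  proof -
    have "wnorm (truncated_bracket n) k (u t) \<le> wnorm (truncated_bracket n) k (u 0) * (1 + growth_const k * N\<^sup>2 * \<bar>t\<bar>) ^ k"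
      by (rule growth_const_bound[OF truncated_bracket_weight truncated_bracket_le \<sigma> d N])
    also have "\<dots> \<le> wnorm japanese_bracket k (u 0) * (1 + growth_const k * N\<^sup>2 * \<bar>t\<bar>) ^ k"
      using growth_const_pos[of k] by (intro mult_right_mono wnorm_truncated_le fin) auto
    finally show ?thesis .
  qed
  from wfinite_from_truncations[OF this]
  show "wfinite japanese_bracket k (u t)"
    "wnorm japanese_bracket k (u t) \<le> wnorm japanese_bracket k (u 0) * (1 + growth_const k * N\<^sup>2 * \<bar>t\<bar>) ^ k" .
qed

lemma fock_solution_growth:
  assumes s: "fock_solution u v" and fin: "wfinite japanese_bracket k (u 0)" "wfinite japanese_bracket k (v 0)"
  shows "wfinite japanese_bracket k (u t)" "wfinite japanese_bracket k (v t)"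
    and "wnorm japanese_bracket k (u t) \<le> wnorm japanese_bracket k (u 0) * (1 + growth_const k * (norm (v 0))\<^sup>2 * \<bar>t\<bar>) ^ k"
    and "wnorm japanese_bracket k (v t) \<le> wnorm japanese_bracket k (v 0) * (1 + growth_const k * (norm (u 0))\<^sup>2 * \<bar>t\<bar>) ^ k"
  using weighted_growth[of 1 u v, OF _ _ fock_solution_norms(2)[OF s] fin(1)]
    weighted_growth[of "-1" v u, OF _ _ fock_solution_norms(1)[OF s] fin(2)] s
  by (auto simp: fock_solution_def)

section \<open>Smoothness in the weighted norms\<close>

text \<open>
  The mean value theorem for the real function \<open>s \<mapsto> \<langle>f(s), y\<rangle>\<close> with \<open>y = f(h) - f(0)\<close>, in the weighted inner
  product, gives \<open>||y||^2 \<le> |h| B ||y||\<close>.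
\<close>

lemma seminorm_mean_value:
  assumes d: "\<And>s. (f has_vector_derivative f' s) (at s)"
    and B: "\<And>s. \<bar>s\<bar> \<le> \<bar>h\<bar> \<Longrightarrow> wnorm (truncated_bracket n) k (f' s) \<le> B"
  shows "wnorm (truncated_bracket n) k (f h - f 0) \<le> \<bar>h\<bar> * B"
proof -
  let ?\<omega> = "truncated_bracket n"
  let ?y = "f h - f 0"
  let ?p = "wnorm ?\<omega> k ?y"
  interpret W: bounded_bilinear "winner ?\<omega> k"
    by (rule winner_bounded_bilinear[OF truncated_bracket_weight truncated_bracket_le])
  have d\<psi>: "((\<lambda>s. winner ?\<omega> k (f s) ?y) has_field_derivative winner ?\<omega> k (f' s) ?y) (at s)" for s
    using bounded_linear.has_vector_derivative[OF W.bounded_linear_left d]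
    by (simp add: has_real_derivative_iff_has_vector_derivative)
  have "norm (winner ?\<omega> k (f h) ?y - winner ?\<omega> k (f 0) ?y) \<le> (B * ?p) * norm (h - 0)"
  proof (rule field_differentiable_bound[of "{- \<bar>h\<bar>..\<bar>h\<bar>}"])
    show "norm (winner ?\<omega> k (f' s) ?y) \<le> B * ?p" if "s \<in> {- \<bar>h\<bar>..\<bar>h\<bar>}" for s
    proof -
      have "norm (winner ?\<omega> k (f' s) ?y) \<le> wnorm ?\<omega> k (f' s) * ?p"
        using winner_bound[OF wfinite_truncated wfinite_truncated] by simp
      also have "\<dots> \<le> B * ?p" using that by (intro mult_right_mono B) auto
      finally show ?thesis .
    qed
  qed (auto intro: DERIV_subset[OF d\<psi>])
  then have "?p\<^sup>2 \<le> \<bar>h\<bar> * B * ?p"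
    unfolding W.diff_left[symmetric] winner_self by (simp add: mult_ac)
  then have "?p * ?p \<le> (\<bar>h\<bar> * B) * ?p" by (simp add: power2_eq_square)
  moreover have "0 \<le> \<bar>h\<bar> * B"
    using B[of 0] wnorm_nonneg[of ?\<omega> k "f' 0"] by (intro mult_nonneg_nonneg) linarith+
  ultimately show ?thesis
    by (cases "?p = 0") (auto dest: mult_right_le_imp_le simp: less_le)
qed

definition locally_wbounded :: "nat \<Rightarrow> (real \<Rightarrow> fock) \<Rightarrow> bool" where
  "locally_wbounded k x \<longleftrightarrow>
     (\<forall>T. \<exists>B. \<forall>t. \<bar>t\<bar> \<le> T \<longrightarrow> wfinite japanese_bracket k (x t) \<and> wnorm japanese_bracket k (x t) \<le> B)"

lemma locally_wbounded_finite: "locally_wbounded k x \<Longrightarrow> wfinite japanese_bracket k (x t)"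
  unfolding locally_wbounded_def by (meson order_refl)

text \<open>
  Differentiability in the unweighted norm is improved to the weighted norm at the price of one more
  derivative. Applying \<open>seminorm_mean_value\<close> to \<open>x'\<close> and then to \<open>x(t + s) - s x'(t)\<close> bounds the error of the
  difference quotient by \<open>|h| B\<close> for all truncated weights, and the truncation is removed.
\<close>

lemma weighted_derivative_lift:
  assumes d: "\<And>t. (x has_vector_derivative x' t) (at t)" and d': "\<And>t. (x' has_vector_derivative x'' t) (at t)"
    and b: "locally_wbounded k x" "locally_wbounded k x'" "locally_wbounded k x''"
  shows "((\<lambda>h. wnorm japanese_bracket k ((1 / h) *\<^sub>R (x (t + h) - x t) - x' t)) \<longlongrightarrow> 0) (at 0)"
proof -
  obtain B where B: "\<And>s. \<bar>s\<bar> \<le> \<bar>t\<bar> + 1 \<Longrightarrow> wfinite japanese_bracket k (x'' s) \<and> wnorm japanese_bracket k (x'' s) \<le> B"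
    using b(3) unfolding locally_wbounded_def by meson
  have bound: "wnorm japanese_bracket k ((1 / h) *\<^sub>R (x (t + h) - x t) - x' t) \<le> \<bar>h\<bar> * B"
    if h: "h \<noteq> 0" "\<bar>h\<bar> \<le> 1" for h
  proof -
    let ?y = "x (t + h) - x t - h *\<^sub>R x' t"
    have shift: "((\<lambda>s. y (t + s)) has_vector_derivative y' (t + s)) (at s)"
      if "\<And>t. (y has_vector_derivative y' t) (at t)" for y y' :: "real \<Rightarrow> fock" and s
    proof -
      have "((\<lambda>s. t + s) has_vector_derivative 1) (at s)"
        by (auto intro!: derivative_eq_intros)
      from vector_diff_chain_at[OF this that] show ?thesis by (simp add: o_def)
    qed
    have "wnorm (truncated_bracket n) k ?y \<le> \<bar>h\<bar> * (\<bar>h\<bar> * B)" for n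
    proof -
      have 1: "wnorm (truncated_bracket n) k (x' (t + s) - x' t) \<le> \<bar>h\<bar> * B" if s: "\<bar>s\<bar> \<le> \<bar>h\<bar>" for s
      proof -
        have "wnorm (truncated_bracket n) k (x' (t + s) - x' (t + 0)) \<le> \<bar>s\<bar> * B"
        proof (rule seminorm_mean_value[OF shift[OF d']])
          fix r assume "\<bar>r\<bar> \<le> \<bar>s\<bar>"
          then have "\<bar>t + r\<bar> \<le> \<bar>t\<bar> + 1" using s h by linarith
          from B[OF this] show "wnorm (truncated_bracket n) k (x'' (t + r)) \<le> B"
            using wnorm_truncated_le order_trans by blast
        qed
        also have "\<dots> \<le> \<bar>h\<bar> * B"
          using s B[of t] order_trans[OF wnorm_nonneg] by (intro mult_right_mono) auto
        finally show ?thesis by simp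
      qed
      have "wnorm (truncated_bracket n) k ((x (t + h) - h *\<^sub>R x' t) - (x (t + 0) - 0 *\<^sub>R x' t)) \<le> \<bar>h\<bar> * (\<bar>h\<bar> * B)"
      proof (rule seminorm_mean_value[where f' = "\<lambda>s. x' (t + s) - x' t"])
        show "((\<lambda>s. x (t + s) - s *\<^sub>R x' t) has_vector_derivative x' (t + s) - x' t) (at s)" for s
          by (intro has_vector_derivative_diff shift d) (auto intro!: derivative_eq_intros)
      qed (use 1 in auto)
      then show ?thesis by (simp add: algebra_simps)
    qed
    from wfinite_from_truncations[OF this] have y: "wfinite japanese_bracket k ?y" "wnorm japanese_bracket k ?y \<le> \<bar>h\<bar> * (\<bar>h\<bar> * B)" .
    have "(1 / h) *\<^sub>R (x (t + h) - x t) - x' t = (1 / h) *\<^sub>R ?y"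
      using h by (simp add: scaleR_right_diff_distrib)
    then have "wnorm japanese_bracket k ((1 / h) *\<^sub>R (x (t + h) - x t) - x' t) = \<bar>1 / h\<bar> * wnorm japanese_bracket k ?y"
      using wnorm_scaleR[OF y(1)] by simp
    also have "\<dots> \<le> \<bar>1 / h\<bar> * (\<bar>h\<bar> * (\<bar>h\<bar> * B))" by (intro mult_left_mono y) simp
    also have "\<dots> = \<bar>h\<bar> * B" using h by simp
    finally show ?thesis .
  qed
  show ?thesis
  proof (rule Lim_null_comparison)
    show "\<forall>\<^sub>F h in at 0. norm (wnorm japanese_bracket k ((1 / h) *\<^sub>R (x (t + h) - x t) - x' t)) \<le> \<bar>h\<bar> * B"
      unfolding eventually_at by (rule exI[of _ 1]) (auto intro!: bound)
    show "((\<lambda>h::real. \<bar>h\<bar> * B) \<longlongrightarrow> 0) (at 0)"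
      by (auto intro!: tendsto_eq_intros)
  qed
qed

text \<open>
  Derivatives are taken in the unweighted norm, and only their size is measured in the weighted one. Because of
  \<open>weighted_derivative_lift\<close> this suffices for smoothness in the weighted norm.
\<close>

primrec wsmooth :: "nat \<Rightarrow> nat \<Rightarrow> (real \<Rightarrow> fock) \<Rightarrow> bool" where
  "wsmooth k 0 x \<longleftrightarrow> locally_wbounded k x"
| "wsmooth k (Suc n) x \<longleftrightarrow> locally_wbounded k x \<and> (\<exists>x'. (\<forall>t. (x has_vector_derivative x' t) (at t)) \<and> wsmooth k n x')"

lemma wsmooth_bounded: "wsmooth k n x \<Longrightarrow> locally_wbounded k x"
  by (cases n) auto

lemma wsmooth_pred: "wsmooth k (Suc n) x \<Longrightarrow> wsmooth k n x"
  by (induction n arbitrary: x) auto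

lemma locally_wbounded_add:
  assumes "locally_wbounded k x" "locally_wbounded k y"
  shows "locally_wbounded k (\<lambda>t. x t + y t)"
  unfolding locally_wbounded_def
proof
  fix T
  obtain B where B: "\<And>t. \<bar>t\<bar> \<le> T \<Longrightarrow> wnorm japanese_bracket k (x t) \<le> B"
    using assms(1) unfolding locally_wbounded_def by meson
  obtain C where C: "\<And>t. \<bar>t\<bar> \<le> T \<Longrightarrow> wnorm japanese_bracket k (y t) \<le> C"
    using assms(2) unfolding locally_wbounded_def by meson
  show "\<exists>B. \<forall>t. \<bar>t\<bar> \<le> T \<longrightarrow> wfinite japanese_bracket k (x t + y t) \<and> wnorm japanese_bracket k (x t + y t) \<le> B"
    using assms[THEN locally_wbounded_finite] B C
    by (intro exI[of _ "B + C"]) (auto intro!: wfinite_add order_trans[OF wnorm_add] add_mono)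
qed

lemma locally_wbounded_uminus: "locally_wbounded k x \<Longrightarrow> locally_wbounded k (\<lambda>t. - x t)"
  unfolding locally_wbounded_def by (metis wfinite_uminus wnorm_uminus)

lemma locally_wbounded_tri:
  assumes "locally_wbounded k a" "locally_wbounded k b" "locally_wbounded k c"
  shows "locally_wbounded k (\<lambda>t. fock_tri (a t) (b t) (c t))"
  unfolding locally_wbounded_def
proof
  fix T
  have "\<exists>B\<ge>0. \<forall>t. \<bar>t\<bar> \<le> T \<longrightarrow> wnorm japanese_bracket k (x t) \<le> B" if "locally_wbounded k x" for x
    using that unfolding locally_wbounded_def by (metis abs_ge_self abs_ge_zero order_trans)
  note ex = this
  obtain A where A: "A \<ge> 0" "\<And>t. \<bar>t\<bar> \<le> T \<Longrightarrow> wnorm japanese_bracket k (a t) \<le> A"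
    using ex[OF assms(1)] by blast
  obtain B where B: "B \<ge> 0" "\<And>t. \<bar>t\<bar> \<le> T \<Longrightarrow> wnorm japanese_bracket k (b t) \<le> B"
    using ex[OF assms(2)] by blast
  obtain C where C: "C \<ge> 0" "\<And>t. \<bar>t\<bar> \<le> T \<Longrightarrow> wnorm japanese_bracket k (c t) \<le> C"
    using ex[OF assms(3)] by blast
  have nw: "norm (x t) \<le> wnorm japanese_bracket k (x t)" if "locally_wbounded k x" for x t
    using wnorm_mono(2)[OF japanese_bracket_weight _ locally_wbounded_finite[OF that], of 0] by (simp add: wnorm_0)
  show "\<exists>B. \<forall>t. \<bar>t\<bar> \<le> T \<longrightarrow> wfinite japanese_bracket k (fock_tri (a t) (b t) (c t)) \<and>
      wnorm japanese_bracket k (fock_tri (a t) (b t) (c t)) \<le> B"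
  proof (intro exI[of _ "schur_const k * (A * B * C)"] allI impI conjI)
    fix t assume t: "\<bar>t\<bar> \<le> T"
    note c = locally_wbounded_finite[OF assms(3), of t]
    show "wfinite japanese_bracket k (fock_tri (a t) (b t) (c t))"
      by (rule wfinite_tri[OF japanese_bracket_weight c])
    show "wnorm japanese_bracket k (fock_tri (a t) (b t) (c t)) \<le> schur_const k * (A * B * C)"
      by (rule order_trans[OF wnorm_tri[OF japanese_bracket_weight c]])
        (intro mult_left_mono mult_mono C(2) order_trans[OF nw[OF assms(1)] A(2)] order_trans[OF nw[OF assms(2)] B(2)] t;
          use A B C in simp)
  qed
qed

lemma wsmooth_add: "wsmooth k n x \<Longrightarrow> wsmooth k n y \<Longrightarrow> wsmooth k n (\<lambda>t. x t + y t)"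
proof (induction n arbitrary: x y)
  case (Suc n)
  from Suc.prems obtain x' y' where
    "\<forall>t. (x has_vector_derivative x' t) (at t)" "wsmooth k n x'" "\<forall>t. (y has_vector_derivative y' t) (at t)" "wsmooth k n y'"
    by auto
  then show ?case using Suc
    by (auto intro!: locally_wbounded_add exI[of _ "\<lambda>t. x' t + y' t"] has_vector_derivative_add)
qed (simp add: locally_wbounded_add)

lemma wsmooth_uminus: "wsmooth k n x \<Longrightarrow> wsmooth k n (\<lambda>t. - x t)"
proof (induction n arbitrary: x)
  case (Suc n)
  from Suc.prems obtain x' where "\<forall>t. (x has_vector_derivative x' t) (at t)" "wsmooth k n x'" by auto
  then show ?case using Suc
    by (auto intro!: locally_wbounded_uminus exI[of _ "\<lambda>t. - x' t"] has_vector_derivative_minus)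
qed (simp add: locally_wbounded_uminus)

lemma wsmooth_tri:
  "wsmooth k n a \<Longrightarrow> wsmooth k n b \<Longrightarrow> wsmooth k n c \<Longrightarrow> wsmooth k n (\<lambda>t. fock_tri (a t) (b t) (c t))"
proof (induction n arbitrary: a b c)
  case (Suc n)
  from Suc.prems obtain a' where a': "\<forall>t. (a has_vector_derivative a' t) (at t)" "wsmooth k n a'" by auto
  from Suc.prems obtain b' where b': "\<forall>t. (b has_vector_derivative b' t) (at t)" "wsmooth k n b'" by auto
  from Suc.prems obtain c' where c': "\<forall>t. (c has_vector_derivative c' t) (at t)" "wsmooth k n c'" by auto
  note low = Suc.prems[THEN wsmooth_pred]
  have "wsmooth k n (\<lambda>t. fock_tri (a t) (b t) (c' t) + (fock_tri (a t) (b' t) (c t) + fock_tri (a' t) (b t) (c t)))"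
    using a' b' c' low by (intro wsmooth_add Suc.IH)
  moreover have "\<forall>t. ((\<lambda>t. fock_tri (a t) (b t) (c t)) has_vector_derivative
      (fock_tri (a t) (b t) (c' t) + (fock_tri (a t) (b' t) (c t) + fock_tri (a' t) (b t) (c t)))) (at t)"
    using a' b' c' by (intro allI fock_tri_has_vector_derivative) auto
  moreover have "locally_wbounded k (\<lambda>t. fock_tri (a t) (b t) (c t))"
    by (intro locally_wbounded_tri wsmooth_bounded[OF Suc.prems(1)] wsmooth_bounded[OF Suc.prems(2)] wsmooth_bounded[OF Suc.prems(3)])
  ultimately show ?case by auto
qed (simp add: locally_wbounded_tri)

text \<open>
  Bootstrap: if \<open>u\<close> and \<open>v\<close> have \<open>n\<close> derivatives, then so do \<open>u'\<close> and \<open>v'\<close>, which are cubic expressions in them.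
\<close>

lemma fock_solution_wsmooth:
  assumes s: "fock_solution u v" and fin: "wfinite japanese_bracket k (u 0)" "wfinite japanese_bracket k (v 0)"
  shows "wsmooth k n u \<and> wsmooth k n v"
proof (induction n)
  case 0
  have mono: "(1 + growth_const k * N\<^sup>2 * \<bar>t\<bar>) ^ k \<le> (1 + growth_const k * N\<^sup>2 * T) ^ k" if "\<bar>t\<bar> \<le> T" for N t T :: real
    using that growth_const_pos[of k] by (intro power_mono add_left_mono mult_left_mono) auto
  have "locally_wbounded k u"
    unfolding locally_wbounded_def
  proof (intro allI)
    fix T show "\<exists>B. \<forall>t. \<bar>t\<bar> \<le> T \<longrightarrow> wfinite japanese_bracket k (u t) \<and> wnorm japanese_bracket k (u t) \<le> B"
      by (intro exI[of _ "wnorm japanese_bracket k (u 0) * (1 + growth_const k * (norm (v 0))\<^sup>2 * T) ^ k"])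
        (auto intro!: fock_solution_growth(1)[OF s fin] order_trans[OF fock_solution_growth(3)[OF s fin] mult_left_mono[OF mono]])
  qed
  moreover have "locally_wbounded k v"
    unfolding locally_wbounded_def
  proof (intro allI)
    fix T show "\<exists>B. \<forall>t. \<bar>t\<bar> \<le> T \<longrightarrow> wfinite japanese_bracket k (v t) \<and> wnorm japanese_bracket k (v t) \<le> B"
      by (intro exI[of _ "wnorm japanese_bracket k (v 0) * (1 + growth_const k * (norm (u 0))\<^sup>2 * T) ^ k"])
        (auto intro!: fock_solution_growth(2)[OF s fin] order_trans[OF fock_solution_growth(4)[OF s fin] mult_left_mono[OF mono]])
  qed
  ultimately show ?case by simp
next
  case (Suc n)
  have "wsmooth k n (\<lambda>t. fock_tri (v t) (v t) (u t))" "wsmooth k n (\<lambda>t. - fock_tri (u t) (u t) (v t))"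
    using Suc by (auto intro!: wsmooth_tri wsmooth_uminus)
  then show ?case
    using s Suc wsmooth_bounded unfolding fock_solution_def by auto
qed

section \<open>Solutions in the weighted spaces\<close>

lemma fock_fun_weighted_iff: "fock_fun x \<in> weighted_fock (real k) \<longleftrightarrow> wfinite japanese_bracket k x"
  by (simp add: weighted_fock_def wfinite_def weighted_eq_weigh)

lemma weighted_norm_fock_fun: "weighted_norm (real k) (fock_fun x) = wnorm japanese_bracket k x"
  by (simp add: weighted_norm_def wnorm_def weighted_eq_weigh)

lemma weighted_fock_fun: "u \<in> weighted_fock s \<Longrightarrow> fock_fun (Fock u) = u"
  by (simp add: weighted_fock_def Fock_inverse)

lemma has_fock_derivative_iff:
  "has_fock_derivative (real k) (\<lambda>\<tau>. fock_fun (x \<tau>)) (fock_fun y) t \<longleftrightarrow>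
    (\<forall>\<tau>. wfinite japanese_bracket k (x \<tau>)) \<and> wfinite japanese_bracket k y \<and>
    ((\<lambda>h. wnorm japanese_bracket k ((1 / h) *\<^sub>R (x (t + h) - x t) - y)) \<longlongrightarrow> 0) (at 0)"
proof -
  have "(\<lambda>z. (fock_fun (x (t + h)) z - fock_fun (x t) z) / complex_of_real h - fock_fun y z)
      = fock_fun ((1 / h) *\<^sub>R (x (t + h) - x t) - y)" for h
    by (simp add: fun_eq_iff)
  then show ?thesis
    by (simp add: has_fock_derivative_def fock_fun_weighted_iff weighted_norm_fock_fun)
qed

lemma has_fock_derivative_imp_vector_derivative:
  assumes "has_fock_derivative (real k) (\<lambda>\<tau>. fock_fun (x \<tau>)) (fock_fun y) t"
  shows "(x has_vector_derivative y) (at t)"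
proof -
  have fin: "\<And>\<tau>. wfinite japanese_bracket k (x \<tau>)" "wfinite japanese_bracket k y"
    and lim: "((\<lambda>h. wnorm japanese_bracket k ((1 / h) *\<^sub>R (x (t + h) - x t) - y)) \<longlongrightarrow> 0) (at 0)"
    using assms unfolding has_fock_derivative_iff by auto
  have "((\<lambda>h. norm (x (t + h) - x t - h *\<^sub>R y) / norm h) \<longlongrightarrow> 0) (at 0)"
  proof (rule Lim_null_comparison[OF _ lim])
    show "\<forall>\<^sub>F h in at 0. norm (norm (x (t + h) - x t - h *\<^sub>R y) / norm h)
        \<le> wnorm japanese_bracket k ((1 / h) *\<^sub>R (x (t + h) - x t) - y)"
      unfolding eventually_at
    proof (intro exI[of _ 1] conjI ballI impI)
      fix h :: real assume "h \<noteq> 0 \<and> dist h 0 < 1"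
      then have h: "h \<noteq> 0" by simp
      let ?q = "(1 / h) *\<^sub>R (x (t + h) - x t) - y"
      have "x (t + h) - x t - h *\<^sub>R y = h *\<^sub>R ?q"
        using h by (simp add: scaleR_right_diff_distrib)
      then have "norm (norm (x (t + h) - x t - h *\<^sub>R y) / norm h) = norm ?q" using h by simp
      also have "\<dots> \<le> wnorm japanese_bracket k ?q"
        using wnorm_mono(2)[OF japanese_bracket_weight, of 0 k ?q] fin
        by (simp add: wnorm_0 wfinite_diff wfinite_scaleR)
      finally show "norm (norm (x (t + h) - x t - h *\<^sub>R y) / norm h) \<le> wnorm japanese_bracket k ?q" .
    qed simp
  qed
  then show ?thesis
    unfolding has_vector_derivative_def has_derivative_at by (simp add: bounded_linear_scaleR_left)
qed

lemma wsmooth_has_fock_derivative: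
  assumes x: "wsmooth k 2 x" and d: "(x has_vector_derivative y) (at t)"
  shows "has_fock_derivative (real k) (\<lambda>\<tau>. fock_fun (x \<tau>)) (fock_fun y) t"
proof -
  obtain x' x'' where x': "\<And>t. (x has_vector_derivative x' t) (at t)" "\<And>t. (x' has_vector_derivative x'' t) (at t)"
    and b: "locally_wbounded k x" "locally_wbounded k x'" "locally_wbounded k x''"
    using x by (auto simp: numeral_2_eq_2)
  have "x' t = y" by (rule vector_derivative_unique_at[OF x'(1) d])
  then show ?thesis
    using weighted_derivative_lift[OF x' b, of t] b(1,2)[THEN locally_wbounded_finite]
    unfolding has_fock_derivative_iff by auto
qed

text \<open>
  Derivatives are unique, so that the finite chains of derivatives for different \<open>n\<close> fit together.
\<close>

lemma wsmooth_imp_smooth_fock_curve: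
  assumes "\<And>n. wsmooth k n x"
  shows "smooth_fock_curve (real k) (\<lambda>t. fock_fun (x t))"
proof -
  define D where "D n = ((\<lambda>y t. vector_derivative y (at t)) ^^ n) x" for n
  have D0: "D 0 = x" and DS: "D (Suc n) = (\<lambda>t. vector_derivative (D n) (at t))" for n
    by (simp_all add: D_def)
  have step: "(\<forall>m. wsmooth k m (\<lambda>t. vector_derivative y (at t))) \<and> (\<forall>t. (y has_vector_derivative vector_derivative y (at t)) (at t))"
    if "\<And>m. wsmooth k m y" for y
  proof -
    have "\<exists>y'. (\<forall>t. (y has_vector_derivative y' t) (at t)) \<and> wsmooth k m y'" for m
      using that[of "Suc m"] by simp
    then obtain y' where y': "\<And>m t. (y has_vector_derivative y' m t) (at t)" "\<And>m. wsmooth k m (y' m)" by metis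
    have eq: "vector_derivative y (at t) = y' m t" for m t by (rule vector_derivative_at[OF y'(1)])
    have "wsmooth k m (\<lambda>t. vector_derivative y (at t))" for m
      using y'(2)[of m] by (simp add: eq[of _ m])
    moreover have "(y has_vector_derivative vector_derivative y (at t)) (at t)" for t
      using y'(1)[of 0 t] by (simp add: eq[of t 0])
    ultimately show ?thesis by blast
  qed
  have sm: "\<forall>m. wsmooth k m (D n)" for n
    by (induction n) (use assms step in \<open>auto simp: D0 DS\<close>)
  show ?thesis
    unfolding smooth_fock_curve_def
  proof (intro exI[of _ "\<lambda>n t. fock_fun (D n t)"] conjI allI)
    show "has_fock_derivative (real k) (\<lambda>t. fock_fun (D n t)) (fock_fun (D (Suc n) t)) t" for n t
      using sm step unfolding DS by (intro wsmooth_has_fock_derivative) blast+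
  qed (simp add: D0)
qed

lemma fock_fun_tri_mass:
  "fock_fun (fock_tri v v u) z = - \<i> * fock_projection (\<lambda>w. mass (fock_fun v) w * fock_fun u w) z"
  unfolding fock_fun_tri by (simp only: complex_norm_square)

lemma fock_solution_is_smooth_solution:
  assumes s: "fock_solution u v" and fin: "wfinite japanese_bracket k (u 0)" "wfinite japanese_bracket k (v 0)"
  shows "is_smooth_solution (real k) (fock_fun (u 0)) (fock_fun (v 0)) (\<lambda>t. fock_fun (u t)) (\<lambda>t. fock_fun (v t))"
  unfolding is_smooth_solution_def
proof (intro conjI allI)
  have sm: "wsmooth k n u" "wsmooth k n v" for n using fock_solution_wsmooth[OF s fin] by auto
  show "smooth_fock_curve (real k) (\<lambda>t. fock_fun (u t))" "smooth_fock_curve (real k) (\<lambda>t. fock_fun (v t))"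
    by (intro wsmooth_imp_smooth_fock_curve sm)+
  fix t
  have "has_fock_derivative (real k) (\<lambda>t. fock_fun (u t)) (fock_fun (fock_tri (v t) (v t) (u t))) t"
    "has_fock_derivative (real k) (\<lambda>t. fock_fun (v t)) (fock_fun (- fock_tri (u t) (u t) (v t))) t"
    using s by (auto intro!: wsmooth_has_fock_derivative sm simp: fock_solution_def)
  then show "\<exists>u' v'. has_fock_derivative (real k) (\<lambda>t. fock_fun (u t)) u' t \<and> has_fock_derivative (real k) (\<lambda>t. fock_fun (v t)) v' t \<and>
      (\<forall>z. \<i> * u' z = fock_projection (\<lambda>w. mass (fock_fun (v t)) w * fock_fun (u t) w) z) \<and>
      (\<forall>z. \<i> * v' z = - fock_projection (\<lambda>w. mass (fock_fun (u t)) w * fock_fun (v t) w) z)"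
    by (intro exI conjI allI) (assumption, assumption, simp_all add: fock_fun_tri_mass flip: mult.assoc)
qed auto

text \<open>
  The weighted norm dominates the unweighted one. Solutions in the weighted space therefore solve the system in
  the Fock space, where they are unique.
\<close>

lemma is_smooth_solution_fock_solution:
  assumes sol: "is_smooth_solution (real k) u0 v0 u1 v1"
  obtains u v where "u1 = (\<lambda>t. fock_fun (u t))" "v1 = (\<lambda>t. fock_fun (v t))" "fock_solution u v"
proof
  define u where "u t = Fock (u1 t)" for t
  define v where "v t = Fock (v1 t)" for t
  have mem: "y t \<in> weighted_fock (real k)" if "smooth_fock_curve (real k) y" for y t
    using that unfolding smooth_fock_curve_def has_fock_derivative_def by blast
  show u: "u1 = (\<lambda>t. fock_fun (u t))" and v: "v1 = (\<lambda>t. fock_fun (v t))"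
    using sol by (auto simp: u_def v_def is_smooth_solution_def weighted_fock_fun[OF mem])
  show "fock_solution u v"
    unfolding fock_solution_def
  proof (intro conjI allI)
    fix t
    obtain u' v' where d: "has_fock_derivative (real k) (\<lambda>t. fock_fun (u t)) u' t" "has_fock_derivative (real k) (\<lambda>t. fock_fun (v t)) v' t"
      and eq: "\<And>z. \<i> * u' z = fock_projection (\<lambda>w. mass (fock_fun (v t)) w * fock_fun (u t) w) z"
        "\<And>z. \<i> * v' z = - fock_projection (\<lambda>w. mass (fock_fun (u t)) w * fock_fun (v t) w) z"
      using sol unfolding is_smooth_solution_def u v by metis
    have f: "fock_fun (Fock u') = u'" "fock_fun (Fock v') = v'"
      using d by (auto simp: has_fock_derivative_def intro: weighted_fock_fun)
    have "Fock u' = fock_tri (v t) (v t) (u t)"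
      by (rule fock_eqI) (simp only: f fock_fun_tri_mass eq(1)[symmetric], simp flip: mult.assoc)
    then show "(u has_vector_derivative fock_tri (v t) (v t) (u t)) (at t)"
      using has_fock_derivative_imp_vector_derivative[of k u "Fock u'" t, unfolded f, OF d(1)] by simp
    have "Fock v' = - fock_tri (u t) (u t) (v t)"
    proof (rule fock_eqI)
      fix z
      have "fock_projection (\<lambda>w. mass (fock_fun (u t)) w * fock_fun (v t) w) z = - (\<i> * v' z)" by (simp add: eq(2))
      then show "fock_fun (Fock v') z = fock_fun (- fock_tri (u t) (u t) (v t)) z"
        by (simp add: f fock_fun_tri_mass flip: mult.assoc)
    qed
    then show "(v has_vector_derivative - fock_tri (u t) (u t) (v t)) (at t)"
      using has_fock_derivative_imp_vector_derivative[of k v "Fock v'" t, unfolded f, OF d(2)] by simp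
  qed
qed

section \<open>The difference of the weighted norms\<close>

text \<open>
  The full weight is unbounded and its inner product is not continuous on the Fock space; here the
  difference quotient converges in the weighted norm itself.
\<close>

lemma wnorm_sq_derivative:
  assumes "has_fock_derivative (real k) (\<lambda>\<tau>. fock_fun (x \<tau>)) (fock_fun y) t"
  shows "((\<lambda>t. (wnorm japanese_bracket k (x t))\<^sup>2) has_real_derivative 2 * winner japanese_bracket k (x t) y) (at t)"
proof -
  let ?p = "wnorm japanese_bracket k" and ?B = "winner japanese_bracket k"
  define q where "q h = (1 / h) *\<^sub>R (x (t + h) - x t) - y" for h
  have fin: "\<And>\<tau>. wfinite japanese_bracket k (x \<tau>)" "wfinite japanese_bracket k y"
    and lim: "((\<lambda>h. ?p (q h)) \<longlongrightarrow> 0) (at 0)"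
    using assms unfolding has_fock_derivative_iff q_def by auto
  have fq: "wfinite japanese_bracket k (q h)" for h unfolding q_def by (intro wfinite_diff wfinite_scaleR fin)
  have bound: "norm (((?p (x (t + h)))\<^sup>2 - (?p (x t))\<^sup>2) / h - 2 * ?B (x t) y)
      \<le> 2 * ?p (x t) * ?p (q h) + \<bar>h\<bar> * (?p (q h) + ?p y)\<^sup>2" if h: "h \<noteq> 0" for h
  proof -
    define r where "r = q h + y"
    have fr: "wfinite japanese_bracket k r" unfolding r_def by (intro wfinite_add fq fin)
    have xh: "x (t + h) = x t + h *\<^sub>R r" using h by (simp add: r_def q_def)
    \<comment> \<open>Expansion of the quadratic form along the chord; \<open>r\<close> is the difference quotient itself.\<close>
    have lin: "?B (x t + h *\<^sub>R r) z = ?B (x t) z + h * ?B r z" if "wfinite japanese_bracket k z" for z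
      using winner_add_left[OF fin(1)[of t] wfinite_scaleR[OF fr, of h] that] by (simp add: winner_scaleR_left)
    have "(?p (x (t + h)))\<^sup>2 = ?B (x t + h *\<^sub>R r) (x t + h *\<^sub>R r)" by (simp only: xh winner_self)
    also have "\<dots> = ?B (x t + h *\<^sub>R r) (x t) + h * ?B (x t + h *\<^sub>R r) r"
      unfolding lin[OF wfinite_add[OF fin(1)[of t] wfinite_scaleR[OF fr, of h]]]
      by (simp only: winner_commute[of _ _ _ "x t + h *\<^sub>R r"])
    also have "\<dots> = ?B (x t) (x t) + 2 * h * ?B (x t) r + h * h * ?B r r"
      unfolding lin[OF fin(1)[of t]] lin[OF fr] winner_commute[of _ _ r "x t"] by (simp add: algebra_simps)
    finally have "((?p (x (t + h)))\<^sup>2 - (?p (x t))\<^sup>2) / h = 2 * ?B (x t) r + h * (?p r)\<^sup>2"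
      using h by (simp add: winner_self field_simps)
    also have "?B (x t) r = ?B (x t) (q h) + ?B (x t) y"
      using winner_add_left[OF fq[of h] fin(2) fin(1)[of t]] by (simp add: r_def winner_commute[of _ _ "x t"])
    finally have "norm (((?p (x (t + h)))\<^sup>2 - (?p (x t))\<^sup>2) / h - 2 * ?B (x t) y) = \<bar>2 * ?B (x t) (q h) + h * (?p r)\<^sup>2\<bar>"
      by simp
    also have "\<dots> \<le> \<bar>2 * ?B (x t) (q h)\<bar> + \<bar>h * (?p r)\<^sup>2\<bar>" by (rule abs_triangle_ineq)
    also have "\<dots> \<le> 2 * (?p (x t) * ?p (q h)) + \<bar>h\<bar> * (?p (q h) + ?p y)\<^sup>2"
    proof (rule add_mono)
      show "\<bar>2 * ?B (x t) (q h)\<bar> \<le> 2 * (?p (x t) * ?p (q h))" using winner_bound[OF fin(1) fq] by (simp add: abs_mult)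
      show "\<bar>h * (?p r)\<^sup>2\<bar> \<le> \<bar>h\<bar> * (?p (q h) + ?p y)\<^sup>2"
        unfolding abs_mult by (simp add: mult_left_mono power_mono r_def wnorm_add[OF fq fin(2)])
    qed
    finally show ?thesis by (simp add: mult.assoc)
  qed
  have "((\<lambda>h. ((?p (x (t + h)))\<^sup>2 - (?p (x t))\<^sup>2) / h - 2 * ?B (x t) y) \<longlongrightarrow> 0) (at 0)"
  proof (rule Lim_null_comparison)
    show "\<forall>\<^sub>F h in at 0. norm (((?p (x (t + h)))\<^sup>2 - (?p (x t))\<^sup>2) / h - 2 * ?B (x t) y)
        \<le> 2 * ?p (x t) * ?p (q h) + \<bar>h\<bar> * (?p (q h) + ?p y)\<^sup>2"
      unfolding eventually_at by (intro exI[of _ 1] conjI ballI impI bound) auto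
    show "((\<lambda>h. 2 * ?p (x t) * ?p (q h) + \<bar>h\<bar> * (?p (q h) + ?p y)\<^sup>2) \<longlongrightarrow> 0) (at 0)"
      by (auto intro!: tendsto_eq_intros lim)
  qed
  then show ?thesis by (simp add: DERIV_def LIM_zero_iff)
qed

lemma difference_derivative:
  assumes s: "fock_solution u v" and fin: "wfinite japanese_bracket k (u 0)" "wfinite japanese_bracket k (v 0)"
  shows "((\<lambda>t. (wnorm japanese_bracket k (u t))\<^sup>2 - (wnorm japanese_bracket k (v t))\<^sup>2) has_real_derivative
    2 * (weighted_current japanese_bracket k (fock_fun (u t)) (fock_fun (v t)) +
      weighted_current japanese_bracket k (fock_fun (v t)) (fock_fun (u t)))) (at t)"
proof -
  have sm: "wsmooth k 2 u" "wsmooth k 2 v" using fock_solution_wsmooth[OF s fin] by auto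
  note g = fock_solution_growth(1,2)[OF s fin]
  have du: "((\<lambda>t. (wnorm japanese_bracket k (u t))\<^sup>2) has_real_derivative 2 * winner japanese_bracket k (u t) (fock_tri (v t) (v t) (u t))) (at t)"
    by (rule wnorm_sq_derivative[OF wsmooth_has_fock_derivative[OF sm(1)]]) (use s in \<open>simp add: fock_solution_def\<close>)
  have dv: "((\<lambda>t. (wnorm japanese_bracket k (v t))\<^sup>2) has_real_derivative 2 * winner japanese_bracket k (v t) (- fock_tri (u t) (u t) (v t))) (at t)"
    by (rule wnorm_sq_derivative[OF wsmooth_has_fock_derivative[OF sm(2)]]) (use s in \<open>simp add: fock_solution_def\<close>)
  have "winner japanese_bracket k (v t) (- fock_tri (u t) (u t) (v t)) = - winner japanese_bracket k (v t) (fock_tri (u t) (u t) (v t))"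
    using winner_scaleR_left[of japanese_bracket k "-1" "fock_tri (u t) (u t) (v t)" "v t"] by (simp add: winner_commute[of _ _ "v t"])
  then show ?thesis
    using DERIV_diff[OF du dv] winner_tri[OF japanese_bracket_weight g(1), of t "v t"] winner_tri[OF japanese_bracket_weight g(2), of t "u t"]
    by simp
qed

lemma growth_square_bound:
  fixes a A t w :: real
  assumes "0 \<le> w" "w \<le> a * (1 + A * \<bar>t\<bar>) ^ j" "0 \<le> A" "0 \<le> a"
  shows "w\<^sup>2 \<le> (a * (1 + A) ^ j)\<^sup>2 * (1 + \<bar>t\<bar>) ^ (2 * j)"
proof -
  have "1 + A * \<bar>t\<bar> \<le> (1 + A) * (1 + \<bar>t\<bar>)" using assms by (simp add: algebra_simps)
  then have "(1 + A * \<bar>t\<bar>) ^ j \<le> ((1 + A) * (1 + \<bar>t\<bar>)) ^ j" using assms by (intro power_mono) auto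
  then have "a * (1 + A * \<bar>t\<bar>) ^ j \<le> a * ((1 + A) * (1 + \<bar>t\<bar>)) ^ j" using assms by (intro mult_left_mono) auto
  with assms have "w \<le> a * ((1 + A) * (1 + \<bar>t\<bar>)) ^ j" by simp
  then have "w\<^sup>2 \<le> (a * ((1 + A) * (1 + \<bar>t\<bar>)) ^ j)\<^sup>2" using assms by (intro power_mono)
  then show ?thesis by (simp add: power_mult_distrib power_mult[symmetric] mult_ac)
qed

text \<open>
  The derivative of the difference is bounded through \<open>current_cancellation\<close> by weighted norms of order \<open>k - 1\<close>,
  whose growth is known; then the mean value theorem applies.
\<close>

lemma difference_growth:
  assumes s: "fock_solution u v" and fin: "wfinite japanese_bracket k (u 0)" "wfinite japanese_bracket k (v 0)"
  shows "\<exists>K. \<forall>t. \<bar>((wnorm japanese_bracket k (u t))\<^sup>2 - (wnorm japanese_bracket k (v t))\<^sup>2) -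
      ((wnorm japanese_bracket k (u 0))\<^sup>2 - (wnorm japanese_bracket k (v 0))\<^sup>2)\<bar>
    \<le> taylor_const k * K * (1 + \<bar>t\<bar>) ^ (2 * (k - 1)) * \<bar>t\<bar>"
proof -
  define j where "j = k - 1"
  define D where "D t = (wnorm japanese_bracket k (u t))\<^sup>2 - (wnorm japanese_bracket k (v t))\<^sup>2" for t
  define c where "c t = weighted_current japanese_bracket k (fock_fun (u t)) (fock_fun (v t)) +
      weighted_current japanese_bracket k (fock_fun (v t)) (fock_fun (u t))" for t
  define a where "a = (norm (v 0))\<^sup>2 * (wnorm japanese_bracket j (u 0) * (1 + growth_const j * (norm (v 0))\<^sup>2) ^ j)\<^sup>2"
  define b where "b = (norm (u 0))\<^sup>2 * (wnorm japanese_bracket j (v 0) * (1 + growth_const j * (norm (u 0))\<^sup>2) ^ j)\<^sup>2"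
  define K where "K = 2 * schur_const (2 * k) * (a + b)"
  have ab: "a \<ge> 0" "b \<ge> 0" by (simp_all add: a_def b_def)
  have K0: "K \<ge> 0" using ab by (simp add: K_def)
  have finj: "wfinite japanese_bracket j (u 0)" "wfinite japanese_bracket j (v 0)"
    using fin wnorm_mono(1)[OF japanese_bracket_weight, of "k - 1" k] by (simp_all add: j_def)
  note g = fock_solution_growth(1,2)[OF s fin] and gj = fock_solution_growth(3,4)[OF s finj]
  have gc: "0 \<le> growth_const j * N\<^sup>2" for N :: real using growth_const_pos[of j] by simp
  have cb: "\<bar>2 * c t\<bar> \<le> taylor_const k * K * (1 + \<bar>t\<bar>) ^ (2 * j)" for t
  proof -
    have "\<bar>c t\<bar> \<le> taylor_const k * schur_const (2 * k) *
        ((norm (v t))\<^sup>2 * (wnorm japanese_bracket j (u t))\<^sup>2 + (norm (u t))\<^sup>2 * (wnorm japanese_bracket j (v t))\<^sup>2)"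
      using current_cancellation[OF fock_fun_in fock_fun_in g(1)[unfolded wfinite_def] g(2)[unfolded wfinite_def], of t t]
      unfolding c_def j_def wnorm_def norm_fock_def .
    also have "\<dots> = taylor_const k * schur_const (2 * k) *
        ((norm (v 0))\<^sup>2 * (wnorm japanese_bracket j (u t))\<^sup>2 + (norm (u 0))\<^sup>2 * (wnorm japanese_bracket j (v t))\<^sup>2)"
      by (simp only: fock_solution_norms(1)[OF s, of t] fock_solution_norms(2)[OF s, of t])
    also have "\<dots> \<le> taylor_const k * schur_const (2 * k) * (a * (1 + \<bar>t\<bar>) ^ (2 * j) + b * (1 + \<bar>t\<bar>) ^ (2 * j))"
      unfolding a_def b_def mult.assoc[of "(norm _)\<^sup>2"]
      by (intro mult_left_mono add_mono growth_square_bound gj gc) auto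
    finally show ?thesis by (simp add: K_def abs_mult algebra_simps)
  qed
  have "\<bar>D t - D 0\<bar> \<le> taylor_const k * K * (1 + \<bar>t\<bar>) ^ (2 * j) * \<bar>t\<bar>" for t
  proof -
    have "norm (D t - D 0) \<le> (taylor_const k * K * (1 + \<bar>t\<bar>) ^ (2 * j)) * norm (t - 0)"
    proof (rule field_differentiable_bound[of "{- \<bar>t\<bar>..\<bar>t\<bar>}"])
      show "(D has_real_derivative 2 * c \<tau>) (at \<tau> within {- \<bar>t\<bar>..\<bar>t\<bar>})" for \<tau>
        unfolding D_def[abs_def] c_def by (rule DERIV_subset[OF difference_derivative[OF s fin]]) simp
      show "norm (2 * c \<tau>) \<le> taylor_const k * K * (1 + \<bar>t\<bar>) ^ (2 * j)" if "\<tau> \<in> {- \<bar>t\<bar>..\<bar>t\<bar>}" for \<tau>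
      proof -
        have "norm (2 * c \<tau>) \<le> taylor_const k * K * (1 + \<bar>\<tau>\<bar>) ^ (2 * j)" using cb[of \<tau>] by simp
        also have "\<dots> \<le> taylor_const k * K * (1 + \<bar>t\<bar>) ^ (2 * j)"
          using that K0 by (intro mult_left_mono power_mono) auto
        finally show ?thesis .
      qed
    qed auto
    then show ?thesis by simp
  qed
  then show ?thesis unfolding D_def j_def by blast
qed

theorem theorem1p5:
  fixes k :: nat
  shows "\<exists>C::real. C > 0 \<and>
    (\<forall>u0 \<in> weighted_fock (real k). \<forall>v0 \<in> weighted_fock (real k).
      \<exists>u v. is_smooth_solution (real k) u0 v0 u v \<and>
        (\<forall>u1 v1. is_smooth_solution (real k) u0 v0 u1 v1 \<longrightarrow> u1 = u \<and> v1 = v) \<and>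
        (\<forall>t. weighted_norm (real k) (u t)
               \<le> weighted_norm (real k) u0 * (1 + C * (L2_norm v0)\<^sup>2 * \<bar>t\<bar>) ^ k) \<and>
        (\<forall>t. weighted_norm (real k) (v t)
               \<le> weighted_norm (real k) v0 * (1 + C * (L2_norm u0)\<^sup>2 * \<bar>t\<bar>) ^ k) \<and>
        (k \<ge> 2 \<longrightarrow> (\<exists>C'. \<forall>t.
           \<bar>(weighted_norm (real k) (u t))\<^sup>2 - (weighted_norm (real k) (v t))\<^sup>2\<bar>
             \<le> C' * (1 + \<bar>t\<bar>) ^ (2 * k - 1))) \<and>
        (k = 0 \<or> k = 1 \<longrightarrow> (\<exists>C'. \<forall>t.
           \<bar>(weighted_norm (real k) (u t))\<^sup>2 - (weighted_norm (real k) (v t))\<^sup>2\<bar> \<le> C')))"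
proof (intro exI[of _ "growth_const k"] conjI growth_const_pos ballI)
  fix u0 v0 assume u0: "u0 \<in> weighted_fock (real k)" and v0: "v0 \<in> weighted_fock (real k)"
  define U0 where "U0 = Fock u0"
  define V0 where "V0 = Fock v0"
  have U0: "u0 = fock_fun U0" and V0: "v0 = fock_fun V0"
    using weighted_fock_fun[OF u0] weighted_fock_fun[OF v0] by (simp_all add: U0_def V0_def)
  obtain u v where s: "fock_solution u v" and init: "u 0 = U0" "v 0 = V0"
    using fock_solution_exists by blast
  have fin: "wfinite japanese_bracket k (u 0)" "wfinite japanese_bracket k (v 0)"
    using u0 v0 unfolding U0 V0 fock_fun_weighted_iff init .
  define D where "D t = (wnorm japanese_bracket k (u t))\<^sup>2 - (wnorm japanese_bracket k (v t))\<^sup>2" for t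
  obtain K where K: "\<And>t. \<bar>D t - D 0\<bar> \<le> taylor_const k * K * (1 + \<bar>t\<bar>) ^ (2 * (k - 1)) * \<bar>t\<bar>"
    using difference_growth[OF s fin] unfolding D_def by blast
  show "\<exists>u v. is_smooth_solution (real k) u0 v0 u v \<and>
        (\<forall>u1 v1. is_smooth_solution (real k) u0 v0 u1 v1 \<longrightarrow> u1 = u \<and> v1 = v) \<and>
        (\<forall>t. weighted_norm (real k) (u t)
               \<le> weighted_norm (real k) u0 * (1 + growth_const k * (L2_norm v0)\<^sup>2 * \<bar>t\<bar>) ^ k) \<and>
        (\<forall>t. weighted_norm (real k) (v t)
               \<le> weighted_norm (real k) v0 * (1 + growth_const k * (L2_norm u0)\<^sup>2 * \<bar>t\<bar>) ^ k) \<and>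
        (k \<ge> 2 \<longrightarrow> (\<exists>C'. \<forall>t.
           \<bar>(weighted_norm (real k) (u t))\<^sup>2 - (weighted_norm (real k) (v t))\<^sup>2\<bar>
             \<le> C' * (1 + \<bar>t\<bar>) ^ (2 * k - 1))) \<and>
        (k = 0 \<or> k = 1 \<longrightarrow> (\<exists>C'. \<forall>t.
           \<bar>(weighted_norm (real k) (u t))\<^sup>2 - (weighted_norm (real k) (v t))\<^sup>2\<bar> \<le> C'))"
  proof (rule exI[of _ "\<lambda>t. fock_fun (u t)"], rule exI[of _ "\<lambda>t. fock_fun (v t)"],
      unfold weighted_norm_fock_fun, intro conjI allI impI)
    show "is_smooth_solution (real k) u0 v0 (\<lambda>t. fock_fun (u t)) (\<lambda>t. fock_fun (v t))"
      using fock_solution_is_smooth_solution[OF s fin] by (simp add: init U0 V0)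
    fix u1 v1 assume sol: "is_smooth_solution (real k) u0 v0 u1 v1"
    obtain u' v' where uv: "u1 = (\<lambda>t. fock_fun (u' t))" "v1 = (\<lambda>t. fock_fun (v' t))" and s': "fock_solution u' v'"
      by (rule is_smooth_solution_fock_solution[OF sol])
    have "u1 0 = u0" "v1 0 = v0" using sol by (simp_all add: is_smooth_solution_def)
    then have "u' 0 = u 0" "v' 0 = v 0" unfolding uv U0 V0 init by (simp_all add: fock_fun_inject)
    then have "u' t = u t \<and> v' t = v t" for t by (rule fock_solution_unique[OF s' s])
    then show "u1 = (\<lambda>t. fock_fun (u t))" "v1 = (\<lambda>t. fock_fun (v t))" by (simp_all add: uv)
  next
    fix t
    show "wnorm japanese_bracket k (u t) \<le> weighted_norm (real k) u0 * (1 + growth_const k * (L2_norm v0)\<^sup>2 * \<bar>t\<bar>) ^ k"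
      "wnorm japanese_bracket k (v t) \<le> weighted_norm (real k) v0 * (1 + growth_const k * (L2_norm u0)\<^sup>2 * \<bar>t\<bar>) ^ k"
      using fock_solution_growth(3,4)[OF s fin, of t] by (simp_all add: init U0 V0 weighted_norm_fock_fun norm_fock_def)
  next
    assume k: "2 \<le> k"
    have "\<bar>D t\<bar> \<le> (\<bar>D 0\<bar> + taylor_const k * \<bar>K\<bar>) * (1 + \<bar>t\<bar>) ^ (2 * k - 1)" for t
    proof -
      have "taylor_const k * K * (1 + \<bar>t\<bar>) ^ (2 * (k - 1)) * \<bar>t\<bar> \<le> taylor_const k * \<bar>K\<bar> * (1 + \<bar>t\<bar>) ^ (2 * (k - 1)) * (1 + \<bar>t\<bar>)"
        by (intro mult_mono mult_left_mono) auto
      also have "\<dots> = taylor_const k * \<bar>K\<bar> * (1 + \<bar>t\<bar>) ^ Suc (2 * (k - 1))" by simp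
      also have "Suc (2 * (k - 1)) = 2 * k - 1" using k by simp
      finally have "\<bar>D t - D 0\<bar> \<le> taylor_const k * \<bar>K\<bar> * (1 + \<bar>t\<bar>) ^ (2 * k - 1)" using K[of t] by linarith
      moreover have "\<bar>D 0\<bar> * 1 \<le> \<bar>D 0\<bar> * (1 + \<bar>t\<bar>) ^ (2 * k - 1)" by (intro mult_left_mono one_le_power) auto
      ultimately show ?thesis unfolding distrib_right by linarith
    qed
    then show "\<exists>C'. \<forall>t. \<bar>(wnorm japanese_bracket k (u t))\<^sup>2 - (wnorm japanese_bracket k (v t))\<^sup>2\<bar> \<le> C' * (1 + \<bar>t\<bar>) ^ (2 * k - 1)"
      unfolding D_def by blast
  next
    assume "k = 0 \<or> k = 1"
    then have "taylor_const k = 0" by (auto simp: taylor_const_def)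
    then have "\<bar>D t\<bar> \<le> \<bar>D 0\<bar>" for t using K[of t] by simp
    then show "\<exists>C'. \<forall>t. \<bar>(wnorm japanese_bracket k (u t))\<^sup>2 - (wnorm japanese_bracket k (v t))\<^sup>2\<bar> \<le> C'"
      unfolding D_def by blast
  qed
qed

end
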